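(* Let $1<p<\infty$ and let $B$ be any ball in $\mathbb{R}^d$. Then: (i) if $0<q<1$, then $\sup\{F_{p,q}(\Omega) : \Omega\subset\mathbb{R}^d \text{ open},\ 0<|\Omega|<\infty\}=+\infty$; (ii) if $q\ge1$, then $\sup\{F_{p,q}(\Omega) : \Omega\subset\mathbb{R}^d \text{ open},\ 0<|\Omega|<\infty\}\le \dfrac{T_p(B)^{q-1}}{|B|^{(q-1)(p-1+p/d)}}$.
   Context: $|\Omega|$ is the Lebesgue measure. For $\Omega\subset\mathbb{R}^d$ open with $0<|\Omega|<\infty$ and $1<p<\infty$, $W^{1,p}_0(\Omega)$ is the completion of $C_c^\infty(\Omega)$ with respect to the norm $\|\nabla u\|_{L^p(\Omega)}$. The $p$-torsional rigidity is $$T_p(\Omega)=\max\Big\{\Big[\int_\Omega|u|\,dx\Big]^p\Big[\int_\Omega|\nabla u|^p\,dx\Big]^{-1} : u\in W^{1,p}_0(\Omega),\ u\neq0\Big\},$$ and the $p$-principal eigenvalue is $$\lambda_p(\Omega)=\min\Big\{\Big[\int_\Omega|\nabla u|^p\,dx\Big]\Big[\int_\Omega|u|^p\,dx\Big]^{-1} : u\in W^{1,p}_0(\Omega),\ u\neq0\Big\}.$$ For $q>0$ the scaling invariant functional $F_{p,q}$ is $$F_{p,q}(\Omega)=\frac{\lambda_p(\Omega)\,T_p(\Omega)^q}{|\Omega|^{\alpha(p,q,d)}},\qquad \alpha(p,q,d)=q(p-1)+\frac{p(q-1)}{d}.$$ *)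

theory Defs
  imports "HOL-Analysis.Analysis"
begin

primrec Ck :: "nat \<Rightarrow> ('a::euclidean_space \<Rightarrow> real) \<Rightarrow> bool" where
  "Ck 0 f \<longleftrightarrow> continuous_on UNIV f"
| "Ck (Suc n) f \<longleftrightarrow> (\<forall>x. f differentiable (at x)) \<and>
     (\<forall>b\<in>Basis. Ck n (\<lambda>x. frechet_derivative f (at x) b))"

definition grad :: "('a::euclidean_space \<Rightarrow> real) \<Rightarrow> 'a \<Rightarrow> 'a" where
  "grad f x = (\<Sum>b\<in>Basis. frechet_derivative f (at x) b *\<^sub>R b)"

definition test_functions :: "'a::euclidean_space set \<Rightarrow> ('a \<Rightarrow> real) set" where
  "test_functions \<Omega> =
     {\<phi>. (\<forall>n. Ck n \<phi>) \<and> compact (closure {x. \<phi> x \<noteq> 0}) \<and> closure {x. \<phi> x \<noteq> 0} \<subseteq> \<Omega>}"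

definition Lp_on ::
  "real \<Rightarrow> 'a::euclidean_space set \<Rightarrow> ('a \<Rightarrow> 'b::euclidean_space) set" where
  "Lp_on p \<Omega> = {f. f \<in> borel_measurable (lebesgue_on \<Omega>) \<and>
     integrable (lebesgue_on \<Omega>) (\<lambda>x. norm (f x) powr p)}"

definition Lp_tendsto ::
  "real \<Rightarrow> 'a::euclidean_space set \<Rightarrow> (nat \<Rightarrow> 'a \<Rightarrow> 'b::euclidean_space) \<Rightarrow> ('a \<Rightarrow> 'b) \<Rightarrow> bool" where
  "Lp_tendsto p \<Omega> f g \<longleftrightarrow>
     (\<lambda>n. \<integral>\<^sup>+x. ennreal (norm (f n x - g x) powr p) \<partial>lebesgue_on \<Omega>) \<longlonglongrightarrow> 0"

(* The completion of the test functions under the norm of grad u in Lp, realised as functions on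
   \<Omega>: the pairs (u, g) with u in the space and g = grad u. When \<Omega> has finite measure, the Poincare
   inequality makes a sequence of test functions that is Cauchy for the gradient norm Cauchy in Lp
   as well, so every element of the abstract completion is such a pair, and integration by parts
   shows that u determines g almost everywhere. Functions are not identified when they agree
   almost everywhere. *)
definition W0 :: "real \<Rightarrow> 'a::euclidean_space set \<Rightarrow> (('a \<Rightarrow> real) \<times> ('a \<Rightarrow> 'a)) set" where
  "W0 p \<Omega> = {(u, g). u \<in> Lp_on p \<Omega> \<and> g \<in> Lp_on p \<Omega> \<and>
     (\<exists>\<phi>. (\<forall>n. \<phi> n \<in> test_functions \<Omega>) \<and>
          Lp_tendsto p \<Omega> \<phi> u \<and> Lp_tendsto p \<Omega> (\<lambda>n. grad (\<phi> n)) g)}"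

definition nonzero_on :: "'a::euclidean_space set \<Rightarrow> ('a \<Rightarrow> real) \<Rightarrow> bool" where
  "nonzero_on \<Omega> u \<longleftrightarrow> \<not> (AE x in lebesgue_on \<Omega>. u x = 0)"

(* On open sets of finite positive measure both extrema are attained, and the set in the
   supremum is bounded above by the Poincare inequality, so Sup and Inf on the reals are the
   maximum and the minimum. *)
definition torsion :: "real \<Rightarrow> 'a::euclidean_space set \<Rightarrow> real" where
  "torsion p \<Omega> = Sup {(\<integral>x. \<bar>u x\<bar> \<partial>lebesgue_on \<Omega>) powr p
       * inverse (\<integral>x. norm (g x) powr p \<partial>lebesgue_on \<Omega>)
     | u g. (u, g) \<in> W0 p \<Omega> \<and> nonzero_on \<Omega> u}"

definition eigenvalue :: "real \<Rightarrow> 'a::euclidean_space set \<Rightarrow> real" where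
  "eigenvalue p \<Omega> = Inf {(\<integral>x. norm (g x) powr p \<partial>lebesgue_on \<Omega>)
       * inverse (\<integral>x. \<bar>u x\<bar> powr p \<partial>lebesgue_on \<Omega>)
     | u g. (u, g) \<in> W0 p \<Omega> \<and> nonzero_on \<Omega> u}"

definition alpha :: "real \<Rightarrow> real \<Rightarrow> nat \<Rightarrow> real" where
  "alpha p q d = q * (p - 1) + p * (q - 1) / real d"

definition F :: "real \<Rightarrow> real \<Rightarrow> 'a::euclidean_space set \<Rightarrow> real" where
  "F p q \<Omega> = eigenvalue p \<Omega> * torsion p \<Omega> powr q / measure lebesgue \<Omega> powr alpha p q DIM('a)"

definition admissible :: "'a::euclidean_space set set" where
  "admissible = {\<Omega>. open \<Omega> \<and> 0 < emeasure lebesgue \<Omega> \<and> emeasure lebesgue \<Omega> < \<infinity>}"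

end

theory Submission
  imports Defs
begin

text \<open>For \<open>q < 1\<close> the supremum is infinite along unions of \<open>N\<close> distant unit balls: their eigenvalue is bounded
  below, their torsional rigidity grows like \<open>N powr (p - 1)\<close> and their volume like \<open>N\<close>.

  For \<open>1 \<le> q\<close> the functional factors as \<open>\<lambda> T / vol powr (p - 1)\<close>, which is at most 1 by Hoelder's inequality, times
  the power \<open>q - 1\<close> of \<open>T / vol powr (p - 1 + p / d)\<close>, which is maximal for balls (Saint-Venant). The latter is proved
  without rearrangements. Let \<open>R s\<close> be the radius of the ball with the volume of the superlevel set
  \<open>{\<bar>\<phi>\<bar> > s}\<close>. Applying Brunn--Minkowski to these sets and balls of radius \<open>t * R s\<close> with small
  \<open>t\<close> gives \<open>d * \<integral> \<bar>\<phi>\<bar> \<le> \<integral> R \<bar>\<phi>\<bar> * norm (grad \<phi>)\<close>. Now apply Hoelder's inequality; the moment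
  \<open>\<integral> (R \<bar>\<phi>\<bar>) powr (p / (p - 1))\<close> over the domain is at most that of \<open>norm\<close> over the ball of the same
  volume. All steps are equalities in the limit for \<open>\<phi> x = r powr (p / (p - 1)) - norm x powr (p / (p - 1))\<close> on the
  ball of radius \<open>r\<close>.\<close>

section \<open>The Brunn--Minkowski inequality\<close>

text \<open>Brunn--Minkowski applies to every open bounded set, hence also at critical levels, where
  a superlevel set of a test function can have an irregular boundary. The resulting bound on the
  torsion depends on the domain only through its volume radius and is homogeneous in it, so one
  constant compares a domain with a ball of any radius. Upper bounds are proved for every competitor
  in the quotients; on the ball only the supremum has to be bounded from below, and approximating
  test functions do that. Their mass and energy tend to multiples of one moment of
  \<open>norm\<close> with exponent \<open>p / (p - 1)\<close>, the Hoelder conjugate of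
  \<open>p\<close>, and this moment is the one left over by Hoelder's inequality in the upper bound.
  For \<open>q < 1\<close> the eigenvalue of the union of balls is bounded below by a
  one-dimensional Poincare inequality along a line, whose constant depends on the gap length and not
  on the number \<open>N\<close> of balls. Torsion contributes \<open>N powr ((p - 1) * q)\<close>
  and volume \<open>N powr alpha p q d\<close>; the difference of the exponents is
  \<open>p * (1 - q) / d\<close>, positive exactly for \<open>q < 1\<close>.\<close>

abbreviation vol :: "'a::euclidean_space set \<Rightarrow> real" where
  "vol \<equiv> measure lborel"

text \<open>With \<open>G\<close> the geometric mean, the numbers \<open>ln (x i / G)\<close> sum to
  0; the bound \<open>ln y \<le> y - 1\<close> then gives the claim after summation.\<close>

lemma am_gm_root:
  fixes x :: "'i \<Rightarrow> real"
  assumes "finite I" "I \<noteq> {}" and pos: "\<And>i. i \<in> I \<Longrightarrow> 0 < x i"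
  shows "root (card I) (\<Prod>i\<in>I. x i) \<le> (\<Sum>i\<in>I. x i) / real (card I)"
proof -
  define G where "G = root (card I) (\<Prod>i\<in>I. x i)"
  have cI: "0 < card I" using assms by (simp add: card_gt_0_iff)
  have P: "0 < (\<Prod>i\<in>I. x i)" using pos by (simp add: prod_pos)
  then have G: "0 < G" using cI by (simp add: G_def)
  have Gp: "G ^ card I = (\<Prod>i\<in>I. x i)" using P cI by (simp add: G_def)
  have "(\<Sum>i\<in>I. ln (x i / G)) = (\<Sum>i\<in>I. ln (x i)) - real (card I) * ln G"
  proof -
    have "(\<Sum>i\<in>I. ln (x i / G)) = (\<Sum>i\<in>I. ln (x i) - ln G)"
      using pos G by (intro sum.cong refl) (metis ln_div less_numeral_extra(3))
    then show ?thesis by (simp add: sum_subtractf)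
  qed
  also have "(\<Sum>i\<in>I. ln (x i)) = ln (\<Prod>i\<in>I. x i)"
    using pos assms(1) by (subst ln_prod) (auto simp: less_imp_neq[symmetric])
  also have "\<dots> = real (card I) * ln G" using G by (simp add: Gp[symmetric] ln_realpow)
  finally have "0 = (\<Sum>i\<in>I. ln (x i / G))" by simp
  also have "\<dots> \<le> (\<Sum>i\<in>I. x i / G - 1)" using pos G by (intro sum_mono ln_le_minus_one) simp
  also have "\<dots> = (\<Sum>i\<in>I. x i) / G - real (card I)" by (simp add: sum_subtractf sum_divide_distrib)
  finally show ?thesis using G cI unfolding G_def[symmetric] by (simp add: field_simps)
qed

definition sumset :: "'a::ab_group_add set \<Rightarrow> 'a set \<Rightarrow> 'a set" where
  "sumset A B = {x + y | x y. x \<in> A \<and> y \<in> B}"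

lemma sumset_commute: "sumset A B = sumset B A" unfolding sumset_def by (auto; metis add.commute)

lemma sumset_mono: "A \<subseteq> A' \<Longrightarrow> B \<subseteq> B' \<Longrightarrow> sumset A B \<subseteq> sumset A' B'" unfolding sumset_def by blast

lemma open_sumset:
  fixes A B :: "'a::real_normed_vector set"
  shows "open B \<Longrightarrow> open (sumset A B)"
proof -
  assume "open B"
  have "sumset A B = (\<Union>x\<in>A. (+) x ` B)" unfolding sumset_def by auto
  then show ?thesis using \<open>open B\<close> by (auto intro!: open_translation)
qed

lemma bounded_sumset:
  fixes A B :: "'a::real_normed_vector set"
  assumes "bounded A" "bounded B" shows "bounded (sumset A B)"
proof -
  obtain a b where "\<And>x. x \<in> A \<Longrightarrow> norm x \<le> a" "\<And>x. x \<in> B \<Longrightarrow> norm x \<le> b"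
    using assms by (meson bounded_iff)
  then have "\<And>z. z \<in> sumset A B \<Longrightarrow> norm z \<le> a + b"
    unfolding sumset_def using norm_triangle_mono by blast
  then show ?thesis by (meson bounded_iff)
qed

lemma bounded_open_fmeasurable:
  fixes A :: "'a::euclidean_space set"
  assumes "open A" "bounded A" shows "A \<in> fmeasurable lborel"
proof -
  obtain r where "A \<subseteq> ball 0 r" using assms(2) bounded_subset_ballD by blast
  then have "emeasure lborel A \<le> emeasure lborel (ball (0::'a) r)" by (intro emeasure_mono) auto
  also have "\<dots> < \<infinity>" by (rule emeasure_lborel_ball_finite)
  finally show ?thesis using assms(1) by (simp add: fmeasurable_def)
qed

lemma sumset_box:
  fixes a b a' b' :: "'a::euclidean_space"
  assumes "box a b \<noteq> {}" "box a' b' \<noteq> {}"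
  shows "box (a + a') (b + b') \<subseteq> sumset (box a b) (box a' b')"
proof
  fix z assume z: "z \<in> box (a + a') (b + b')"
  have l: "a \<bullet> i < b \<bullet> i" "a' \<bullet> i < b' \<bullet> i" if "i \<in> Basis" for i
    using assms that by (auto simp: box_ne_empty)
  have zi: "a \<bullet> i + a' \<bullet> i < z \<bullet> i" "z \<bullet> i < b \<bullet> i + b' \<bullet> i" if "i \<in> Basis" for i
    using z that by (auto simp: mem_box inner_add_left)
  have "\<exists>t. a \<bullet> i < t \<and> t < b \<bullet> i \<and> a' \<bullet> i < z \<bullet> i - t \<and> z \<bullet> i - t < b' \<bullet> i" if i: "i \<in> Basis" for i
  proof -
    \<comment> \<open>The four conditions on the coordinate \<open>t\<close> describe an open
      interval; it is nonempty because \<open>z \<bullet> i\<close> lies strictly between the sums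
      of the endpoints.\<close>
    have "max (a \<bullet> i) (z \<bullet> i - b' \<bullet> i) < min (b \<bullet> i) (z \<bullet> i - a' \<bullet> i)"
      using l[OF i] zi[OF i] by auto
    from dense[OF this] show ?thesis by (auto simp: algebra_simps)
  qed
  then obtain t where t: "\<And>i. i \<in> Basis \<Longrightarrow> a \<bullet> i < t i \<and> t i < b \<bullet> i \<and> a' \<bullet> i < z \<bullet> i - t i \<and> z \<bullet> i - t i < b' \<bullet> i"
    by metis
  define x where "x = (\<Sum>i\<in>Basis. t i *\<^sub>R i)"
  have "x \<in> box a b" "z - x \<in> box a' b'" using t by (auto simp: mem_box x_def inner_diff_left)
  then show "z \<in> sumset (box a b) (box a' b')"
    unfolding sumset_def by (intro CollectI exI[of _ x] exI[of _ "z - x"]) auto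
qed

text \<open>After division by the sides \<open>l i + m i\<close> of the sum box, AM-GM is applied to
  the ratios \<open>l i / (l i + m i)\<close> and \<open>m i / (l i + m i)\<close> separately. In
  each coordinate the two ratios add up to 1, so the two arithmetic means do too.\<close>

lemma brunn_minkowski_box:
  fixes a b a' b' :: "'a::euclidean_space"
  assumes "box a b \<noteq> {}" "box a' b' \<noteq> {}"
  shows "(root DIM('a) (vol (box a b)) + root DIM('a) (vol (box a' b'))) ^ DIM('a)
      \<le> vol (sumset (box a b) (box a' b'))"
proof -
  let ?d = "DIM('a)"
  define l m where "l i = b \<bullet> i - a \<bullet> i" and "m i = b' \<bullet> i - a' \<bullet> i" for i
  have lm: "0 < l i" "0 < m i" if "i \<in> Basis" for i
    using assms that by (auto simp: box_ne_empty l_def m_def)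
  have ne: "box (a + a') (b + b') \<noteq> {}"
    using lm by (auto simp: box_ne_empty l_def m_def inner_add_left) (metis add_strict_mono diff_gt_0_iff_gt)
  have M: "vol (box a b) = (\<Prod>i\<in>Basis. l i)"
          "vol (box a' b') = (\<Prod>i\<in>Basis. m i)"
          "vol (box (a + a') (b + b')) = (\<Prod>i\<in>Basis. l i + m i)"
    using assms ne by (force simp: measure_lborel_box_eq box_ne_empty l_def m_def inner_diff_left inner_add_left
          intro!: prod.cong)+
  have pl: "0 < (\<Prod>i\<in>(Basis::'a set). l i + m i)" using lm by (intro prod_pos) (simp add: add_pos_pos)
  have "root ?d (\<Prod>i\<in>(Basis::'a set). l i / (l i + m i)) + root ?d (\<Prod>i\<in>(Basis::'a set). m i / (l i + m i))
      \<le> (\<Sum>i\<in>(Basis::'a set). l i / (l i + m i)) / ?d + (\<Sum>i\<in>(Basis::'a set). m i / (l i + m i)) / ?d"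
    using lm by (intro add_mono am_gm_root) (auto simp: add_pos_pos)
  also have "\<dots> = (\<Sum>i\<in>(Basis::'a set). l i / (l i + m i) + m i / (l i + m i)) / ?d"
    by (simp add: sum.distrib add_divide_distrib)
  also have "(\<Sum>i\<in>(Basis::'a set). l i / (l i + m i) + m i / (l i + m i)) = (\<Sum>i\<in>(Basis::'a set). 1)"
    using lm by (intro sum.cong refl) (simp add: add_divide_distrib[symmetric] add_pos_pos less_imp_neq[symmetric])
  also have "\<dots> / ?d = 1" by simp
  finally have "root ?d (\<Prod>i\<in>(Basis::'a set). l i) + root ?d (\<Prod>i\<in>(Basis::'a set). m i)
       \<le> root ?d (\<Prod>i\<in>(Basis::'a set). l i + m i)"
    using divide_le_eq_1_pos[OF real_root_gt_zero[OF DIM_positive[where 'a='a] pl]]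
    by (simp only: prod_dividef real_root_divide DIM_positive add_divide_distrib[symmetric])
  moreover have "0 \<le> (\<Prod>i\<in>(Basis::'a set). l i)" "0 \<le> (\<Prod>i\<in>(Basis::'a set). m i)"
    using lm by (auto intro!: prod_nonneg simp: less_imp_le)
  ultimately have "(root ?d (\<Prod>i\<in>(Basis::'a set). l i) + root ?d (\<Prod>i\<in>(Basis::'a set). m i)) ^ ?d
      \<le> (root ?d (\<Prod>i\<in>(Basis::'a set). l i + m i)) ^ ?d"
    by (intro power_mono add_nonneg_nonneg real_root_ge_zero)
  also have "\<dots> = vol (box (a + a') (b + b'))" using pl M by simp
  also have "\<dots> \<le> vol (sumset (box a b) (box a' b'))" using sumset_box[OF assms]
    by (intro measure_mono_fmeasurable bounded_open_fmeasurable open_sumset bounded_sumset) auto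
  finally show ?thesis by (simp add: M)
qed

section \<open>Cutting boxes, and finite disjoint families of boxes, by coordinate
  hyperplanes\<close>

lemma box_Int_below:
  fixes a b :: "'a::euclidean_space"
  assumes "i \<in> Basis"
  shows "box a b \<inter> {x. x \<bullet> i < e} = box a (b + (min (b \<bullet> i) e - b \<bullet> i) *\<^sub>R i)"
  using assms by (auto simp: mem_box inner_add_left inner_Basis if_distrib min_def split: if_splits)
     (metis less_le_trans linorder_not_le order_less_trans)+

lemma box_Int_above:
  fixes a b :: "'a::euclidean_space"
  assumes "i \<in> Basis"
  shows "box a b \<inter> {x. e < x \<bullet> i} = box (a + (max (a \<bullet> i) e - a \<bullet> i) *\<^sub>R i) b"
  using assms by (auto simp: mem_box inner_add_left inner_Basis if_distrib max_def split: if_splits)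
     (metis le_less_trans linorder_not_le order_less_trans)+

text \<open>The closed formula covers every position of the hyperplane and makes continuity in
  \<open>e\<close> evident, as the intermediate value argument in \<open>box_family_halve\<close>
  requires.\<close>

lemma measure_box_Int_below:
  fixes a b :: "'a::euclidean_space"
  assumes i: "i \<in> Basis" and ne: "box a b \<noteq> {}"
  shows "vol (box a b \<inter> {x. x \<bullet> i < e})
      = max 0 (min (b \<bullet> i) e - a \<bullet> i) * (\<Prod>j\<in>Basis - {i}. (b - a) \<bullet> j)"
proof -
  let ?b = "b + (min (b \<bullet> i) e - b \<bullet> i) *\<^sub>R i"
  have ab: "a \<bullet> j < b \<bullet> j" if "j \<in> Basis" for j using ne that by (auto simp: box_ne_empty)
  have bj: "?b \<bullet> j = (if j = i then min (b \<bullet> i) e else b \<bullet> j)" if "j \<in> Basis" for j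
    using that i by (auto simp: inner_add_left inner_Basis)
  show ?thesis
  proof (cases "a \<bullet> i \<le> min (b \<bullet> i) e")
    case True
    then have "\<forall>j\<in>Basis. a \<bullet> j \<le> ?b \<bullet> j" using ab bj by (simp add: less_imp_le)
    then have "vol (box a ?b) = (\<Prod>j\<in>Basis. (?b - a) \<bullet> j)" by (simp add: measure_lborel_box_eq)
    also have "\<dots> = (?b - a) \<bullet> i * (\<Prod>j\<in>Basis - {i}. (?b - a) \<bullet> j)"
      using i by (intro prod.remove) auto
    also have "(\<Prod>j\<in>Basis - {i}. (?b - a) \<bullet> j) = (\<Prod>j\<in>Basis - {i}. (b - a) \<bullet> j)"
      using bj by (intro prod.cong refl) (auto simp: inner_diff_left)
    also have "(?b - a) \<bullet> i = max 0 (min (b \<bullet> i) e - a \<bullet> i)"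
      using True bj[OF i] by (simp add: inner_diff_left)
    finally show ?thesis using i by (simp add: box_Int_below)
  next
    case False
    then have "box a ?b = {}" using bj[OF i] i by (auto simp: box_eq_empty intro!: bexI[of _ i])
    then have "vol (box a ?b) = 0" by simp
    moreover have "max 0 (min (b \<bullet> i) e - a \<bullet> i) = 0" using False by linarith
    ultimately show ?thesis using i by (simp add: box_Int_below del: max_def)
  qed
qed

lemma emeasure_hyperplane:
  fixes i :: "'a::euclidean_space"
  assumes "i \<in> Basis" shows "{x. x \<bullet> i = e} \<in> null_sets lborel"
proof -
  have "closed {x. x \<bullet> i = e}" by (intro closed_Collect_eq continuous_intros)
  then have "{x. x \<bullet> i = e} \<in> sets lborel" by simp
  moreover have "{x. x \<bullet> i = e} \<in> null_sets lebesgue"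
    using negligible_standard_hyperplane[OF assms, of e] by (simp add: negligible_iff_null_sets)
  ultimately show ?thesis by (simp add: null_sets_completion_iff)
qed

text \<open>The hyperplane itself is null, so a family may be split into its two open sides, which
  again consist of open boxes, without losing volume.\<close>

lemma measure_halfspaces:
  fixes A :: "'a::euclidean_space set"
  assumes i: "i \<in> Basis" and A: "A \<in> fmeasurable lborel"
  shows "vol A = vol (A \<inter> {x. x \<bullet> i < e}) + vol (A \<inter> {x. e < x \<bullet> i})"
proof -
  have S: "{x. x \<bullet> i < e} \<in> sets lborel" "{x. e < x \<bullet> i} \<in> sets lborel"
    by (auto intro!: borel_open open_Collect_less continuous_intros)
  have "vol A = vol (A - {x. x \<bullet> i = e})"
    using A by (intro measure_Diff_null_set[symmetric] emeasure_hyperplane i) auto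
  also have "A - {x. x \<bullet> i = e} = (A \<inter> {x. x \<bullet> i < e}) \<union> (A \<inter> {x. e < x \<bullet> i})" by auto
  also have "vol \<dots> = vol (A \<inter> {x. x \<bullet> i < e}) + vol (A \<inter> {x. e < x \<bullet> i})"
    using A S by (intro measure_Union) (auto simp: fmeasurable_Int_fmeasurable fmeasurableD2)
  finally show ?thesis .
qed

text \<open>Open members make all unions and sumsets open and thus measurable. Nonempty members give
  every nonempty family positive volume and make \<open>card\<close> count genuine boxes, the
  quantity of the induction.\<close>

definition box_family :: "'a::euclidean_space set set \<Rightarrow> bool" where
  "box_family \<A> \<longleftrightarrow> finite \<A> \<and> disjoint \<A> \<and> (\<forall>X\<in>\<A>. X \<noteq> {} \<and> (\<exists>a b. X = box a b))"

text \<open>Empty traces are dropped so that the cardinality falls strictly as soon as one box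
  misses \<open>H\<close>.\<close>

definition cut :: "'a set set \<Rightarrow> 'a set \<Rightarrow> 'a set set" where
  "cut \<A> H = (\<lambda>X. X \<inter> H) ` \<A> - {{}}"

lemma Union_cut [simp]: "\<Union>(cut \<A> H) = \<Union>\<A> \<inter> H" unfolding cut_def by auto

lemma box_family_cut:
  assumes "box_family \<A>" and H: "\<And>a b. \<exists>a' b'. box a b \<inter> H = box a' b'"
  shows "box_family (cut \<A> H)" unfolding box_family_def
proof (intro conjI ballI)
  show "finite (cut \<A> H)" using assms by (simp add: box_family_def cut_def)
  have "disjoint \<A>" using assms by (simp add: box_family_def)
  then show "disjoint (cut \<A> H)" unfolding cut_def pairwise_def disjnt_def by blast
  fix X assume X: "X \<in> cut \<A> H"
  then show "X \<noteq> {}" by (simp add: cut_def)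
  from X obtain Y where "Y \<in> \<A>" "X = Y \<inter> H" by (auto simp: cut_def)
  then show "\<exists>a b. X = box a b" using assms unfolding box_family_def by metis
qed

lemma box_family_below: "i \<in> Basis \<Longrightarrow> box_family \<A> \<Longrightarrow> box_family (cut \<A> {x. x \<bullet> i < e})"
  by (rule box_family_cut) (auto simp: box_Int_below)

lemma box_family_above: "i \<in> Basis \<Longrightarrow> box_family \<A> \<Longrightarrow> box_family (cut \<A> {x. e < x \<bullet> i})"
  by (rule box_family_cut) (auto simp: box_Int_above)

lemma card_cut_le: "finite \<A> \<Longrightarrow> card (cut \<A> H) \<le> card \<A>"
  unfolding cut_def by (meson Diff_subset card_image_le card_mono finite_imageI le_trans)

lemma card_cut_less:
  assumes "finite \<A>" "X \<in> \<A>" "X \<inter> H = {}" shows "card (cut \<A> H) < card \<A>"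
proof -
  have "cut \<A> H \<subseteq> cut (\<A> - {X}) H" using assms(3) unfolding cut_def by auto
  then have "card (cut \<A> H) \<le> card (cut (\<A> - {X}) H)"
    using assms(1) by (intro card_mono) (auto simp: cut_def)
  also have "\<dots> \<le> card (\<A> - {X})" using assms(1) by (intro card_cut_le) auto
  also have "\<dots> < card \<A>" using assms by (intro psubset_card_mono) auto
  finally show ?thesis .
qed

lemma box_family_Union:
  assumes "box_family \<A>"
  shows "open (\<Union>\<A>)" "bounded (\<Union>\<A>)" "\<Union>\<A> \<in> fmeasurable lborel"
proof -
  show "open (\<Union>\<A>)" using assms unfolding box_family_def by (metis open_Union open_box)
  show "bounded (\<Union>\<A>)" using assms unfolding box_family_def by (metis bounded_Union bounded_box)
  then show "\<Union>\<A> \<in> fmeasurable lborel" using \<open>open (\<Union>\<A>)\<close> by (rule bounded_open_fmeasurable[rotated])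
qed

lemma open_measure_pos:
  fixes A :: "'a::euclidean_space set"
  assumes "open A" "A \<noteq> {}" "A \<in> fmeasurable lborel"
  shows "0 < vol A"
proof -
  obtain x where "x \<in> A" using assms by auto
  then obtain e where e: "e > 0" "ball x e \<subseteq> A" using assms open_contains_ball by blast
  have "0 < vol (ball x e)" using e content_ball_pos[of e x] by simp
  also have "\<dots> \<le> vol A" using e assms by (intro measure_mono_fmeasurable) auto
  finally show ?thesis .
qed

text \<open>Intermediate value theorem: the volume below the hyperplane is continuous in
  \<open>e\<close>, vanishes far to one side and is the full volume far to the other. The ratio
  \<open>\<theta>\<close> is arbitrary because it is dictated by the cut of the other
  family.\<close>

lemma box_family_halve:
  fixes \<B> :: "'a::euclidean_space set set"
  assumes i: "i \<in> Basis" and B: "box_family \<B>" and \<theta>: "0 < \<theta>" "\<theta> < 1"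
  obtains e where "vol (\<Union>\<B> \<inter> {x. x \<bullet> i < e}) = \<theta> * vol (\<Union>\<B>)"
proof -
  define g where "g e = vol (\<Union>\<B> \<inter> {x. x \<bullet> i < e})" for e
  have H: "open {x::'a. x \<bullet> i < e}" for e by (intro open_Collect_less continuous_intros)
  have g: "g e = (\<Sum>X\<in>\<B>. vol (X \<inter> {x. x \<bullet> i < e}))" for e
  proof -
    have "g e = vol (\<Union>X\<in>\<B>. X \<inter> {x. x \<bullet> i < e})"
      unfolding g_def by (intro arg_cong[where f="vol"]) auto
    also have "\<dots> = (\<Sum>X\<in>\<B>. vol (X \<inter> {x. x \<bullet> i < e}))"
    proof (rule measure_finite_Union)
      show "finite \<B>" using B by (simp add: box_family_def)
      show "(\<lambda>X. X \<inter> {x. x \<bullet> i < e}) ` \<B> \<subseteq> sets lborel"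
        using B H by (auto simp: box_family_def intro!: sets.Int)
      show "disjoint_family_on (\<lambda>X. X \<inter> {x. x \<bullet> i < e}) \<B>"
        using B by (auto simp: box_family_def disjoint_family_on_def pairwise_def disjnt_def)
      fix X assume "X \<in> \<B>"
      then obtain a b where "X = box a b" using B unfolding box_family_def by blast
      then have "X \<inter> {x. x \<bullet> i < e} \<in> fmeasurable lborel"
        using H by (intro bounded_open_fmeasurable) (auto intro: bounded_subset[OF bounded_box])
      then show "emeasure lborel (X \<inter> {x. x \<bullet> i < e}) \<noteq> \<infinity>" by (auto simp: fmeasurable_def)
    qed
    finally show ?thesis .
  qed
  have "continuous_on UNIV (\<lambda>e. vol (X \<inter> {x. x \<bullet> i < e}))" if X: "X \<in> \<B>" for X
  proof -
    obtain a b where "X = box a b" "box a b \<noteq> {}" using X B unfolding box_family_def by blast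
    then show ?thesis by (simp add: measure_box_Int_below[OF i]) (intro continuous_intros)
  qed
  then have cont: "continuous_on UNIV g" unfolding g by (intro continuous_on_sum) auto
  obtain c where c: "\<And>x. x \<in> \<Union>\<B> \<Longrightarrow> norm x \<le> c" using box_family_Union(2)[OF B] by (meson bounded_iff)
  have xi: "\<bar>x \<bullet> i\<bar> \<le> c" if "x \<in> \<Union>\<B>" for x using c[OF that] Basis_le_norm[OF i, of x] by linarith
  have "\<Union>\<B> \<inter> {x. x \<bullet> i < - c} = {}" using xi by fastforce
  then have lo: "g (- c) = 0" by (simp add: g_def)
  have "\<Union>\<B> \<inter> {x. x \<bullet> i < \<bar>c\<bar> + 1} = \<Union>\<B>" using xi by fastforce
  then have hi: "g (\<bar>c\<bar> + 1) = vol (\<Union>\<B>)" by (simp add: g_def)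
  have "\<exists>e\<ge>-c. e \<le> \<bar>c\<bar> + 1 \<and> g e = \<theta> * vol (\<Union>\<B>)"
    using \<theta> lo hi continuous_on_subset[OF cont subset_UNIV]
    by (intro IVT') (auto intro!: mult_left_le_one_le)
  then show ?thesis using that unfolding g_def by blast
qed

text \<open>The intersection of two boxes is the box between the coordinatewise maxima and minima;
  if it is empty, one coordinate is responsible.\<close>

lemma disjoint_boxes_separated:
  fixes a b a' b' :: "'a::euclidean_space"
  assumes "box a b \<noteq> {}" "box a' b' \<noteq> {}" "box a b \<inter> box a' b' = {}"
  obtains i where "i \<in> Basis" "b \<bullet> i \<le> a' \<bullet> i \<or> b' \<bullet> i \<le> a \<bullet> i"
proof -
  have "box (\<Sum>i\<in>Basis. max (a \<bullet> i) (a' \<bullet> i) *\<^sub>R i) (\<Sum>i\<in>Basis. min (b \<bullet> i) (b' \<bullet> i) *\<^sub>R i) = {}"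
    using assms(3) by (simp add: box_Int_box)
  then obtain i where "i \<in> Basis" "min (b \<bullet> i) (b' \<bullet> i) \<le> max (a \<bullet> i) (a' \<bullet> i)"
    by (auto simp: box_eq_empty)
  moreover have "a \<bullet> i < b \<bullet> i" "a' \<bullet> i < b' \<bullet> i" using assms \<open>i \<in> Basis\<close> by (auto simp: box_ne_empty)
  ultimately show ?thesis using that[of i] by (auto simp: min_def max_def split: if_splits)
qed

lemma box_familyE:
  assumes "box_family \<A>" "X \<in> \<A>" obtains a b where "X = box a b" "box a b \<noteq> {}"
  using assms unfolding box_family_def by blast

text \<open>The Hadwiger--Ohmann argument. A hyperplane separating two boxes of \<A> leaves fewer
  boxes of \<A> on each side; \<B> is cut by a parallel hyperplane in the same volume ratio. The
  induction hypothesis on both sides adds up, because the asserted bound is homogeneous in the two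
  volumes and the two partial sumsets lie on opposite sides of a hyperplane.\<close>

lemma brunn_minkowski_step:
  fixes \<A> \<B> :: "'a::euclidean_space set set"
  assumes A: "box_family \<A>" "\<A> \<noteq> {}" and B: "box_family \<B>" "\<B> \<noteq> {}" and card: "1 < card \<A>"
    and IH: "\<And>\<A>' \<B>' :: 'a set set. box_family \<A>' \<Longrightarrow> \<A>' \<noteq> {} \<Longrightarrow> box_family \<B>' \<Longrightarrow> \<B>' \<noteq> {} \<Longrightarrow>
        card \<A>' + card \<B>' < card \<A> + card \<B> \<Longrightarrow>
        (root DIM('a) (vol (\<Union>\<A>')) + root DIM('a) (vol (\<Union>\<B>'))) ^ DIM('a)
          \<le> vol (sumset (\<Union>\<A>') (\<Union>\<B>'))"
  shows "(root DIM('a) (vol (\<Union>\<A>)) + root DIM('a) (vol (\<Union>\<B>))) ^ DIM('a)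
          \<le> vol (sumset (\<Union>\<A>) (\<Union>\<B>))"
proof -
  let ?d = "DIM('a)" and ?\<mu> = "vol :: 'a set \<Rightarrow> real"
  have fin: "finite \<A>" "finite \<B>" using A B by (auto simp: box_family_def)
  obtain X Y where XY: "X \<in> \<A>" "Y \<in> \<A>" "X \<noteq> Y"
  proof -
    have "\<not> card \<A> \<le> Suc 0" using card by simp
    then show ?thesis using that unfolding card_le_Suc0_iff_eq[OF fin(1)] by blast
  qed
  obtain a b a' b' where box: "X = box a b" "Y = box a' b'" using XY box_familyE[OF A(1)] by meson
  have ne: "box a b \<noteq> {}" "box a' b' \<noteq> {}" "box a b \<inter> box a' b' = {}"
    using XY A box by (auto simp: box_family_def pairwise_def disjnt_def)
  obtain i where i: "i \<in> Basis" "b \<bullet> i \<le> a' \<bullet> i \<or> b' \<bullet> i \<le> a \<bullet> i"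
    using disjoint_boxes_separated[OF ne] by metis
  \<comment> \<open>\<open>X'\<close> and \<open>Y'\<close> are \<open>X\<close> and
    \<open>Y\<close>, ordered along the direction \<open>i\<close>.\<close>
  obtain X' Y' c where sep: "X' \<in> \<A>" "Y' \<in> \<A>" "X' \<subseteq> {x. x \<bullet> i < c}" "Y' \<subseteq> {x. c < x \<bullet> i}"
  proof (cases "b \<bullet> i \<le> a' \<bullet> i")
    case True
    have "X \<subseteq> {x. x \<bullet> i < b \<bullet> i}" "Y \<subseteq> {x. b \<bullet> i < x \<bullet> i}"
      using True box i(1) by (auto simp: mem_box intro: le_less_trans)
    then show ?thesis using that XY by blast
  next
    case False
    then have "b' \<bullet> i \<le> a \<bullet> i" using i by simp
    then have "Y \<subseteq> {x. x \<bullet> i < b' \<bullet> i}" "X \<subseteq> {x. b' \<bullet> i < x \<bullet> i}"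
      using box i(1) by (auto simp: mem_box intro: le_less_trans)
    then show ?thesis using that XY by blast
  qed
  let ?L = "\<lambda>c. {x. x \<bullet> i < c}" and ?U = "\<lambda>c. {x. c < x \<bullet> i}"
  have ne': "X' \<noteq> {}" "Y' \<noteq> {}" using sep A by (auto simp: box_family_def)
  have AL: "cut \<A> (?L c) \<noteq> {}" using sep(1,3) ne' unfolding cut_def by blast
  have AU: "cut \<A> (?U c) \<noteq> {}" using sep(2,4) ne' unfolding cut_def by blast
  \<comment> \<open>The lower side loses \<open>Y'\<close> and the upper side loses
    \<open>X'\<close>; cutting \<B> does not increase its cardinality, so the total count
    drops.\<close>
  have cardL: "card (cut \<A> (?L c)) < card \<A>"
    using sep fin by (intro card_cut_less[where X=Y']) force+
  have cardU: "card (cut \<A> (?U c)) < card \<A>"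
    using sep fin by (intro card_cut_less[where X=X']) force+
  have pos: "0 < ?\<mu> (\<Union>\<D>)" if "box_family \<D>" "\<D> \<noteq> {}" for \<D> :: "'a set set"
    using that box_family_Union[OF that(1)] by (intro open_measure_pos) (auto simp: box_family_def)
  have sumA: "?\<mu> (\<Union>\<A>) = ?\<mu> (\<Union>(cut \<A> (?L c))) + ?\<mu> (\<Union>(cut \<A> (?U c)))"
    using measure_halfspaces[OF i(1) box_family_Union(3)[OF A(1)], of c] by simp
  have posL: "0 < ?\<mu> (\<Union>(cut \<A> (?L c)))" by (intro pos box_family_below i A AL)
  have posU: "0 < ?\<mu> (\<Union>(cut \<A> (?U c)))" by (intro pos box_family_above i A AU)
  define \<theta> where "\<theta> = ?\<mu> (\<Union>(cut \<A> (?L c))) / ?\<mu> (\<Union>\<A>)"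
  have pA: "0 < ?\<mu> (\<Union>\<A>)" and pB: "0 < ?\<mu> (\<Union>\<B>)" using pos A B by auto
  have \<theta>: "0 < \<theta>" "\<theta> < 1" using posL posU pA sumA by (auto simp: \<theta>_def)
  have muL: "?\<mu> (\<Union>(cut \<A> (?L c))) = \<theta> * ?\<mu> (\<Union>\<A>)" using pA by (simp add: \<theta>_def)
  have muU: "?\<mu> (\<Union>(cut \<A> (?U c))) = (1 - \<theta>) * ?\<mu> (\<Union>\<A>)" using sumA muL by (simp add: algebra_simps)
  \<comment> \<open>The common ratio \<open>\<theta>\<close> is what allows it to be factored out of
    both roots below.\<close>
  obtain e where e: "?\<mu> (\<Union>\<B> \<inter> ?L e) = \<theta> * ?\<mu> (\<Union>\<B>)" using box_family_halve[OF i(1) B(1) \<theta>] by blast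
  have nuL: "?\<mu> (\<Union>(cut \<B> (?L e))) = \<theta> * ?\<mu> (\<Union>\<B>)" using e by simp
  have nuU: "?\<mu> (\<Union>(cut \<B> (?U e))) = (1 - \<theta>) * ?\<mu> (\<Union>\<B>)"
    using measure_halfspaces[OF i(1) box_family_Union(3)[OF B(1)], of e] e by (simp add: algebra_simps)
  have BL: "cut \<B> (?L e) \<noteq> {}"
  proof
    assume "cut \<B> (?L e) = {}"
    then show False using nuL \<theta> pB by (metis Sup_empty measure_empty mult_pos_pos less_irrefl)
  qed
  have BU: "cut \<B> (?U e) \<noteq> {}"
  proof
    assume "cut \<B> (?U e) = {}"
    then have "(1 - \<theta>) * ?\<mu> (\<Union>\<B>) = 0" using nuU by (metis Sup_empty measure_empty)
    then show False using \<theta> pB by simp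
  qed
  let ?SL = "sumset (\<Union>(cut \<A> (?L c))) (\<Union>(cut \<B> (?L e)))" 
  let ?SU = "sumset (\<Union>(cut \<A> (?U c))) (\<Union>(cut \<B> (?U e)))"
  have cle: "card (cut \<B> (?L e)) \<le> card \<B>" "card (cut \<B> (?U e)) \<le> card \<B>"
    using fin card_cut_le by auto
  have rt: "(root ?d (t * u) + root ?d (t * v)) ^ ?d = t * (root ?d u + root ?d v) ^ ?d" if "0 < t" for t u v
    using that by (simp add: real_root_mult distrib_left[symmetric] power_mult_distrib del: distrib_left)
  have L: "\<theta> * (root ?d (?\<mu> (\<Union>\<A>)) + root ?d (?\<mu> (\<Union>\<B>))) ^ ?d \<le> ?\<mu> ?SL"
    using IH[OF box_family_below[OF i(1) A(1)] AL box_family_below[OF i(1) B(1)] BL] cardL cle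
    unfolding muL nuL rt[OF \<theta>(1)] by simp
  have U: "(1 - \<theta>) * (root ?d (?\<mu> (\<Union>\<A>)) + root ?d (?\<mu> (\<Union>\<B>))) ^ ?d \<le> ?\<mu> ?SU"
  proof -
    have "0 < 1 - \<theta>" using \<theta> by simp
    note rt[OF this]
    then show ?thesis
      using IH[OF box_family_above[OF i(1) A(1)] AU box_family_above[OF i(1) B(1)] BU] cardU cle
      unfolding muU nuU by simp
  qed
  have fm: "sumset (\<Union>\<D>) (\<Union>\<E>) \<in> fmeasurable lborel" if "box_family \<D>" "box_family \<E>" for \<D> \<E> :: "'a set set"
    using that box_family_Union by (intro bounded_open_fmeasurable open_sumset bounded_sumset)
  have "(root ?d (?\<mu> (\<Union>\<A>)) + root ?d (?\<mu> (\<Union>\<B>))) ^ ?d \<le> ?\<mu> ?SL + ?\<mu> ?SU"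
    using L U by (simp add: algebra_simps)
  also have "\<dots> = ?\<mu> (?SL \<union> ?SU)"
  proof (rule measure_Union[symmetric])
    have "?SL \<in> fmeasurable lborel" "?SU \<in> fmeasurable lborel"
      by (intro fm box_family_below box_family_above i A B)+
    then show "emeasure lborel ?SL \<noteq> \<infinity>" "emeasure lborel ?SU \<noteq> \<infinity>" "?SL \<in> sets lborel" "?SU \<in> sets lborel"
      by (auto simp: fmeasurable_def)
    \<comment> \<open>Coordinates below \<open>c\<close> and \<open>e\<close> add to less than
      \<open>c + e\<close>, those above to more: hence the partial sumsets are disjoint and their
      volumes add.\<close>
    have "?SL \<subseteq> ?L (c + e)" "?SU \<subseteq> ?U (c + e)"
      by (auto simp: sumset_def inner_add_left intro: add_strict_mono)
    then show "?SL \<inter> ?SU = {}" by fastforce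
  qed
  also have "\<dots> \<le> ?\<mu> (sumset (\<Union>\<A>) (\<Union>\<B>))"
  proof (rule measure_mono_fmeasurable)
    show "?SL \<union> ?SU \<subseteq> sumset (\<Union>\<A>) (\<Union>\<B>)" by (intro Un_least sumset_mono) auto
    have "?SL \<in> sets lborel" "?SU \<in> sets lborel"
      using fm[OF box_family_below[OF i(1) A(1)] box_family_below[OF i(1) B(1)]]
        fm[OF box_family_above[OF i(1) A(1)] box_family_above[OF i(1) B(1)]] fmeasurableD by blast+
    then show "?SL \<union> ?SU \<in> sets lborel" by (rule sets.Un)
    show "sumset (\<Union>\<A>) (\<Union>\<B>) \<in> fmeasurable lborel" by (intro fm A B)
  qed
  finally show ?thesis .
qed

text \<open>Induction on the total number of boxes. The step needs two boxes in its first family; if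
  only \<B> has them, the roles are exchanged by commutativity of the sumset.\<close>

lemma brunn_minkowski_boxes:
  fixes \<A> \<B> :: "'a::euclidean_space set set"
  assumes "box_family \<A>" "\<A> \<noteq> {}" "box_family \<B>" "\<B> \<noteq> {}"
  shows "(root DIM('a) (vol (\<Union>\<A>)) + root DIM('a) (vol (\<Union>\<B>))) ^ DIM('a)
          \<le> vol (sumset (\<Union>\<A>) (\<Union>\<B>))" using assms
proof (induction "card \<A> + card \<B>" arbitrary: \<A> \<B> rule: less_induct)
  case less
  note IH = less.hyps and prems = less.prems
  have fin: "finite \<A>" "finite \<B>" using prems by (auto simp: box_family_def)
  then have "0 < card \<A>" "0 < card \<B>" using prems by (auto simp: card_gt_0_iff)
  then consider "1 < card \<A>" | "1 < card \<B>" | "card \<A> = 1" "card \<B> = 1" by linarith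
  then show ?case
  proof cases
    case 1
    show ?thesis by (rule brunn_minkowski_step[OF prems 1]) (rule IH)
  next
    case 2
    have "(root DIM('a) (vol (\<Union>\<B>)) + root DIM('a) (vol (\<Union>\<A>))) ^ DIM('a)
          \<le> vol (sumset (\<Union>\<B>) (\<Union>\<A>))"
    proof (rule brunn_minkowski_step[OF prems(3,4,1,2) 2])
      fix \<A>' \<B>' :: "'a set set"
      assume *: "box_family \<A>'" "\<A>' \<noteq> {}" "box_family \<B>'" "\<B>' \<noteq> {}"
        and "card \<A>' + card \<B>' < card \<B> + card \<A>"
      then have "card \<A>' + card \<B>' < card \<A> + card \<B>" by linarith
      from IH[OF this *]
      show "(root DIM('a) (vol (\<Union>\<A>')) + root DIM('a) (vol (\<Union>\<B>'))) ^ DIM('a)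
          \<le> vol (sumset (\<Union>\<A>') (\<Union>\<B>'))" .
    qed
    then show ?thesis by (simp add: add.commute sumset_commute)
  next
    case 3
    then obtain X Y where XY: "\<A> = {X}" "\<B> = {Y}" by (metis card_1_singletonE)
    then obtain a b a' b' where "X = box a b" "Y = box a' b'"
      using prems box_familyE by (metis singletonI)
    then show ?thesis using XY prems brunn_minkowski_box[of a b a' b'] by (auto simp: box_family_def)
  qed
qed

text \<open>Inner regularity gives a compact subset of \<open>A\<close> of nearly full volume.
  Finitely many boxes inside \<open>A\<close> cover it; their union is subdivided into
  nonoverlapping cells, and passing to the interiors discards only null boundaries.\<close>

lemma box_family_approx:
  fixes A :: "'a::euclidean_space set"
  assumes A: "open A" "bounded A" "A \<noteq> {}" and \<eta>: "0 < \<eta>"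
  obtains \<A> where "box_family \<A>" "\<A> \<noteq> {}" "\<Union>\<A> \<subseteq> A" "vol A - \<eta> < vol (\<Union>\<A>)"
proof -
  have fA: "A \<in> fmeasurable lborel" using A by (intro bounded_open_fmeasurable)
  then have pA: "0 < vol A" using A by (intro open_measure_pos)
  \<comment> \<open>The minimum with the volume of \<open>A\<close> forces the approximating family
    to have positive volume, hence to be nonempty.\<close>
  define \<epsilon> where "\<epsilon> = min \<eta> (vol A)"
  have \<epsilon>: "0 < \<epsilon>" using \<eta> pA by (simp add: \<epsilon>_def)
  obtain T where T: "closed T" "T \<subseteq> A" "emeasure lebesgue (A - T) < ennreal \<epsilon>"
    using sets_lebesgue_inner_closed[of A \<epsilon>] A \<epsilon> by (metis borel_open sets_completionI_sets sets_lborel)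
  have cT: "compact T" using T A bounded_subset compact_eq_bounded_closed by blast
  have "\<exists>a b. x \<in> box a b \<and> cbox a b \<subseteq> A" if "x \<in> T" for x
  proof -
    have "x \<in> A" using that T by blast
    then show ?thesis using open_contains_cbox[OF A(1)] by metis
  qed
  then obtain f g where fg: "\<And>x. x \<in> T \<Longrightarrow> x \<in> box (f x) (g x) \<and> cbox (f x) (g x) \<subseteq> A" by metis
  have cov: "T \<subseteq> (\<Union>x\<in>T. box (f x) (g x))" using fg by blast
  obtain S where S: "S \<subseteq> T" "finite S" "T \<subseteq> (\<Union>x\<in>S. box (f x) (g x))"
    using compactE_image[OF cT open_box cov] by metis
  obtain P where P: "P division_of \<Union>((\<lambda>x. cbox (f x) (g x)) ` S)"
    by (rule elementary_unions_intervals[OF finite_imageI[OF S(2), of "\<lambda>x. cbox (f x) (g x)"]]) auto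
  define \<A> where "\<A> = interior ` P - {{}}"
  have bf: "box_family \<A>" unfolding box_family_def
  proof (intro conjI ballI)
    show "finite \<A>" using P by (simp add: \<A>_def division_of_finite)
    show "disjoint \<A>"
    proof (rule pairwiseI)
      fix X Y assume "X \<in> \<A>" "Y \<in> \<A>" "X \<noteq> Y"
      then obtain K L where "K \<in> P" "L \<in> P" "K \<noteq> L" "X = interior K" "Y = interior L"
        by (auto simp: \<A>_def)
      then show "disjnt X Y" using division_ofD(5)[OF P, of K L] by (simp add: disjnt_def)
    qed
    fix X assume X: "X \<in> \<A>"
    then show "X \<noteq> {}" by (simp add: \<A>_def)
    from X obtain Y where Y: "Y \<in> P" "X = interior Y" by (auto simp: \<A>_def)
    obtain a b where "Y = cbox a b" using division_ofD(4)[OF P Y(1)] by blast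
    then show "\<exists>a b. X = box a b" using Y by (auto simp: interior_cbox)
  qed
  have UA: "\<Union>\<A> = \<Union>(interior ` P)" by (auto simp: \<A>_def)
  have "\<Union>\<A> \<subseteq> \<Union>P" unfolding UA using interior_subset by fast
  also have "\<Union>P = (\<Union>x\<in>S. cbox (f x) (g x))" using division_ofD(6)[OF P] .
  also have UnA: "\<dots> \<subseteq> A" using fg S by blast
  finally have sub: "\<Union>\<A> \<subseteq> A" .
  have PA: "\<Union>P \<subseteq> A" using UnA division_ofD(6)[OF P] by simp
  have ms: "Y \<in> sets lborel" "Y - interior Y \<in> null_sets lborel" if YP: "Y \<in> P" for Y
  proof -
    obtain a b where Y: "Y = cbox a b" using division_ofD(4)[OF P YP] by blast
    show "Y \<in> sets lborel" using Y by simp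
    have "negligible (cbox a b - box a b)" by (rule negligible_frontier_interval)
    then have "cbox a b - box a b \<in> null_sets lebesgue" by (simp add: negligible_iff_null_sets)
    then show "Y - interior Y \<in> null_sets lborel" using Y
      by (simp add: null_sets_completion_iff interior_cbox)
  qed
  have sP: "\<Union>P \<in> sets lborel"
    by (rule sets.finite_Union[OF division_of_finite[OF P]]) (use ms(1) in blast)
  have N: "\<Union>P - \<Union>\<A> \<in> null_sets lborel"
  proof (rule null_sets_subset)
    show "(\<Union>Y\<in>P. Y - interior Y) \<in> null_sets lborel"
      by (rule null_sets.finite_UN[OF division_of_finite[OF P]]) (rule ms(2))
    show "\<Union>P - \<Union>\<A> \<subseteq> (\<Union>Y\<in>P. Y - interior Y)" unfolding UA by blast
    show "\<Union>P - \<Union>\<A> \<in> sets lborel" by (rule sets.Diff[OF sP]) (simp add: box_family_Union(1)[OF bf])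
  qed
  have TP: "T \<subseteq> \<Union>P" 
  proof -
    have "(\<Union>x\<in>S. box (f x) (g x)) \<subseteq> (\<Union>x\<in>S. cbox (f x) (g x))"
      by (intro UN_mono box_subset_cbox order_refl)
    then show ?thesis using S(3) division_ofD(6)[OF P] by simp
  qed
  have "vol A - \<epsilon> < vol T"
  proof -
    have s: "T \<in> sets lborel" "A - T \<in> sets lborel" using T A by auto
    have fT: "T \<in> fmeasurable lborel" "A - T \<in> fmeasurable lborel"
      using fmeasurableI2[OF fA] s T by auto
    have "vol A = vol T + vol (A - T)" using measure_Un2[OF fT(1) fA] T by (simp add: Un_absorb1)
    moreover have "ennreal (vol (A - T)) < ennreal \<epsilon>"
      using T(3) s fT by (simp add: emeasure_eq_measure2[symmetric])
    ultimately show ?thesis using \<epsilon> by (simp add: ennreal_less_iff)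
  qed
  also have "vol T \<le> vol (\<Union>P)"
  proof (rule measure_mono_fmeasurable[OF TP])
    show "T \<in> sets lborel" using T by simp
    from PA show "\<Union>P \<in> fmeasurable lborel" using fmeasurableI2[OF fA] sP by blast
  qed
  also have "\<dots> = vol (\<Union>\<A>)" using measure_Diff_null_set[OF sP N] \<open>\<Union>\<A> \<subseteq> \<Union>P\<close> by (simp add: double_diff)
  finally have *: "vol A - \<epsilon> < vol (\<Union>\<A>)" .
  then have "0 < vol (\<Union>\<A>)" using \<epsilon>_def by linarith
  then have "\<A> \<noteq> {}" by auto
  then show ?thesis using that[of \<A>] bf sub * by (simp add: \<epsilon>_def)
qed

text \<open>Both sets are approximated from inside by box families with volume loss \<eta>; the
  sumset only shrinks, and the lower bound is continuous as \<eta> tends to 0 from the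
  right.\<close>

lemma brunn_minkowski:
  fixes A B :: "'a::euclidean_space set"
  assumes A: "open A" "bounded A" "A \<noteq> {}" and B: "open B" "bounded B" "B \<noteq> {}"
  shows "(root DIM('a) (vol A) + root DIM('a) (vol B)) ^ DIM('a)
      \<le> vol (sumset A B)"
proof -
  define f where "f \<eta> = (root DIM('a) (vol A - \<eta>) + root DIM('a) (vol B - \<eta>)) ^ DIM('a)" for \<eta>
  have pos: "0 < vol A" "0 < vol B"
    using A B by (auto intro!: open_measure_pos bounded_open_fmeasurable)
  have "\<forall>\<^sub>F \<eta> in at_right 0. \<eta> < vol A \<and> \<eta> < vol B \<and> 0 < \<eta>"
    using pos eventually_at_right_less[of "0::real"] 
    by (intro eventually_conj) (auto simp: eventually_at_right_field)
  then have ev: "\<forall>\<^sub>F \<eta> in at_right 0. f \<eta> \<le> vol (sumset A B)"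
  proof eventually_elim
    case (elim \<eta>)
    obtain \<A> where fA: "box_family \<A>" "\<A> \<noteq> {}" "\<Union>\<A> \<subseteq> A" "vol A - \<eta> < vol (\<Union>\<A>)"
      using box_family_approx[OF A] elim by blast
    obtain \<B> where fB: "box_family \<B>" "\<B> \<noteq> {}" "\<Union>\<B> \<subseteq> B" "vol B - \<eta> < vol (\<Union>\<B>)"
      using box_family_approx[OF B] elim by blast
    have "f \<eta> \<le> (root DIM('a) (vol (\<Union>\<A>)) + root DIM('a) (vol (\<Union>\<B>))) ^ DIM('a)"
      unfolding f_def using fA(4) fB(4) elim
      by (intro power_mono add_mono) (auto intro!: add_nonneg_nonneg)
    also have "\<dots> \<le> vol (sumset (\<Union>\<A>) (\<Union>\<B>))" by (intro brunn_minkowski_boxes fA fB)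
    also have "\<dots> \<le> vol (sumset A B)"
    proof (rule measure_mono_fmeasurable)
      show "sumset (\<Union>\<A>) (\<Union>\<B>) \<subseteq> sumset A B" by (intro sumset_mono fA fB)
      show "sumset (\<Union>\<A>) (\<Union>\<B>) \<in> sets lborel"
        using open_sumset[OF box_family_Union(1)[OF fB(1)]] by simp
      show "sumset A B \<in> fmeasurable lborel"
        using A B by (intro bounded_open_fmeasurable open_sumset bounded_sumset)
    qed
    finally show ?case .
  qed
  have "(f \<longlongrightarrow> f 0) (at_right 0)" unfolding f_def by (intro tendsto_intros)
  from tendsto_upperbound[OF this ev] have "f 0 \<le> vol (sumset A B)" by simp
  then show ?thesis by (simp add: f_def)
qed

section \<open>Layer cakes and Hoelder's inequality\<close>

text \<open>Fubini for the region under the graph. Only positive levels are integrated since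
  \<open>ennreal\<close> truncates negative values, so \<open>f\<close> may have any sign.\<close>

lemma layer_cake:
  fixes f :: "'a::euclidean_space \<Rightarrow> real"
  assumes [measurable]: "f \<in> borel_measurable borel"
  shows "(\<integral>\<^sup>+x. ennreal (f x) \<partial>lborel) = (\<integral>\<^sup>+s. indicator {0<..} s * emeasure lborel {x. s < f x} \<partial>lborel)"
proof -
  have "(\<integral>\<^sup>+x. ennreal (f x) \<partial>lborel)
      = (\<integral>\<^sup>+x. (\<integral>\<^sup>+s. indicator {0<..} s * indicator {x. s < f x} x \<partial>lborel) \<partial>lborel)"
  proof (rule nn_integral_cong)
    fix x
    have "(\<integral>\<^sup>+s. indicator {0<..} s * indicator {x. s < f x} x \<partial>lborel) = (\<integral>\<^sup>+s. indicator {0<..<f x} s \<partial>(lborel::real measure))"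
      by (intro nn_integral_cong) (auto simp: indicator_def)
    also have "\<dots> = ennreal (f x)" by (cases "0 \<le> f x") (auto simp: ennreal_neg)
    finally show "ennreal (f x) = (\<integral>\<^sup>+s. indicator {0<..} s * indicator {x. s < f x} x \<partial>lborel)" by simp
  qed
  also have "\<dots> = (\<integral>\<^sup>+s. (\<integral>\<^sup>+x. indicator {0<..} s * indicator {x. s < f x} x \<partial>lborel) \<partial>lborel)"
    by (rule lborel_pair.Fubini'[symmetric]) measurable
  also have "\<dots> = (\<integral>\<^sup>+s. indicator {0<..} s * emeasure lborel {x. s < f x} \<partial>lborel)"
    by (intro nn_integral_cong) (subst nn_integral_cmult_indicator, auto)
  finally show ?thesis .
qed

lemma measurable_superlevel_emeasure [measurable]:
  fixes f :: "'a::euclidean_space \<Rightarrow> real"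
  assumes [measurable]: "f \<in> borel_measurable borel"
  shows "(\<lambda>s. emeasure lborel {x. s < f x}) \<in> borel_measurable borel"
proof -
  have "(\<lambda>s. \<integral>\<^sup>+x. indicator {x. s < f x} x \<partial>lborel) \<in> borel_measurable (borel :: real measure)"
    by measurable
  then show ?thesis by simp
qed

text \<open>The comparison is used twice: with a factor \<open>(1 + t) ^ d\<close> for enlarged
  superlevel sets, and with factor 1 for the moments of the level radius.\<close>

lemma nn_integral_le_superlevel:
  fixes f g :: "'a::euclidean_space \<Rightarrow> real"
  assumes [measurable]: "f \<in> borel_measurable borel" "g \<in> borel_measurable borel"
    and le: "\<And>s. 0 < s \<Longrightarrow> c * emeasure lborel {x. s < f x} \<le> emeasure lborel {x. s < g x}"
  shows "c * (\<integral>\<^sup>+x. ennreal (f x) \<partial>lborel) \<le> (\<integral>\<^sup>+x. ennreal (g x) \<partial>lborel)"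
proof -
  have "c * (\<integral>\<^sup>+x. ennreal (f x) \<partial>lborel)
      = (\<integral>\<^sup>+s. c * (indicator {0<..} s * emeasure lborel {x. s < f x}) \<partial>lborel)"
    by (simp add: layer_cake nn_integral_cmult)
  also have "\<dots> \<le> (\<integral>\<^sup>+s. indicator {0<..} s * emeasure lborel {x. s < g x} \<partial>lborel)"
    using le by (intro nn_integral_mono) (auto simp: indicator_def)
  also have "\<dots> = (\<integral>\<^sup>+x. ennreal (g x) \<partial>lborel)" by (simp add: layer_cake)
  finally show ?thesis .
qed

text \<open>Young's inequality for \<open>f / A powr (1 / p)\<close> and
  \<open>g / B powr (1 / q)\<close>, integrated. The normalisation is possible because both bounds
  are positive.\<close>

lemma holder_aux:
  fixes f g :: "'a \<Rightarrow> real"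
  assumes pq: "1 < p" "1 < q" "1 / p + 1 / q = 1"
    and [measurable]: "f \<in> borel_measurable M" "g \<in> borel_measurable M"
    and nn: "\<And>x. 0 \<le> f x" "\<And>x. 0 \<le> g x"
    and A: "(\<integral>\<^sup>+x. ennreal (f x powr p) \<partial>M) \<le> ennreal A" "0 < A"
    and B: "(\<integral>\<^sup>+x. ennreal (g x powr q) \<partial>M) \<le> ennreal B" "0 < B"
  shows "(\<integral>\<^sup>+x. ennreal (f x * g x) \<partial>M) \<le> ennreal (A powr (1 / p) * B powr (1 / q))"
proof -
  define C where "C = A powr (1 / p) * B powr (1 / q)"
  have C: "0 < C" using A B by (simp add: C_def)
  have "f x * g x \<le> C * (1 / (p * A)) * f x powr p + C * (1 / (q * B)) * g x powr q" for x
  proof -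
    have "(f x / A powr (1 / p)) * (g x / B powr (1 / q))
        \<le> (f x / A powr (1 / p)) powr p / p + (g x / B powr (1 / q)) powr q / q"
      using pq nn by (intro Youngs_inequality) auto
    also have "\<dots> = f x powr p / (p * A) + g x powr q / (q * B)"
      using A B nn pq by (simp add: powr_divide powr_powr mult.commute)
    finally have "C * ((f x / A powr (1 / p)) * (g x / B powr (1 / q)))
        \<le> C * (f x powr p / (p * A) + g x powr q / (q * B))" using C by (intro mult_left_mono) auto
    moreover have "C * ((f x / A powr (1 / p)) * (g x / B powr (1 / q))) = f x * g x"
      using A B by (simp add: C_def)
    ultimately show ?thesis by (simp add: algebra_simps)
  qed
  then have "(\<integral>\<^sup>+x. ennreal (f x * g x) \<partial>M)
      \<le> (\<integral>\<^sup>+x. ennreal (C * (1 / (p * A)) * f x powr p + C * (1 / (q * B)) * g x powr q) \<partial>M)"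
    by (intro nn_integral_mono ennreal_leI)
  also have "\<dots> = (\<integral>\<^sup>+x. ennreal (C * (1 / (p * A))) * ennreal (f x powr p)
        + ennreal (C * (1 / (q * B))) * ennreal (g x powr q) \<partial>M)"
    using C A B pq by (intro nn_integral_cong) (simp add: ennreal_mult[symmetric] ennreal_plus[symmetric] del: ennreal_plus)
  also have "\<dots> = ennreal (C * (1 / (p * A))) * (\<integral>\<^sup>+x. ennreal (f x powr p) \<partial>M)
        + ennreal (C * (1 / (q * B))) * (\<integral>\<^sup>+x. ennreal (g x powr q) \<partial>M)"
    by (simp add: nn_integral_add nn_integral_cmult)
  also have "\<dots> \<le> ennreal (C * (1 / (p * A))) * ennreal A + ennreal (C * (1 / (q * B))) * ennreal B"
    by (intro add_mono mult_left_mono A B) auto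
  also have "\<dots> = ennreal (C * (1 / (p * A)) * A + C * (1 / (q * B)) * B)"
    using C A B pq by (simp add: ennreal_mult[symmetric] ennreal_plus[symmetric] del: ennreal_plus)
  also have "C * (1 / (p * A)) * A + C * (1 / (q * B)) * B = C * (1 / p + 1 / q)"
    using A B pq by (simp add: field_simps)
  finally show ?thesis using pq by (simp add: C_def)
qed

text \<open>Bounds that vanish are reached from \<open>A + \<epsilon>\<close> and
  \<open>B + \<epsilon>\<close> by letting \<epsilon> tend to 0.\<close>

lemma holder_nn_integral:
  fixes f g :: "'a \<Rightarrow> real"
  assumes pq: "1 < p" "1 < q" "1 / p + 1 / q = 1"
    and meas: "f \<in> borel_measurable M" "g \<in> borel_measurable M"
    and nn: "\<And>x. 0 \<le> f x" "\<And>x. 0 \<le> g x"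
    and A: "(\<integral>\<^sup>+x. ennreal (f x powr p) \<partial>M) \<le> ennreal A" "0 \<le> A"
    and B: "(\<integral>\<^sup>+x. ennreal (g x powr q) \<partial>M) \<le> ennreal B" "0 \<le> B"
  shows "(\<integral>\<^sup>+x. ennreal (f x * g x) \<partial>M) \<le> ennreal (A powr (1 / p) * B powr (1 / q))"
proof (rule tendsto_lowerbound)
  show "((\<lambda>\<epsilon>. ennreal ((A + \<epsilon>) powr (1 / p) * (B + \<epsilon>) powr (1 / q))) \<longlongrightarrow>
      ennreal (A powr (1 / p) * B powr (1 / q))) (at_right 0)"
  proof (intro tendsto_ennrealI tendsto_mult tendsto_powr2)
    show "((\<lambda>\<epsilon>. A + \<epsilon>) \<longlongrightarrow> A) (at_right 0)" "((\<lambda>\<epsilon>. B + \<epsilon>) \<longlongrightarrow> B) (at_right 0)"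
      by (auto intro!: tendsto_eq_intros)
    show "\<forall>\<^sub>F \<epsilon> in at_right 0. 0 \<le> A + \<epsilon>" "\<forall>\<^sub>F \<epsilon> in at_right 0. 0 \<le> B + \<epsilon>"
      using A(2) B(2) eventually_at_right_less[of "0::real"] by (auto elim!: eventually_mono)
  qed (use pq in auto)
  show "\<forall>\<^sub>F \<epsilon> in at_right 0. (\<integral>\<^sup>+x. ennreal (f x * g x) \<partial>M)
      \<le> ennreal ((A + \<epsilon>) powr (1 / p) * (B + \<epsilon>) powr (1 / q))"
    using eventually_at_right_less[of "0::real"]
  proof eventually_elim
    case (elim \<epsilon>)
    have "(\<integral>\<^sup>+x. ennreal (f x powr p) \<partial>M) \<le> ennreal (A + \<epsilon>)"
      "(\<integral>\<^sup>+x. ennreal (g x powr q) \<partial>M) \<le> ennreal (B + \<epsilon>)"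
      using elim by (auto intro!: order_trans[OF A(1)] order_trans[OF B(1)] ennreal_leI)
    then show ?case using elim A(2) B(2) by (intro holder_aux pq meas nn) auto
  qed
qed simp

section \<open>Test functions\<close>

lemma Ck_imp_has_derivative:
  assumes "Ck (Suc n) f" shows "(f has_derivative (\<lambda>h. grad f x \<bullet> h)) (at x)"
proof -
  let ?L = "frechet_derivative f (at x)"
  have d: "(f has_derivative ?L) (at x)" using assms by (simp add: frechet_derivative_works[symmetric])
  then interpret linear ?L by (rule has_derivative_linear)
  have "?L h = grad f x \<bullet> h" for h
  proof -
    have "?L h = ?L (\<Sum>b\<in>Basis. (h \<bullet> b) *\<^sub>R b)" by (simp add: euclidean_representation)
    also have "\<dots> = (\<Sum>b\<in>Basis. (h \<bullet> b) * ?L b)" by (simp add: sum scaleR)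
    also have "\<dots> = grad f x \<bullet> h"
      unfolding grad_def inner_sum_left by (intro sum.cong) (simp_all add: inner_commute[of h])
    finally show ?thesis .
  qed
  then have "?L = (\<lambda>h. grad f x \<bullet> h)" by auto
  then show ?thesis using d by simp
qed

lemma Ck_imp_continuous: "Ck n f \<Longrightarrow> continuous_on UNIV f"
  by (cases n) (auto intro!: continuous_at_imp_continuous_on differentiable_imp_continuous_within)

lemma Ck_grad_continuous: "Ck (Suc n) f \<Longrightarrow> continuous_on UNIV (grad f)"
  unfolding grad_def by (intro continuous_intros) (auto intro: Ck_imp_continuous)

lemma has_derivative_imp_grad:
  assumes "(f has_derivative (\<lambda>h. v \<bullet> h)) (at x)" shows "grad f x = v"
proof -
  have "frechet_derivative f (at x) = (\<lambda>h. v \<bullet> h)" using assms frechet_derivative_at by metis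
  then show ?thesis by (simp add: grad_def euclidean_representation)
qed

lemma test_functionsD:
  assumes "\<phi> \<in> test_functions \<Omega>"
  shows "Ck n \<phi>" "continuous_on UNIV \<phi>" "continuous_on UNIV (grad \<phi>)"
    "(\<phi> has_derivative (\<lambda>h. grad \<phi> x \<bullet> h)) (at x)"
    "\<phi> \<in> borel_measurable borel" "grad \<phi> \<in> borel_measurable borel"
proof -
  have C: "Ck n \<phi>" for n using assms by (simp add: test_functions_def)
  show "Ck n \<phi>" by (rule C)
  show c: "continuous_on UNIV \<phi>" "continuous_on UNIV (grad \<phi>)"
    using Ck_imp_continuous[OF C[of 0]] Ck_grad_continuous[OF C[of 1, unfolded One_nat_def]] by auto
  then show "\<phi> \<in> borel_measurable borel" "grad \<phi> \<in> borel_measurable borel"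
    by (simp_all add: borel_measurable_continuous_onI)
  show "(\<phi> has_derivative (\<lambda>h. grad \<phi> x \<bullet> h)) (at x)"
    by (rule Ck_imp_has_derivative[OF C[of "Suc 0"]])
qed

lemma test_functions_outside:
  assumes "\<phi> \<in> test_functions \<Omega>" "x \<notin> closure {x. \<phi> x \<noteq> 0}"
  shows "\<phi> x = 0" "grad \<phi> x = 0"
proof -
  let ?S = "- closure {x. \<phi> x \<noteq> 0}"
  have z: "\<phi> y = 0" if "y \<in> ?S" for y using that closure_subset[of "{x. \<phi> x \<noteq> 0}"] by auto
  have S: "open ?S" "x \<in> ?S" using assms(2) by auto
  show "\<phi> x = 0" by (rule z[OF S(2)])
  have "((\<lambda>y. 0) has_derivative (\<lambda>h. 0 \<bullet> h)) (at x)"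
    unfolding inner_zero_left by (rule has_derivative_const)
  then have "(\<phi> has_derivative (\<lambda>h. 0 \<bullet> h)) (at x)"
    by (rule has_derivative_transform_within_open[OF _ S]) (rule z[symmetric])
  then show "grad \<phi> x = 0" by (rule has_derivative_imp_grad)
qed

lemma test_functions_outside_domain:
  assumes "\<phi> \<in> test_functions \<Omega>" "x \<notin> \<Omega>"
  shows "\<phi> x = 0" "grad \<phi> x = 0"
  using assms test_functions_outside[OF assms(1), of x] by (auto simp: test_functions_def)

lemma test_functions_support_bounded:
  assumes "\<phi> \<in> test_functions \<Omega>"
  obtains R where "0 < R" "\<And>x. R < norm x \<Longrightarrow> \<phi> x = 0 \<and> grad \<phi> x = 0"
proof -
  have "bounded (closure {x. \<phi> x \<noteq> 0})"
    using assms by (simp add: test_functions_def compact_imp_bounded)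
  then obtain R where "0 < R" and R: "\<And>x. x \<in> closure {x. \<phi> x \<noteq> 0} \<Longrightarrow> norm x \<le> R"
    unfolding bounded_pos by blast
  have "\<phi> x = 0 \<and> grad \<phi> x = 0" if "R < norm x" for x
    using test_functions_outside[OF assms, of x] R[of x] that by force
  then show ?thesis using that \<open>0 < R\<close> by blast
qed

lemma test_functions_mono: "\<Omega> \<subseteq> \<Omega>' \<Longrightarrow> test_functions \<Omega> \<subseteq> test_functions \<Omega>'"
  by (auto simp: test_functions_def)

lemma compact_support_uniformly_continuous:
  fixes f :: "'a::euclidean_space \<Rightarrow> 'b::real_normed_vector"
  assumes "continuous_on UNIV f" and z: "\<And>x. R < norm x \<Longrightarrow> f x = 0" and "0 < \<epsilon>"
  obtains \<eta> where "0 < \<eta>" "\<And>x y. dist x y < \<eta> \<Longrightarrow> norm (f x - f y) < \<epsilon>"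
proof -
  have "uniformly_continuous_on (cball 0 (R + 1)) f"
    using assms(1) by (intro compact_uniformly_continuous) (auto intro: continuous_on_subset)
  then obtain \<eta> where \<eta>: "0 < \<eta>" "\<And>x y. x \<in> cball 0 (R + 1) \<Longrightarrow> y \<in> cball 0 (R + 1) \<Longrightarrow> dist y x < \<eta> \<Longrightarrow> dist (f y) (f x) < \<epsilon>"
    using \<open>0 < \<epsilon>\<close> unfolding uniformly_continuous_on_def by meson
  show ?thesis
  proof (rule that[of "min \<eta> 1"])
    show "0 < min \<eta> 1" using \<eta> by simp
    fix x y :: 'a assume d: "dist x y < min \<eta> 1"
    show "norm (f x - f y) < \<epsilon>"
    proof (cases "norm x \<le> R + 1 \<and> norm y \<le> R + 1")
      case True
      then show ?thesis using \<eta>(2)[of y x] d by (simp add: dist_norm)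
    next
      case False
      \<comment> \<open>At distance below 1, one point beyond radius \<open>R + 1\<close> puts both
        beyond \<open>R\<close>, where \<open>f\<close> vanishes; this is the reason for the larger
        ball in the compactness argument.\<close>
      have "\<bar>norm x - norm y\<bar> < 1" using d norm_triangle_ineq3[of x y] by (simp add: dist_norm)
      then have "R < norm x" "R < norm y" using False by linarith+
      then show ?thesis using z \<open>0 < \<epsilon>\<close> by simp
    qed
  qed
qed

text \<open>The gradient is uniformly continuous by compact support, so the mean value inequality
  for \<phi> minus its linear part at \<open>z\<close> holds with one \<eta> for all
  \<open>z\<close>.\<close>

lemma test_functions_taylor:
  assumes \<phi>: "\<phi> \<in> test_functions \<Omega>" and "0 < \<epsilon>"
  obtains \<eta> where "0 < \<eta>"
    "\<And>x z. dist x z < \<eta> \<Longrightarrow> \<bar>\<phi> x - \<phi> z - grad \<phi> z \<bullet> (x - z)\<bar> \<le> \<epsilon> * norm (x - z)"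
proof -
  obtain R where R: "\<And>x. R < norm x \<Longrightarrow> grad \<phi> x = 0"
    using test_functions_support_bounded[OF \<phi>] by metis
  obtain \<eta> where \<eta>: "0 < \<eta>" "\<And>x y. dist x y < \<eta> \<Longrightarrow> norm (grad \<phi> x - grad \<phi> y) < \<epsilon>"
    using compact_support_uniformly_continuous[OF test_functionsD(3)[OF \<phi>] R \<open>0 < \<epsilon>\<close>] by metis
  show ?thesis
  proof (rule that[OF \<eta>(1)])
    fix x z :: 'a assume xz: "dist x z < \<eta>"
    have "norm ((\<phi> x - grad \<phi> z \<bullet> x) - (\<phi> z - grad \<phi> z \<bullet> z)) \<le> \<epsilon> * norm (x - z)"
    proof (rule differentiable_bound)
      show "convex (ball z \<eta>)" by simp
      show "((\<lambda>w. \<phi> w - grad \<phi> z \<bullet> w) has_derivative (\<lambda>h. grad \<phi> w \<bullet> h - grad \<phi> z \<bullet> h)) (at w within ball z \<eta>)" for w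
        by (rule has_derivative_at_withinI)
           (intro has_derivative_diff test_functionsD(4)[OF \<phi>] has_derivative_inner_right has_derivative_ident)
      show "onorm (\<lambda>h. grad \<phi> w \<bullet> h - grad \<phi> z \<bullet> h) \<le> \<epsilon>" if "w \<in> ball z \<eta>" for w
      proof (rule onorm_bound)
        fix h
        have "norm (grad \<phi> w \<bullet> h - grad \<phi> z \<bullet> h) \<le> norm (grad \<phi> w - grad \<phi> z) * norm h"
          by (simp add: inner_diff_left[symmetric] Cauchy_Schwarz_ineq2)
        also have "\<dots> \<le> \<epsilon> * norm h"
          using \<eta>(2)[of w z] that by (intro mult_right_mono) (auto simp: dist_commute)
        finally show "norm (grad \<phi> w \<bullet> h - grad \<phi> z \<bullet> h) \<le> \<epsilon> * norm h" .
      qed (use \<open>0 < \<epsilon>\<close> in simp)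
    qed (use xz \<eta> in \<open>auto simp: dist_commute\<close>)
    then show "\<bar>\<phi> x - \<phi> z - grad \<phi> z \<bullet> (x - z)\<bar> \<le> \<epsilon> * norm (x - z)"
      by (simp add: inner_diff_right algebra_simps)
  qed
qed

lemma compact_support_bounded:
  fixes f :: "'a::euclidean_space \<Rightarrow> 'b::real_normed_vector"
  assumes "continuous_on UNIV f" and z: "\<And>x. R < norm x \<Longrightarrow> f x = 0"
  obtains C where "0 < C" "\<And>x. norm (f x) \<le> C"
proof -
  have "compact (f ` cball 0 R)"
    using assms(1) by (intro compact_continuous_image) (auto intro: continuous_on_subset)
  then obtain C where C: "0 < C" "\<And>y. y \<in> f ` cball 0 R \<Longrightarrow> norm y \<le> C"
    using compact_imp_bounded by (metis bounded_pos)
  have "norm (f x) \<le> C" for x using C(1) C(2)[of "f x"] z[of x] by (cases "norm x \<le> R") auto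
  then show ?thesis using that C(1) by blast
qed

lemma compact_support_integrable:
  fixes f :: "'a::euclidean_space \<Rightarrow> real"
  assumes c: "continuous_on UNIV f" and z: "\<And>x. R < norm x \<Longrightarrow> f x = 0"
  shows "integrable lborel f"
proof -
  have "integrable lborel (\<lambda>x. indicator (cball 0 R) x *\<^sub>R f x)"
    using c by (intro borel_integrable_compact) (auto intro: continuous_on_subset)
  moreover have "(\<lambda>x. indicator (cball 0 R) x *\<^sub>R f x) = f"
    using z by (auto simp: fun_eq_iff indicator_def not_le)
  ultimately show ?thesis by simp
qed

lemma test_functions_integrable:
  assumes \<phi>: "\<phi> \<in> test_functions \<Omega>" and "0 < p"
  shows "integrable lborel (\<lambda>x. \<bar>\<phi> x\<bar> powr p)" "integrable lborel (\<lambda>x. norm (grad \<phi> x) powr p)"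
    "integrable lborel (\<lambda>x. \<bar>\<phi> x\<bar>)"
proof -
  obtain R where R: "\<And>x. R < norm x \<Longrightarrow> \<phi> x = 0 \<and> grad \<phi> x = 0"
    using test_functions_support_bounded[OF \<phi>] by metis
  note c = test_functionsD(2,3)[OF \<phi>]
  show "integrable lborel (\<lambda>x. \<bar>\<phi> x\<bar> powr p)" 
    using R c \<open>0 < p\<close> by (intro compact_support_integrable[of _ R] continuous_on_powr' continuous_intros) auto
  show "integrable lborel (\<lambda>x. norm (grad \<phi> x) powr p)"
    using R c \<open>0 < p\<close> by (intro compact_support_integrable[of _ R] continuous_on_powr' continuous_intros) auto
  show "integrable lborel (\<lambda>x. \<bar>\<phi> x\<bar>)"
    using R c by (intro compact_support_integrable[of _ R] continuous_intros) auto
qed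

section \<open>Saint-Venant's inequality for test functions\<close>

lemma ball_borel_measurable [measurable]: "ball c r \<in> sets (borel :: 'a::euclidean_space measure)"
  by simp

definition level_radius :: "('a::euclidean_space \<Rightarrow> real) \<Rightarrow> real \<Rightarrow> real" where
  "level_radius f s = root DIM('a) (vol {x. s < \<bar>f x\<bar>} / unit_ball_vol (real DIM('a)))"

lemma level_radius_nonneg [simp]: "0 \<le> level_radius f s" by (simp add: level_radius_def)

lemma level_radius_measurable [measurable]:
  assumes [measurable]: "f \<in> borel_measurable borel"
  shows "level_radius f \<in> borel_measurable borel"
proof -
  have [measurable]: "(\<lambda>s. emeasure lborel {x. s < \<bar>f x\<bar>}) \<in> borel_measurable borel" by measurable
  show ?thesis unfolding level_radius_def measure_def by measurable
qed

lemma level_radius_power: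
  fixes f :: "'a::euclidean_space \<Rightarrow> real"
  shows "unit_ball_vol (real DIM('a)) * level_radius f s ^ DIM('a) = vol {x. s < \<bar>f x\<bar>}"
  using unit_ball_vol_pos[of "real DIM('a)"] by (simp add: level_radius_def less_imp_neq[symmetric])

lemma level_radius_antimono:
  assumes "{x. s < \<bar>f x\<bar>} \<in> fmeasurable lborel" "f \<in> borel_measurable borel" "s \<le> s'"
  shows "level_radius f s' \<le> level_radius f s"
proof -
  have [measurable]: "f \<in> borel_measurable borel" by fact
  have "vol {x. s' < \<bar>f x\<bar>} \<le> vol {x. s < \<bar>f x\<bar>}"
    using assms by (intro measure_mono_fmeasurable) auto
  then show ?thesis unfolding level_radius_def by (intro real_root_le_mono divide_right_mono) auto
qed

lemma test_functions_superlevel: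
  fixes \<phi> :: "'a::euclidean_space \<Rightarrow> real"
  assumes \<phi>: "\<phi> \<in> test_functions \<Omega>" and "0 \<le> s"
  shows "open {x. s < \<bar>\<phi> x\<bar>}" "bounded {x. s < \<bar>\<phi> x\<bar>}" "{x. s < \<bar>\<phi> x\<bar>} \<in> fmeasurable lborel"
proof -
  have c: "continuous_on UNIV \<phi>" by (rule test_functionsD[OF \<phi>])
  show o: "open {x. s < \<bar>\<phi> x\<bar>}" by (intro open_Collect_less continuous_intros c)
  obtain R where R: "\<And>x. R < norm x \<Longrightarrow> \<phi> x = 0 \<and> grad \<phi> x = 0"
    by (rule test_functions_support_bounded[OF \<phi>]) blast
  have "norm x \<le> R" if "s < \<bar>\<phi> x\<bar>" for x using R[of x] that \<open>0 \<le> s\<close> by (cases "R < norm x") auto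
  then show b: "bounded {x. s < \<bar>\<phi> x\<bar>}" unfolding bounded_iff by blast
  show "{x. s < \<bar>\<phi> x\<bar>} \<in> fmeasurable lborel" by (rule bounded_open_fmeasurable[OF o b])
qed

text \<open>The two summands have volume radii \<open>r\<close> and \<open>t * r\<close>;
  Brunn--Minkowski says that volume radii at least add, here to \<open>(1 + t) * r\<close>.\<close>

lemma superlevel_neighbourhood:
  fixes \<phi> :: "'a::euclidean_space \<Rightarrow> real"
  assumes \<phi>: "\<phi> \<in> test_functions \<Omega>" and "0 \<le> s" "0 < t" and ne: "{x. s < \<bar>\<phi> x\<bar>} \<noteq> {}"
  shows "(1 + t) ^ DIM('a) * vol {x. s < \<bar>\<phi> x\<bar>}
      \<le> vol (sumset {x. s < \<bar>\<phi> x\<bar>} (ball 0 (t * level_radius \<phi> s)))"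
proof -
  let ?U = "{x. s < \<bar>\<phi> x\<bar>}" and ?d = "DIM('a)" and ?\<omega> = "unit_ball_vol (real DIM('a))"
  let ?r = "level_radius \<phi> s"
  note U = test_functions_superlevel[OF \<phi> \<open>0 \<le> s\<close>]
  have \<omega>: "0 < ?\<omega>" by simp
  have pU: "0 < vol ?U" using U ne by (intro open_measure_pos)
  then have r: "0 < ?r" using \<omega> by (simp add: level_radius_def)
  have mU: "vol ?U = ?\<omega> * ?r ^ ?d" by (simp add: level_radius_power)
  have "vol (ball (0::'a) (t * ?r)) = ?\<omega> * (t * ?r) ^ ?d"
    using \<open>0 < t\<close> r by (simp add: content_ball)
  then have "root ?d (vol ?U) + root ?d (vol (ball (0::'a) (t * ?r)))
      = root ?d ?\<omega> * ((1 + t) * ?r)"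
    using mU r \<open>0 < t\<close> by (simp add: real_root_mult real_root_power_cancel algebra_simps)
  moreover have "(root ?d ?\<omega> * ((1 + t) * ?r)) ^ ?d = (1 + t) ^ ?d * vol ?U"
    using mU \<omega> by (simp add: power_mult_distrib less_imp_le)
  moreover have "ball (0::'a) (t * ?r) \<noteq> {}" using mult_pos_pos[OF \<open>0 < t\<close> r] by (simp add: not_le)
  ultimately show ?thesis
    using brunn_minkowski[OF U(1,2) ne open_ball bounded_ball, of 0 "t * ?r"] by metis
qed

text \<open>A point \<open>z\<close> of the enlarged set that is not yet above level
  \<open>s\<close> is reached by the first-order gain of \<phi> over a step of length less than
  \<open>t * level_radius \<phi> s\<close>. The right-hand side must be the superlevel set of one
  function independent of \<open>s\<close>, which is why the radius is taken at the level of
  \<open>z\<close>. The indicator keeps the error term integrable.\<close>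

lemma superlevel_neighbourhood_subset:
  fixes \<phi> :: "'a::euclidean_space \<Rightarrow> real"
  assumes \<phi>: "\<phi> \<in> test_functions \<Omega>" and s: "0 < s" and t: "0 < t"
    and M: "\<And>x. M < norm x \<Longrightarrow> \<phi> x = 0"
    and \<eta>: "\<And>x z. dist x z < \<eta> \<Longrightarrow> \<bar>\<phi> x - \<phi> z - grad \<phi> z \<bullet> (x - z)\<bar> \<le> \<epsilon> * norm (x - z)"
    and \<epsilon>: "0 < \<epsilon>" and tR: "t * level_radius \<phi> 0 < min \<eta> 1"
  shows "sumset {x. s < \<bar>\<phi> x\<bar>} (ball 0 (t * level_radius \<phi> s))
      \<subseteq> {z. s < \<bar>\<phi> z\<bar> + t * (level_radius \<phi> \<bar>\<phi> z\<bar> * norm (grad \<phi> z)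
              + \<epsilon> * level_radius \<phi> \<bar>\<phi> z\<bar> * indicator (ball 0 (M + 1)) z)}"
proof
  fix z assume "z \<in> sumset {x. s < \<bar>\<phi> x\<bar>} (ball 0 (t * level_radius \<phi> s))"
  then obtain x y where x: "s < \<bar>\<phi> x\<bar>" and y: "norm y < t * level_radius \<phi> s" and z: "z = x + y"
    by (auto simp: sumset_def)
  note fm = test_functions_superlevel(3)[OF \<phi>] and meas = test_functionsD(5)[OF \<phi>]
  have "t * level_radius \<phi> s \<le> t * level_radius \<phi> 0"
    using s t by (intro mult_left_mono level_radius_antimono fm meas) auto
  then have yl: "norm y < \<eta>" "norm y < 1" using y tR by auto
  have "norm x \<le> M" using x s M[of x] by (cases "M < norm x") auto
  then have zK: "z \<in> ball 0 (M + 1)" using yl norm_triangle_ineq[of x y] by (simp add: z)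
  show "z \<in> {z. s < \<bar>\<phi> z\<bar> + t * (level_radius \<phi> \<bar>\<phi> z\<bar> * norm (grad \<phi> z)
              + \<epsilon> * level_radius \<phi> \<bar>\<phi> z\<bar> * indicator (ball 0 (M + 1)) z)}"
  proof (cases "s < \<bar>\<phi> z\<bar>")
    case True
    have "0 \<le> t * (level_radius \<phi> \<bar>\<phi> z\<bar> * norm (grad \<phi> z)
              + \<epsilon> * level_radius \<phi> \<bar>\<phi> z\<bar> * indicator (ball 0 (M + 1)) z)"
      using t \<epsilon> by (intro mult_nonneg_nonneg add_nonneg_nonneg) auto
    then show ?thesis using True by simp
  next
    case False
    \<comment> \<open>The level of \<open>z\<close> is at most \<open>s\<close>, so its superlevel
      set is larger: this is where the \<open>s\<close>-dependent radius is traded for one depending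
      on \<open>z\<close> only.\<close>
    then have R: "level_radius \<phi> s \<le> level_radius \<phi> \<bar>\<phi> z\<bar>"
      by (intro level_radius_antimono fm meas) auto
    have "\<bar>\<phi> x - \<phi> z - grad \<phi> z \<bullet> (x - z)\<bar> \<le> \<epsilon> * norm y"
      using \<eta>[of x z] yl by (simp add: z dist_norm)
    moreover have "\<bar>grad \<phi> z \<bullet> (x - z)\<bar> \<le> norm (grad \<phi> z) * norm y"
      using Cauchy_Schwarz_ineq2[of "grad \<phi> z" "x - z"] by (simp add: z)
    ultimately have "\<bar>\<phi> x\<bar> \<le> \<bar>\<phi> z\<bar> + (norm (grad \<phi> z) + \<epsilon>) * norm y" by (simp add: distrib_right)
    also have "\<dots> \<le> \<bar>\<phi> z\<bar> + (norm (grad \<phi> z) + \<epsilon>) * (t * level_radius \<phi> \<bar>\<phi> z\<bar>)"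
    proof (intro add_left_mono mult_left_mono)
      show "norm y \<le> t * level_radius \<phi> \<bar>\<phi> z\<bar>"
        using y mult_left_mono[OF R less_imp_le[OF t]] by linarith
    qed (use \<epsilon> in auto)
    finally show ?thesis using x zK by (simp add: algebra_simps)
  qed
qed

text \<open>The isoperimetric inequality for all superlevel sets of \<open>\<bar>\<phi>\<bar>\<close> at once. Enlarging each superlevel
  set by a ball of \<open>t\<close> times its own volume radius multiplies its volume by at least \<open>(1 + t) ^ d\<close>, so no
  coarea formula is needed.\<close>

lemma integral_level_radius_grad:
  fixes \<phi> :: "'a::euclidean_space \<Rightarrow> real"
  assumes \<phi>: "\<phi> \<in> test_functions \<Omega>"
  shows "ennreal (real DIM('a)) * (\<integral>\<^sup>+x. ennreal \<bar>\<phi> x\<bar> \<partial>lborel)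
      \<le> (\<integral>\<^sup>+x. ennreal (level_radius \<phi> \<bar>\<phi> x\<bar> * norm (grad \<phi> x)) \<partial>lborel)" (is "?L \<le> ?X")
proof (rule ennreal_le_epsilon)
  fix e :: real assume fin: "?X < top" and e: "0 < e"
  have [measurable]: "\<phi> \<in> borel_measurable borel" "grad \<phi> \<in> borel_measurable borel"
    using test_functionsD[OF \<phi>] by auto
  let ?d = "DIM('a)" and ?R = "\<lambda>x. level_radius \<phi> \<bar>\<phi> x\<bar>"
  obtain M where M: "\<And>x. M < norm x \<Longrightarrow> \<phi> x = 0 \<and> grad \<phi> x = 0"
    by (rule test_functions_support_bounded[OF \<phi>]) blast
  let ?K = "ball (0::'a) (M + 1)"
  define Y where "Y = level_radius \<phi> 0 * vol ?K"
  have Y: "0 \<le> Y" by (simp add: Y_def)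
  \<comment> \<open>The Taylor error integrates to at most \<open>\<epsilon> * Y \<le> e\<close>;
    the added 1 covers \<open>Y = 0\<close>.\<close>
  define \<epsilon> where "\<epsilon> = e / (Y + 1)"
  have \<epsilon>: "0 < \<epsilon>" using e Y by (simp add: \<epsilon>_def)
  have "\<epsilon> * Y \<le> e" using e Y by (simp add: \<epsilon>_def field_simps)
  obtain \<eta> where \<eta>: "0 < \<eta>"
    "\<And>x z. dist x z < \<eta> \<Longrightarrow> \<bar>\<phi> x - \<phi> z - grad \<phi> z \<bullet> (x - z)\<bar> \<le> \<epsilon> * norm (x - z)"
    by (rule test_functions_taylor[OF \<phi> \<epsilon>]) blast
  \<comment> \<open>The radius at level 0 is the largest one, so this \<open>t\<close> keeps every
    enlargement within the Taylor range \<eta> and within distance 1 of the support.\<close>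
  define t where "t = min \<eta> 1 / (level_radius \<phi> 0 + 1)"
  have R1: "0 < level_radius \<phi> 0 + 1" by (simp add: add_nonneg_pos)
  have t: "0 < t" using \<eta>(1) R1 by (simp add: t_def)
  have tR: "t * level_radius \<phi> 0 < min \<eta> 1"
  proof -
    have "min \<eta> 1 * level_radius \<phi> 0 < min \<eta> 1 * (level_radius \<phi> 0 + 1)"
      using \<eta>(1) by (intro mult_strict_left_mono) auto
    then show ?thesis by (simp only: t_def times_divide_eq_left pos_divide_less_eq[OF R1])
  qed
  define H where "H z = \<bar>\<phi> z\<bar> + t * (?R z * norm (grad \<phi> z) + \<epsilon> * ?R z * indicator ?K z)" for z
  have [measurable]: "H \<in> borel_measurable borel" unfolding H_def by measurable
  have "ennreal ((1 + t) ^ ?d) * (\<integral>\<^sup>+x. ennreal \<bar>\<phi> x\<bar> \<partial>lborel) \<le> (\<integral>\<^sup>+x. ennreal (H x) \<partial>lborel)"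
  proof (rule nn_integral_le_superlevel)
    fix s :: real assume s: "0 < s"
    let ?U = "{x. s < \<bar>\<phi> x\<bar>}"
    note U = test_functions_superlevel[OF \<phi> less_imp_le[OF s]]
    show "ennreal ((1 + t) ^ ?d) * emeasure lborel ?U \<le> emeasure lborel {x. s < H x}"
    proof (cases "?U = {}")
      case False
      have "ennreal ((1 + t) ^ ?d) * emeasure lborel ?U = ennreal ((1 + t) ^ ?d * vol ?U)"
        using U(3) t by (simp add: emeasure_eq_measure2 ennreal_mult)
      also have "\<dots> \<le> ennreal (vol (sumset ?U (ball 0 (t * level_radius \<phi> s))))"
        using s t False by (intro ennreal_leI superlevel_neighbourhood[OF \<phi>]) auto
      also have "\<dots> = emeasure lborel (sumset ?U (ball 0 (t * level_radius \<phi> s)))"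
        using U by (intro emeasure_eq_measure2[symmetric] bounded_open_fmeasurable open_sumset bounded_sumset) auto
      also have "\<dots> \<le> emeasure lborel {x. s < H x}"
      proof (rule emeasure_mono)
        show "sumset ?U (ball 0 (t * level_radius \<phi> s)) \<subseteq> {x. s < H x}"
          unfolding H_def using M \<eta> by (intro superlevel_neighbourhood_subset[OF \<phi> s t _ _ \<epsilon> tR]) auto
      qed measurable
      finally show ?thesis .
    qed simp
  qed measurable
  also have "(\<integral>\<^sup>+x. ennreal (H x) \<partial>lborel) = (\<integral>\<^sup>+x. ennreal \<bar>\<phi> x\<bar> + ennreal t * (ennreal (?R x * norm (grad \<phi> x))
       + ennreal (\<epsilon> * ?R x) * indicator ?K x) \<partial>lborel)" unfolding H_def using t \<epsilon>
    by (intro nn_integral_cong) (simp add: ennreal_mult ennreal_plus ennreal_indicator)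
  also have "\<dots> = (\<integral>\<^sup>+x. ennreal \<bar>\<phi> x\<bar> \<partial>lborel)
      + ennreal t * (?X + (\<integral>\<^sup>+x. ennreal (\<epsilon> * ?R x) * indicator ?K x \<partial>lborel))"
    by (simp add: nn_integral_add nn_integral_cmult)
  also have "(\<integral>\<^sup>+x. ennreal (\<epsilon> * ?R x) * indicator ?K x \<partial>lborel) \<le> (\<integral>\<^sup>+x. ennreal (\<epsilon> * level_radius \<phi> 0) * indicator ?K x \<partial>lborel)"
    using \<epsilon> by (intro nn_integral_mono mult_right_mono ennreal_leI mult_left_mono level_radius_antimono
        test_functions_superlevel[OF \<phi>]) auto
  also have "\<dots> = ennreal (\<epsilon> * Y)" using \<epsilon> emeasure_lborel_ball_finite[of "0::'a" "M + 1"]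
    by (simp add: nn_integral_cmult_indicator Y_def ennreal_mult emeasure_eq_ennreal_measure) (simp add: mult.assoc)
  also have "\<dots> \<le> ennreal e" using \<open>\<epsilon> * Y \<le> e\<close> by (rule ennreal_leI)
  finally have main: "ennreal ((1 + t) ^ ?d) * (\<integral>\<^sup>+x. ennreal \<bar>\<phi> x\<bar> \<partial>lborel)
      \<le> (\<integral>\<^sup>+x. ennreal \<bar>\<phi> x\<bar> \<partial>lborel) + ennreal t * (?X + ennreal e)"
    by (simp add: add_left_mono mult_left_mono)
  obtain x where x: "?X = ennreal x" "0 \<le> x" using fin by (cases ?X) auto
  have "integrable lborel (\<lambda>x. \<bar>\<phi> x\<bar>)" using test_functions_integrable(3)[OF \<phi>, of 1] by simp
  then obtain i where i: "(\<integral>\<^sup>+x. ennreal \<bar>\<phi> x\<bar> \<partial>lborel) = ennreal i" "0 \<le> i"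
    by (metis nn_integral_eq_integral abs_ge_zero always_eventually integral_nonneg_AE)
  \<comment> \<open>Bernoulli extracts the factor \<open>d\<close> at the fixed \<open>t\<close>:
    after cancelling \<open>i\<close>, both sides are multiples of \<open>t\<close>.\<close>
  have "(1 + real ?d * t) * i \<le> (1 + t) ^ ?d * i"
    using Bernoulli_inequality[of t ?d] t i(2) by (intro mult_right_mono) auto
  also have "\<dots> \<le> i + t * (x + e)"
    using main t i x e by (simp add: ennreal_mult[symmetric] ennreal_plus[symmetric] del: ennreal_plus)
  finally have "t * (real ?d * i) \<le> t * (x + e)" by (simp add: algebra_simps)
  then have "real ?d * i \<le> x + e" using t by simp
  then show "?L \<le> ?X + ennreal e"
    using i x e by (simp add: ennreal_mult[symmetric] ennreal_plus[symmetric] del: ennreal_plus)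
qed

text \<open>If the level radius at \<open>\<bar>f x\<bar>\<close> exceeds \<kappa>, the set where
  \<open>\<bar>f\<bar>\<close> is larger than at \<open>x\<close> has at least the volume of a ball
  of radius \<kappa>; its complement \<open>L \<bar>f x\<bar>\<close> in \<Omega> is correspondingly
  small. The set in question is covered by such complements.\<close>

lemma emeasure_small_level_radius:
  fixes f :: "'a::euclidean_space \<Rightarrow> real"
  assumes [measurable]: "f \<in> borel_measurable borel" and \<Omega>: "\<Omega> \<in> fmeasurable lborel"
    and z: "\<And>x. x \<notin> \<Omega> \<Longrightarrow> f x = 0" and bdd: "\<And>x. \<bar>f x\<bar> \<le> C"
    and "0 \<le> \<kappa>"
  shows "emeasure lborel {x\<in>\<Omega>. \<kappa> < level_radius f \<bar>f x\<bar>}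
      \<le> ennreal (vol \<Omega> - unit_ball_vol (real DIM('a)) * \<kappa> ^ DIM('a))"
    (is "emeasure lborel ?E \<le> ennreal ?c")
proof -
  have [measurable]: "\<Omega> \<in> sets borel" using \<Omega> by auto
  define L where "L s = {y\<in>\<Omega>. \<bar>f y\<bar> \<le> s}" for s
  have [measurable]: "L s \<in> sets borel" for s unfolding L_def by measurable
  have L: "emeasure lborel (L \<bar>f x\<bar>) \<le> ennreal ?c" if "x \<in> ?E" for x
  proof -
    let ?U = "{y. \<bar>f x\<bar> < \<bar>f y\<bar>}"
    have "?U \<subseteq> \<Omega>" using z by force
    then have fU: "?U \<in> fmeasurable lborel" by (intro fmeasurableI2[OF \<Omega>]) auto
    have "L \<bar>f x\<bar> = \<Omega> - ?U" by (auto simp: L_def)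
    have fL: "L \<bar>f x\<bar> \<in> fmeasurable lborel" unfolding L_def by (intro fmeasurableI2[OF \<Omega>]) auto
    have "vol \<Omega> = vol ?U + vol (\<Omega> - ?U)"
      using measure_Un2[OF fU \<Omega>] \<open>?U \<subseteq> \<Omega>\<close> by (simp add: Un_absorb1)
    moreover have "\<kappa> ^ DIM('a) \<le> level_radius f \<bar>f x\<bar> ^ DIM('a)"
      using that \<open>0 \<le> \<kappa>\<close> by (intro power_mono) auto
    then have "unit_ball_vol (real DIM('a)) * \<kappa> ^ DIM('a) \<le> vol ?U"
      using mult_left_mono[of "\<kappa> ^ DIM('a)" _ "unit_ball_vol (real DIM('a))"]
      by (simp add: level_radius_power[symmetric])
    ultimately have "vol (L \<bar>f x\<bar>) \<le> ?c" using \<open>L \<bar>f x\<bar> = \<Omega> - ?U\<close> by simp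
    then show ?thesis using fL by (simp add: emeasure_eq_measure2 ennreal_leI)
  qed
  show ?thesis
  proof (cases "?E = {}")
    case True
    then show ?thesis by (simp only: emeasure_empty zero_le)
  next
    case False
    \<comment> \<open>The sets \<open>L s\<close> grow with \<open>s\<close>, so the largest values
      of \<open>\<bar>f\<bar>\<close> on \<open>?E\<close> decide. If the supremum is attained, a
      single \<open>L\<close> covers \<open>?E\<close>; otherwise \<open>?E\<close> is exhausted by
      the increasing sets \<open>A n\<close>, each inside some \<open>L\<close>.\<close>
    define \<sigma> where "\<sigma> = Sup ((\<lambda>x. \<bar>f x\<bar>) ` ?E)"
    have bd: "bdd_above ((\<lambda>x. \<bar>f x\<bar>) ` ?E)" using bdd by (intro bdd_aboveI[of _ C]) auto
    have le: "\<bar>f x\<bar> \<le> \<sigma>" if "x \<in> ?E" for x unfolding \<sigma>_def using bd that by (intro cSup_upper) auto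
    show ?thesis
    proof (cases "\<exists>x\<in>?E. \<bar>f x\<bar> = \<sigma>")
      case True
      then obtain x where x: "x \<in> ?E" "\<bar>f x\<bar> = \<sigma>" by blast
      have "?E \<subseteq> L \<bar>f x\<bar>" using le x(2) by (auto simp: L_def)
      then have "emeasure lborel ?E \<le> emeasure lborel (L \<bar>f x\<bar>)" by (intro emeasure_mono) auto
      then show ?thesis using L[OF x(1)] by (rule order_trans)
    next
      case False
      then have less: "\<bar>f x\<bar> < \<sigma>" if "x \<in> ?E" for x using le[OF that] that by fastforce
      define A where "A n = {y\<in>?E. \<bar>f y\<bar> \<le> \<sigma> - 1 / real (Suc n)}" for n
      have [measurable]: "A n \<in> sets borel" for n unfolding A_def by measurable
      have "emeasure lborel (A n) \<le> ennreal ?c" for n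
      proof -
        have "\<sigma> - 1 / real (Suc n) < Sup ((\<lambda>x. \<bar>f x\<bar>) ` ?E)" by (simp add: \<sigma>_def)
        then obtain x where x: "x \<in> ?E" "\<sigma> - 1 / real (Suc n) < \<bar>f x\<bar>"
          using \<open>?E \<noteq> {}\<close> less_cSup_iff[OF _ bd] by (auto simp del: of_nat_Suc)
        then have "A n \<subseteq> L \<bar>f x\<bar>" by (auto simp: A_def L_def simp del: of_nat_Suc)
        then have "emeasure lborel (A n) \<le> emeasure lborel (L \<bar>f x\<bar>)" by (intro emeasure_mono) auto
        then show ?thesis using L[OF x(1)] by (rule order_trans)
      qed
      then have "(SUP n. emeasure lborel (A n)) \<le> ennreal ?c" by (intro SUP_least)
      moreover have "incseq A"
      proof (rule incseq_SucI)
        fix n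
        have "1 / real (Suc (Suc n)) \<le> 1 / real (Suc n)" by (intro divide_left_mono) auto
        then show "A n \<subseteq> A (Suc n)" by (auto simp: A_def simp del: of_nat_Suc)
      qed
      moreover have "(\<Union>n. A n) = ?E"
      proof
        show "?E \<subseteq> (\<Union>n. A n)"
        proof
          fix x assume x: "x \<in> ?E"
          then obtain n where "1 / real (Suc n) < \<sigma> - \<bar>f x\<bar>"
            using reals_Archimedean[of "\<sigma> - \<bar>f x\<bar>"] less[OF x] by (auto simp: inverse_eq_divide)
          then have "\<bar>f x\<bar> \<le> \<sigma> - 1 / real (Suc n)" by linarith
          then show "x \<in> (\<Union>n. A n)" using x unfolding A_def by blast
        qed
      qed (auto simp: A_def)
      moreover have "range A \<subseteq> sets lborel" by auto
      ultimately show ?thesis using SUP_emeasure_incseq[of A lborel] by simp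
    qed
  qed
qed

text \<open>The \<open>itself\<close> argument fixes the space and thereby the dimension, which
  \<open>a\<close> and \<rho> do not reveal.\<close>

definition ball_moment :: "'a::euclidean_space itself \<Rightarrow> real \<Rightarrow> real \<Rightarrow> real" where
  "ball_moment _ a \<rho> = (LINT y:ball (0::'a) \<rho>|lborel. norm y powr a)"

lemma ball_moment_eq:
  assumes "0 < a"
  shows "(\<integral>\<^sup>+y. ennreal (indicator (ball (0::'a::euclidean_space) \<rho>) y * norm y powr a) \<partial>lborel)
      = ennreal (ball_moment TYPE('a) a \<rho>)"
    and "0 \<le> ball_moment TYPE('a) a \<rho>"
proof -
  have "set_integrable lborel (cball (0::'a) \<rho>) (\<lambda>y. norm y powr a)"
    unfolding set_integrable_def using assms
    by (intro borel_integrable_compact continuous_on_powr' continuous_intros) auto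
  then have "set_integrable lborel (ball (0::'a) \<rho>) (\<lambda>y. norm y powr a)"
    by (rule set_integrable_subset) auto
  then have i: "integrable lborel (\<lambda>y. indicator (ball (0::'a) \<rho>) y * norm y powr a)"
    by (simp add: set_integrable_def)
  show "(\<integral>\<^sup>+y. ennreal (indicator (ball (0::'a) \<rho>) y * norm y powr a) \<partial>lborel)
      = ennreal (ball_moment TYPE('a) a \<rho>)"
    using nn_integral_eq_integral[OF i] by (simp add: ball_moment_def set_lebesgue_integral_def)
  show "0 \<le> ball_moment TYPE('a) a \<rho>"
    unfolding ball_moment_def set_lebesgue_integral_def by (intro integral_nonneg_AE) simp
qed

text \<open>Superlevel sets are compared at each level. With \<open>s = \<kappa> powr a\<close>, the
  ball contributes the shell between radii \<kappa> and \<rho>, whose volume is exactly the bound of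
  \<open>emeasure_small_level_radius\<close>.\<close>

lemma level_radius_moment:
  fixes f :: "'a::euclidean_space \<Rightarrow> real"
  assumes [measurable]: "f \<in> borel_measurable borel" and \<Omega>: "\<Omega> \<in> fmeasurable lborel"
    and z: "\<And>x. x \<notin> \<Omega> \<Longrightarrow> f x = 0" and bdd: "\<And>x. \<bar>f x\<bar> \<le> C" and a: "0 < a"
    and \<rho>: "0 \<le> \<rho>" "vol \<Omega> = unit_ball_vol (real DIM('a)) * \<rho> ^ DIM('a)"
  shows "(\<integral>\<^sup>+x. ennreal (indicator \<Omega> x * level_radius f \<bar>f x\<bar> powr a) \<partial>lborel)
      \<le> ennreal (ball_moment TYPE('a) a \<rho>)"
proof -
  let ?\<omega> = "unit_ball_vol (real DIM('a))"
  have [measurable]: "\<Omega> \<in> sets borel" using \<Omega> by auto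
  have m1: "(\<lambda>x. indicator \<Omega> x * level_radius f \<bar>f x\<bar> powr a) \<in> borel_measurable borel" by measurable
  have m2: "(\<lambda>y::'a. indicator (ball 0 \<rho>) y * norm y powr a) \<in> borel_measurable borel" by measurable
  have "1 * (\<integral>\<^sup>+x. ennreal (indicator \<Omega> x * level_radius f \<bar>f x\<bar> powr a) \<partial>lborel)
      \<le> (\<integral>\<^sup>+y. ennreal (indicator (ball (0::'a) \<rho>) y * norm y powr a) \<partial>lborel)"
  proof (rule nn_integral_le_superlevel[OF m1 m2])
    fix s :: real assume s: "0 < s"
    define \<kappa> where "\<kappa> = s powr (1 / a)"
    have \<kappa>: "0 < \<kappa>" "s = \<kappa> powr a" using s a by (auto simp: \<kappa>_def powr_powr)
    have iff: "s < r powr a \<longleftrightarrow> \<kappa> < r" if "0 \<le> r" for r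
      unfolding \<kappa>(2) using that \<kappa> a by (metis less_eq_real_def not_less powr_less_mono2 powr_mono2)
    have F: "{x. s < indicator \<Omega> x * level_radius f \<bar>f x\<bar> powr a} = {x\<in>\<Omega>. \<kappa> < level_radius f \<bar>f x\<bar>}"
      using s iff by (auto simp: indicator_def split: if_splits)
    have G: "{y. s < indicator (ball (0::'a) \<rho>) y * norm y powr a} = ball 0 \<rho> - cball 0 \<kappa>"
      using s iff by (auto simp: indicator_def split: if_splits)
    have "emeasure lborel {x\<in>\<Omega>. \<kappa> < level_radius f \<bar>f x\<bar>} \<le> ennreal (vol \<Omega> - ?\<omega> * \<kappa> ^ DIM('a))"
      using \<kappa> by (intro emeasure_small_level_radius[OF _ \<Omega> z bdd]) auto
    also have "\<dots> \<le> emeasure lborel (ball (0::'a) \<rho> - cball 0 \<kappa>)"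
    proof (cases "\<kappa> < \<rho>")
      case True
      have "vol (ball (0::'a) \<rho> - cball 0 \<kappa>) = ?\<omega> * \<rho> ^ DIM('a) - ?\<omega> * \<kappa> ^ DIM('a)"
        using True \<kappa> \<rho> emeasure_lborel_ball_finite[of "0::'a" \<rho>]
        by (subst measure_Diff) (auto simp: content_ball content_cball)
      moreover have "ball (0::'a) \<rho> - cball 0 \<kappa> \<in> fmeasurable lborel"
        using emeasure_lborel_ball_finite[of "0::'a" \<rho>] emeasure_lborel_cball_finite[of "0::'a" \<kappa>]
        by (intro fmeasurable.Diff) (auto simp: fmeasurable_def)
      ultimately show ?thesis using \<rho> by (simp add: emeasure_eq_measure2)
    next
      case False
      \<comment> \<open>For \<open>\<kappa> \<ge> \<rho>\<close> the shell is empty, and the bound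
        on the other side is not positive, so \<open>ennreal\<close> turns it into 0.\<close>
      then have "?\<omega> * \<rho> ^ DIM('a) \<le> ?\<omega> * \<kappa> ^ DIM('a)"
        using \<rho> by (intro mult_left_mono power_mono) auto
      then show ?thesis using \<rho> by (simp add: ennreal_neg)
    qed
    finally show "1 * emeasure lborel {x. s < indicator \<Omega> x * level_radius f \<bar>f x\<bar> powr a}
        \<le> emeasure lborel {y. s < indicator (ball (0::'a) \<rho>) y * norm y powr a}"
      unfolding F G by simp
  qed
  then show ?thesis using ball_moment_eq[OF a, where 'a='a] by simp
qed

text \<open>Hoelder separates the gradient from the level radius in
  \<open>integral_level_radius_grad\<close>; the second factor is the moment bounded by that of the
  ball of equal volume.\<close>

lemma saint_venant_test_functions:
  fixes \<phi> :: "'a::euclidean_space \<Rightarrow> real"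
  assumes \<phi>: "\<phi> \<in> test_functions \<Omega>" and \<Omega>: "\<Omega> \<in> fmeasurable lborel" and p: "1 < p"
    and \<rho>: "0 \<le> \<rho>" "vol \<Omega> = unit_ball_vol (real DIM('a)) * \<rho> ^ DIM('a)"
  shows "(LINT x|lborel. \<bar>\<phi> x\<bar>) powr p
      \<le> ball_moment TYPE('a) (p / (p - 1)) \<rho> powr (p - 1) / real DIM('a) powr p
          * (LINT x|lborel. norm (grad \<phi> x) powr p)"
proof -
  let ?J = "ball_moment TYPE('a) (p / (p - 1)) \<rho>" and ?q = "p / (p - 1)"
  define A where "A = (LINT x|lborel. norm (grad \<phi> x) powr p)"
  define i where "i = (LINT x|lborel. \<bar>\<phi> x\<bar>)"
  have q: "1 < ?q" "1 / p + 1 / ?q = 1" "0 < ?q" using p by (auto simp: field_simps)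
  note J = ball_moment_eq[OF q(3), where 'a='a and \<rho>=\<rho>]
  have [measurable]: "\<phi> \<in> borel_measurable borel" "grad \<phi> \<in> borel_measurable borel"
    using test_functionsD[OF \<phi>] by auto
  have [measurable]: "\<Omega> \<in> sets borel" using \<Omega> by auto
  have A: "(\<integral>\<^sup>+x. ennreal (norm (grad \<phi> x) powr p) \<partial>lborel) = ennreal A" "0 \<le> A"
    unfolding A_def using test_functions_integrable[OF \<phi>, of p] p
    by (auto intro!: nn_integral_eq_integral integral_nonneg_AE)
  have i: "(\<integral>\<^sup>+x. ennreal \<bar>\<phi> x\<bar> \<partial>lborel) = ennreal i" "0 \<le> i"
    unfolding i_def using test_functions_integrable[OF \<phi>, of p] p
    by (auto intro!: nn_integral_eq_integral integral_nonneg_AE)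
  obtain M where "\<And>x. M < norm x \<Longrightarrow> \<phi> x = 0 \<and> grad \<phi> x = 0"
    by (rule test_functions_support_bounded[OF \<phi>]) blast
  then obtain C where C: "\<And>x. \<bar>\<phi> x\<bar> \<le> C"
    using compact_support_bounded[OF test_functionsD(2)[OF \<phi>], of M] by (metis real_norm_def)
  have "ennreal (real DIM('a) * i) = ennreal (real DIM('a)) * (\<integral>\<^sup>+x. ennreal \<bar>\<phi> x\<bar> \<partial>lborel)"
    using i by (simp add: ennreal_mult)
  also have "\<dots> \<le> (\<integral>\<^sup>+x. ennreal (level_radius \<phi> \<bar>\<phi> x\<bar> * norm (grad \<phi> x)) \<partial>lborel)"
    by (rule integral_level_radius_grad[OF \<phi>])
  \<comment> \<open>The gradient vanishes outside \<Omega>; inserting the indicator makes the moment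
    of the level radius finite.\<close>
  also have "\<dots> = (\<integral>\<^sup>+x. ennreal (norm (grad \<phi> x) * (indicator \<Omega> x * level_radius \<phi> \<bar>\<phi> x\<bar>)) \<partial>lborel)"
    using test_functions_outside_domain(2)[OF \<phi>]
    by (intro nn_integral_cong arg_cong[where f=ennreal]) (auto simp: indicator_def)
  also have "\<dots> \<le> ennreal (A powr (1 / p) * ?J powr (1 / ?q))"
  proof (rule holder_nn_integral[OF p q(1,2)])
    have "(\<integral>\<^sup>+x. ennreal ((indicator \<Omega> x * level_radius \<phi> \<bar>\<phi> x\<bar>) powr ?q) \<partial>lborel)
        = (\<integral>\<^sup>+x. ennreal (indicator \<Omega> x * level_radius \<phi> \<bar>\<phi> x\<bar> powr ?q) \<partial>lborel)"
      by (intro nn_integral_cong) (auto simp: indicator_def)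
    also have "\<dots> \<le> ennreal ?J"
      by (rule level_radius_moment[OF _ \<Omega> _ C q(3) \<rho>]) (auto simp: test_functions_outside_domain(1)[OF \<phi>])
    finally show "(\<integral>\<^sup>+x. ennreal ((indicator \<Omega> x * level_radius \<phi> \<bar>\<phi> x\<bar>) powr ?q) \<partial>lborel) \<le> ennreal ?J" .
  qed (use A J in auto)
  finally have "real DIM('a) * i \<le> A powr (1 / p) * ?J powr (1 / ?q)" by (simp add: ennreal_le_iff)
  then have "(real DIM('a) * i) powr p \<le> (A powr (1 / p) * ?J powr (1 / ?q)) powr p"
    using i p by (intro powr_mono2) auto
  also have "\<dots> = A * ?J powr (p - 1)"
  proof -
    have "1 / ?q * p = p - 1" using p by (simp add: field_simps)
    then show ?thesis using A J p by (simp add: powr_mult powr_powr)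
  qed
  finally have "real DIM('a) powr p * i powr p \<le> A * ?J powr (p - 1)"
    using i by (simp add: powr_mult)
  moreover have "0 < real DIM('a) powr p" by simp
  ultimately show ?thesis unfolding A_def[symmetric] i_def[symmetric] by (simp add: field_simps)
qed

section \<open>Passage to the Sobolev space\<close>

abbreviation energy :: "real \<Rightarrow> 'a::euclidean_space set \<Rightarrow> ('a \<Rightarrow> 'b::euclidean_space) \<Rightarrow> real" where
  "energy p \<Omega> g \<equiv> \<integral>x. norm (g x) powr p \<partial>lebesgue_on \<Omega>"

abbreviation Lp_mass :: "real \<Rightarrow> 'a::euclidean_space set \<Rightarrow> ('a \<Rightarrow> real) \<Rightarrow> real" where
  "Lp_mass p \<Omega> u \<equiv> \<integral>x. \<bar>u x\<bar> powr p \<partial>lebesgue_on \<Omega>"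

abbreviation L1_mass :: "'a::euclidean_space set \<Rightarrow> ('a \<Rightarrow> real) \<Rightarrow> real" where
  "L1_mass \<Omega> u \<equiv> \<integral>x. \<bar>u x\<bar> \<partial>lebesgue_on \<Omega>"

abbreviation torsion_quotients :: "real \<Rightarrow> 'a::euclidean_space set \<Rightarrow> real set" where
  "torsion_quotients p \<Omega> \<equiv>
     {L1_mass \<Omega> u powr p * inverse (energy p \<Omega> g) | u g. (u, g) \<in> W0 p \<Omega> \<and> nonzero_on \<Omega> u}"

abbreviation rayleigh_quotients :: "real \<Rightarrow> 'a::euclidean_space set \<Rightarrow> real set" where
  "rayleigh_quotients p \<Omega> \<equiv>
     {energy p \<Omega> g * inverse (Lp_mass p \<Omega> u) | u g. (u, g) \<in> W0 p \<Omega> \<and> nonzero_on \<Omega> u}"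

text \<open>With \<open>(1 + \<eta>) powr p = 1 + \<epsilon>\<close>, either
  \<open>b \<le> \<eta> * a\<close> and the first term alone suffices, or \<open>a\<close> is at
  most \<open>b / \<eta>\<close> and the second does.\<close>

lemma powr_add_le_eps:
  fixes p \<epsilon> :: real
  assumes "1 \<le> p" "0 < \<epsilon>"
  obtains C where "0 \<le> C"
    "\<And>a b. 0 \<le> a \<Longrightarrow> 0 \<le> b \<Longrightarrow> (a + b) powr p \<le> (1 + \<epsilon>) * a powr p + C * b powr p"
proof -
  define \<eta> where "\<eta> = (1 + \<epsilon>) powr (1 / p) - 1"
  have "1 powr (1 / p) < (1 + \<epsilon>) powr (1 / p)" using assms by (intro powr_less_mono2) auto
  then have \<eta>: "0 < \<eta>" by (simp add: \<eta>_def)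
  have p1: "(1 + \<eta>) powr p = 1 + \<epsilon>" using assms by (simp add: \<eta>_def powr_powr)
  show ?thesis
  proof (rule that[of "(1 + 1 / \<eta>) powr p"])
    fix a b :: real assume ab: "0 \<le> a" "0 \<le> b"
    show "(a + b) powr p \<le> (1 + \<epsilon>) * a powr p + (1 + 1 / \<eta>) powr p * b powr p"
    proof (cases "b \<le> \<eta> * a")
      case True
      have "(a + b) powr p \<le> ((1 + \<eta>) * a) powr p"
        using True ab assms by (intro powr_mono2) (auto simp: algebra_simps)
      also have "\<dots> = (1 + \<epsilon>) * a powr p" using ab \<eta> p1 by (simp add: powr_mult)
      also have "\<dots> \<le> (1 + \<epsilon>) * a powr p + (1 + 1 / \<eta>) powr p * b powr p" by simp
      finally show ?thesis .
    next
      case False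
      have "(a + b) powr p \<le> ((1 + 1 / \<eta>) * b) powr p"
        using False ab assms \<eta> by (intro powr_mono2) (auto simp: field_simps)
      also have "\<dots> = (1 + 1 / \<eta>) powr p * b powr p" using ab \<eta> by (simp add: powr_mult)
      also have "\<dots> \<le> (1 + \<epsilon>) * a powr p + (1 + 1 / \<eta>) powr p * b powr p" using assms by simp
      finally show ?thesis .
    qed
  qed simp
qed

lemma tendsto_of_eps_bounds:
  fixes a \<delta> :: "nat \<Rightarrow> real"
  assumes "0 \<le> l" and \<delta>: "\<delta> \<longlonglongrightarrow> 0"
    and bd: "\<And>\<epsilon>. 0 < \<epsilon> \<Longrightarrow> \<exists>C. \<forall>\<^sub>F n in sequentially. a n \<le> (1 + \<epsilon>) * l + C * \<delta> n \<and> l \<le> (1 + \<epsilon>) * a n + C * \<delta> n"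
  shows "a \<longlonglongrightarrow> l"
proof (rule tendstoI)
  fix e :: real assume e: "0 < e"
  \<comment> \<open>Chosen so that \<open>\<epsilon> * (l + e) = e / 4\<close>: the relative error
    costs a quarter of \<open>e\<close> both for \<open>l\<close> and for any \<open>a n\<close>
    below \<open>l + e\<close>.\<close>
  define \<epsilon> where "\<epsilon> = e / (4 * (l + e))"
  have le: "0 < l + e" using e \<open>0 \<le> l\<close> by simp
  have "e / (4 * k) * k = e / 4" if "0 < k" for k :: real using that by simp
  from this[OF le] have \<epsilon>: "0 < \<epsilon>" "\<epsilon> * (l + e) = e / 4" using e le by (simp_all only: \<epsilon>_def) simp
  obtain C where C: "\<forall>\<^sub>F n in sequentially. a n \<le> (1 + \<epsilon>) * l + C * \<delta> n \<and> l \<le> (1 + \<epsilon>) * a n + C * \<delta> n"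
    using bd[OF \<epsilon>(1)] by blast
  have "(\<lambda>n. C * \<delta> n) \<longlonglongrightarrow> C * 0" by (intro tendsto_intros \<delta>)
  then have "\<forall>\<^sub>F n in sequentially. C * \<delta> n < e / 4" using e by (intro order_tendstoD(2)) auto
  then show "\<forall>\<^sub>F n in sequentially. dist (a n) l < e" using C
  proof eventually_elim
    case (elim n)
    have "\<epsilon> * l \<le> e / 4" using \<epsilon> mult_left_mono[of l "l + e" \<epsilon>] e by linarith
    then have up: "a n < l + e" using elim e by (simp add: algebra_simps)
    have "\<epsilon> * a n \<le> \<epsilon> * (l + e)" using up \<epsilon> by (intro mult_left_mono) auto
    then have "l - a n < e" using elim e \<epsilon> by (simp add: algebra_simps)
    then show ?case using up by (simp add: dist_real_def abs_less_iff)
  qed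
qed

text \<open>The integrals of the \<open>p\<close>-th powers are compared directly, by integrating
  \<open>powr_add_le_eps\<close> for \<open>h = k + (h - k)\<close> in both directions; the constant
  depends on \<epsilon> but multiplies a quantity tending to 0.\<close>

lemma Lp_tendsto_integral:
  fixes f :: "nat \<Rightarrow> 'a::euclidean_space \<Rightarrow> 'b::euclidean_space"
  assumes p: "1 \<le> p" and f: "\<And>n. f n \<in> Lp_on p \<Omega>" and g: "g \<in> Lp_on p \<Omega>" and lim: "Lp_tendsto p \<Omega> f g"
  shows "(\<lambda>n. \<integral>x. norm (f n x) powr p \<partial>lebesgue_on \<Omega>) \<longlonglongrightarrow> (energy p \<Omega> g)"
proof -
  let ?M = "lebesgue_on \<Omega>"
  have [measurable]: "f n \<in> borel_measurable ?M" "g \<in> borel_measurable ?M" for n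
    using f g by (auto simp: Lp_on_def)
  define N where "N h = (\<integral>x. norm (h x) powr p \<partial>?M)" for h :: "'a \<Rightarrow> 'b"
  have N: "(\<integral>\<^sup>+x. ennreal (norm (h x) powr p) \<partial>?M) = ennreal (N h)" "0 \<le> N h" if "h \<in> Lp_on p \<Omega>" for h
    using that unfolding N_def Lp_on_def by (auto intro!: nn_integral_eq_integral integral_nonneg_AE)
  define D where "D n = (\<integral>\<^sup>+x. ennreal (norm (f n x - g x) powr p) \<partial>?M)" for n
  have D: "D \<longlonglongrightarrow> 0" using lim unfolding Lp_tendsto_def D_def[symmetric] .
  have bound: "ennreal (N h) \<le> ennreal ((1 + \<epsilon>) * N k) + ennreal C * (\<integral>\<^sup>+x. ennreal (norm (h x - k x) powr p) \<partial>?M)"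
    if h: "h \<in> Lp_on p \<Omega>" and k: "k \<in> Lp_on p \<Omega>" and \<epsilon>: "0 < \<epsilon>" and C: "0 \<le> C"
      "\<And>a b. 0 \<le> a \<Longrightarrow> 0 \<le> b \<Longrightarrow> (a + b) powr p \<le> (1 + \<epsilon>) * a powr p + C * b powr p"
    for h k :: "'a \<Rightarrow> 'b" and \<epsilon> C
  proof -
    have [measurable]: "h \<in> borel_measurable ?M" "k \<in> borel_measurable ?M"
      using h k by (auto simp: Lp_on_def)
    have "ennreal (N h) = (\<integral>\<^sup>+x. ennreal (norm (h x) powr p) \<partial>?M)" using N[OF h] by simp
    also have "\<dots> \<le> (\<integral>\<^sup>+x. ennreal (1 + \<epsilon>) * ennreal (norm (k x) powr p) + ennreal C * ennreal (norm (h x - k x) powr p) \<partial>?M)"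
    proof (rule nn_integral_mono)
      fix x
      have "norm (h x) \<le> norm (k x) + norm (h x - k x)" using norm_triangle_ineq[of "k x" "h x - k x"] by simp
      then have "norm (h x) powr p \<le> (norm (k x) + norm (h x - k x)) powr p"
        using p by (intro powr_mono2) auto
      also have "\<dots> \<le> (1 + \<epsilon>) * norm (k x) powr p + C * norm (h x - k x) powr p" by (intro C) auto
      finally show "ennreal (norm (h x) powr p)
          \<le> ennreal (1 + \<epsilon>) * ennreal (norm (k x) powr p) + ennreal C * ennreal (norm (h x - k x) powr p)"
        using \<epsilon> C(1) by (simp add: ennreal_mult[symmetric] ennreal_plus[symmetric] ennreal_leI del: ennreal_plus)
    qed
    also have "\<dots> = ennreal (1 + \<epsilon>) * (\<integral>\<^sup>+x. ennreal (norm (k x) powr p) \<partial>?M)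
        + ennreal C * (\<integral>\<^sup>+x. ennreal (norm (h x - k x) powr p) \<partial>?M)"
      by (simp add: nn_integral_add nn_integral_cmult)
    also have "\<dots> = ennreal ((1 + \<epsilon>) * N k) + ennreal C * (\<integral>\<^sup>+x. ennreal (norm (h x - k x) powr p) \<partial>?M)"
      using N[OF k] \<epsilon> by (simp add: ennreal_mult)
    finally show ?thesis .
  qed
  have fin: "\<forall>\<^sub>F n in sequentially. D n < top" using order_tendstoD(2)[OF D, of top] by simp
  define \<delta> where "\<delta> n = enn2real (D n)" for n
  have \<delta>: "\<delta> \<longlonglongrightarrow> 0" unfolding \<delta>_def by (rule tendsto_enn2real) (use D in simp_all)
  have "(\<lambda>n. N (f n)) \<longlonglongrightarrow> N g"
  proof (rule tendsto_of_eps_bounds[OF N(2)[OF g] \<delta>])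
    fix \<epsilon> :: real assume \<epsilon>: "0 < \<epsilon>"
    obtain C where C: "0 \<le> C"
      "\<And>a b. 0 \<le> a \<Longrightarrow> 0 \<le> b \<Longrightarrow> (a + b) powr p \<le> (1 + \<epsilon>) * a powr p + C * b powr p"
      by (rule powr_add_le_eps[OF p \<epsilon>]) blast
    have "\<forall>\<^sub>F n in sequentially. N (f n) \<le> (1 + \<epsilon>) * N g + C * \<delta> n \<and> N g \<le> (1 + \<epsilon>) * N (f n) + C * \<delta> n"
      using fin
    proof eventually_elim
      case (elim n)
      have Dn: "D n = ennreal (\<delta> n)" "0 \<le> \<delta> n" using elim by (auto simp: \<delta>_def)
      have "ennreal (N (f n)) \<le> ennreal ((1 + \<epsilon>) * N g) + ennreal C * D n"
        using bound[OF f g \<epsilon> C] by (simp add: D_def)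
      moreover have "ennreal (N g) \<le> ennreal ((1 + \<epsilon>) * N (f n)) + ennreal C * D n"
        using bound[OF g f \<epsilon> C] by (simp add: D_def norm_minus_commute)
      ultimately show ?case using Dn C(1) \<epsilon> N(2)[OF g] N(2)[OF f]
        by (simp add: ennreal_mult[symmetric] ennreal_plus[symmetric] del: ennreal_plus)
    qed
    then show "\<exists>C. \<forall>\<^sub>F n in sequentially. N (f n) \<le> (1 + \<epsilon>) * N g + C * \<delta> n \<and> N g \<le> (1 + \<epsilon>) * N (f n) + C * \<delta> n"
      by blast
  qed
  then show ?thesis by (simp add: N_def)
qed

text \<open>For \<open>x > \<epsilon>\<close> the factor \<open>x powr (1 - p)\<close> is at most
  \<open>\<epsilon> powr (1 - p)\<close>. On a set of finite measure this bound passes from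
  \<open>p\<close>-th powers to first powers.\<close>

lemma le_eps_powr:
  fixes x p \<epsilon> :: real
  assumes "1 < p" "0 < \<epsilon>" "0 \<le> x"
  shows "x \<le> \<epsilon> + \<epsilon> powr (1 - p) * x powr p"
proof (cases "x \<le> \<epsilon>")
  case True
  then show ?thesis by (simp add: add_increasing2)
next
  case False
  then have "x powr (1 - p) \<le> \<epsilon> powr (1 - p)" using assms by (intro powr_mono2') auto
  then have "x powr (1 - p) * x powr p \<le> \<epsilon> powr (1 - p) * x powr p" by (intro mult_right_mono) auto
  moreover have "x powr (1 - p) * x powr p = x" using False assms by (simp add: powr_add[symmetric])
  ultimately show ?thesis using assms by linarith
qed

lemma Lp_on_imp_L1_on:
  fixes f :: "'a::euclidean_space \<Rightarrow> 'b::euclidean_space"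
  assumes p: "1 < p" and \<Omega>: "\<Omega> \<in> fmeasurable lebesgue" and f: "f \<in> Lp_on p \<Omega>"
  shows "f \<in> Lp_on 1 \<Omega>"
proof -
  have fm: "f \<in> borel_measurable (lebesgue_on \<Omega>)" and i: "integrable (lebesgue_on \<Omega>) (\<lambda>x. norm (f x) powr p)"
    using f by (auto simp: Lp_on_def)
  interpret finite_measure "lebesgue_on \<Omega>" using \<Omega> by (rule finite_measure_lebesgue_on)
  have "integrable (lebesgue_on \<Omega>) (\<lambda>x. 1 + norm (f x) powr p)" using i by simp
  then have "integrable (lebesgue_on \<Omega>) (\<lambda>x. norm (f x) powr 1)"
  proof (rule Bochner_Integration.integrable_bound)
    show "(\<lambda>x. norm (f x) powr 1) \<in> borel_measurable (lebesgue_on \<Omega>)" using fm by measurable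
    show "AE x in lebesgue_on \<Omega>. norm (norm (f x) powr 1) \<le> norm (1 + norm (f x) powr p)"
      using le_eps_powr[OF p, of 1] by (intro AE_I2) auto
  qed
  then show ?thesis using fm by (simp add: Lp_on_def)
qed

lemma Lp_tendsto_imp_L1_tendsto:
  fixes f :: "nat \<Rightarrow> 'a::euclidean_space \<Rightarrow> 'b::euclidean_space"
  assumes p: "1 < p" and \<Omega>: "\<Omega> \<in> fmeasurable lebesgue"
    and [measurable]: "\<And>n. f n \<in> borel_measurable (lebesgue_on \<Omega>)" "g \<in> borel_measurable (lebesgue_on \<Omega>)"
    and lim: "Lp_tendsto p \<Omega> f g"
  shows "Lp_tendsto 1 \<Omega> f g"
proof -
  let ?M = "lebesgue_on \<Omega>"
  define D where "D n = (\<integral>\<^sup>+x. ennreal (norm (f n x - g x) powr p) \<partial>?M)" for n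
  have D: "D \<longlonglongrightarrow> 0" using lim unfolding Lp_tendsto_def D_def[symmetric] .
  have "emeasure ?M \<Omega> = emeasure lebesgue \<Omega>" using \<Omega> by (intro emeasure_restrict_space) auto
  then have em: "emeasure ?M \<Omega> = ennreal (measure lebesgue \<Omega>)"
    using emeasure_eq_measure2[OF \<Omega>] by (rule trans)
  have "(\<lambda>n. \<integral>\<^sup>+x. ennreal (norm (f n x - g x) powr 1) \<partial>?M) \<longlonglongrightarrow> 0"
  proof (rule order_tendstoI)
    fix a :: ennreal assume "0 < a"
    then obtain z where z: "0 < z" "z < a" using dense by blast
    then obtain e where e: "z = ennreal e" "0 < e" by (cases z) auto
    \<comment> \<open>The constant part then integrates to at most \<open>e / 2\<close> over
      \<Omega>.\<close>
    define \<epsilon> where "\<epsilon> = e / (2 * (measure lebesgue \<Omega> + 1))"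
    have m1: "0 < measure lebesgue \<Omega> + 1" by (simp add: add_nonneg_pos)
    have \<epsilon>: "0 < \<epsilon>" using e m1 by (simp add: \<epsilon>_def)
    have em2: "\<epsilon> * measure lebesgue \<Omega> \<le> e / 2" using e m1 by (simp add: \<epsilon>_def field_simps)
    have "(\<lambda>n. ennreal (\<epsilon> powr (1 - p)) * D n) \<longlonglongrightarrow> ennreal (\<epsilon> powr (1 - p)) * 0"
      by (intro ennreal_tendsto_cmult D) simp
    then have "\<forall>\<^sub>F n in sequentially. ennreal (\<epsilon> powr (1 - p)) * D n < ennreal (e / 2)"
      using e by (intro order_tendstoD(2)) auto
    then show "\<forall>\<^sub>F n in sequentially. (\<integral>\<^sup>+x. ennreal (norm (f n x - g x) powr 1) \<partial>?M) < a"
    proof eventually_elim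
      case (elim n)
      have "(\<integral>\<^sup>+x. ennreal (norm (f n x - g x) powr 1) \<partial>?M)
          \<le> (\<integral>\<^sup>+x. ennreal \<epsilon> + ennreal (\<epsilon> powr (1 - p)) * ennreal (norm (f n x - g x) powr p) \<partial>?M)"
        using le_eps_powr[OF p \<epsilon>] \<epsilon> by (intro nn_integral_mono)
           (simp add: ennreal_mult[symmetric] ennreal_plus[symmetric] ennreal_leI del: ennreal_plus)
      also have "\<dots> = ennreal \<epsilon> * emeasure ?M \<Omega> + ennreal (\<epsilon> powr (1 - p)) * D n"
        by (simp add: nn_integral_add nn_integral_cmult D_def)
      also have "ennreal \<epsilon> * emeasure ?M \<Omega> \<le> ennreal (e / 2)"
        using em2 \<epsilon> by (simp add: em ennreal_mult[symmetric] ennreal_leI)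
      finally have "(\<integral>\<^sup>+x. ennreal (norm (f n x - g x) powr 1) \<partial>?M)
          \<le> ennreal (e / 2) + ennreal (\<epsilon> powr (1 - p)) * D n" by (simp add: add_right_mono)
      also have "\<dots> \<le> ennreal (e / 2) + ennreal (e / 2)" using elim by (intro add_left_mono) simp
      also have "\<dots> = z" using e by (simp add: ennreal_plus[symmetric] del: ennreal_plus)
      finally show ?case using z by simp
    qed
  qed simp
  then show ?thesis by (simp add: Lp_tendsto_def)
qed

lemma lebesgue_on_integral_lborel:
  fixes f :: "'a::euclidean_space \<Rightarrow> real"
  assumes "open \<Omega>" "f \<in> borel_measurable borel" and z: "\<And>x. x \<notin> \<Omega> \<Longrightarrow> f x = 0"
  shows "integral\<^sup>L (lebesgue_on \<Omega>) f = integral\<^sup>L lborel f"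
    and "integrable lborel f \<Longrightarrow> integrable (lebesgue_on \<Omega>) f"
proof -
  have \<Omega>: "\<Omega> \<inter> space lebesgue \<in> sets lebesgue" using assms(1) by simp
  have eq: "indicator \<Omega> x * f x = f x" for x using z by (auto simp: indicator_def)
  show "integral\<^sup>L (lebesgue_on \<Omega>) f = integral\<^sup>L lborel f"
    using integral_restrict_space[OF \<Omega>, of f] integral_completion[of f lborel] assms(2) by (simp add: eq)
  show "integrable (lebesgue_on \<Omega>) f" if "integrable lborel f"
    using integrable_restrict_space[OF \<Omega>, of f] integrable_completion[of f lborel] assms(2) that by (simp add: eq)
qed

lemma test_functions_integral_on:
  assumes \<phi>: "\<phi> \<in> test_functions \<Omega>" and "open \<Omega>" and p: "0 < p"
  shows "(Lp_mass p \<Omega> \<phi>) = (LINT x|lborel. \<bar>\<phi> x\<bar> powr p)"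
    and "(energy p \<Omega> (grad \<phi>)) = (LINT x|lborel. norm (grad \<phi> x) powr p)"
    and "(L1_mass \<Omega> \<phi>) = (LINT x|lborel. \<bar>\<phi> x\<bar>)"
    and "\<phi> \<in> Lp_on p \<Omega>" "grad \<phi> \<in> Lp_on p \<Omega>"
proof -
  have [measurable]: "\<phi> \<in> borel_measurable borel" "grad \<phi> \<in> borel_measurable borel"
    using test_functionsD[OF \<phi>] by auto
  note z = test_functions_outside_domain[OF \<phi>]
  note i = test_functions_integrable[OF \<phi> p]
  show "(Lp_mass p \<Omega> \<phi>) = (LINT x|lborel. \<bar>\<phi> x\<bar> powr p)"
    by (rule lebesgue_on_integral_lborel[OF \<open>open \<Omega>\<close>]) (measurable, simp add: z)
  show "(energy p \<Omega> (grad \<phi>)) = (LINT x|lborel. norm (grad \<phi> x) powr p)"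
    by (rule lebesgue_on_integral_lborel[OF \<open>open \<Omega>\<close>]) (measurable, simp add: z)
  show "(L1_mass \<Omega> \<phi>) = (LINT x|lborel. \<bar>\<phi> x\<bar>)"
    by (rule lebesgue_on_integral_lborel[OF \<open>open \<Omega>\<close>]) (measurable, simp add: z)
  have m: "\<phi> \<in> borel_measurable (lebesgue_on \<Omega>)" "grad \<phi> \<in> borel_measurable (lebesgue_on \<Omega>)"
    by (auto intro!: measurable_restrict_space1 measurable_completion)
  have "integrable (lebesgue_on \<Omega>) (\<lambda>x. \<bar>\<phi> x\<bar> powr p)"
    by (rule lebesgue_on_integral_lborel(2)[OF \<open>open \<Omega>\<close> _ _ i(1)]) (measurable, simp add: z)
  then show "\<phi> \<in> Lp_on p \<Omega>" using m by (simp add: Lp_on_def)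
  have "integrable (lebesgue_on \<Omega>) (\<lambda>x. norm (grad \<phi> x) powr p)"
    by (rule lebesgue_on_integral_lborel(2)[OF \<open>open \<Omega>\<close> _ _ i(2)]) (measurable, simp add: z)
  then show "grad \<phi> \<in> Lp_on p \<Omega>" using m by (simp add: Lp_on_def)
qed

lemma test_functions_W0:
  assumes "\<phi> \<in> test_functions \<Omega>" "open \<Omega>" "0 < p"
  shows "(\<phi>, grad \<phi>) \<in> W0 p \<Omega>" using test_functions_integral_on(4,5)[OF assms] assms(1) \<open>0 < p\<close>
  unfolding W0_def by (auto simp: Lp_tendsto_def intro!: exI[of _ "\<lambda>n. \<phi>"])

text \<open>One sequence for all three integrals, so that inequalities between them pass from test
  functions to pairs in \<open>W0\<close>. Convergence of the first one uses that \<Omega> has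
  finite measure.\<close>

lemma W0_approx:
  fixes u :: "'a::euclidean_space \<Rightarrow> real"
  assumes ug: "(u, g) \<in> W0 p \<Omega>" and p: "1 < p" and \<Omega>: "open \<Omega>" "\<Omega> \<in> fmeasurable lebesgue"
  obtains \<phi> where "\<And>n. \<phi> n \<in> test_functions \<Omega>"
    "(\<lambda>n. LINT x|lborel. \<bar>\<phi> n x\<bar>) \<longlonglongrightarrow> (L1_mass \<Omega> u)"
    "(\<lambda>n. LINT x|lborel. \<bar>\<phi> n x\<bar> powr p) \<longlonglongrightarrow> (Lp_mass p \<Omega> u)"
    "(\<lambda>n. LINT x|lborel. norm (grad (\<phi> n) x) powr p) \<longlonglongrightarrow> (energy p \<Omega> g)"
proof -
  obtain \<phi> where u: "u \<in> Lp_on p \<Omega>" and g: "g \<in> Lp_on p \<Omega>" and \<phi>: "\<And>n. \<phi> n \<in> test_functions \<Omega>"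
    and l: "Lp_tendsto p \<Omega> \<phi> u" "Lp_tendsto p \<Omega> (\<lambda>n. grad (\<phi> n)) g" using ug by (auto simp: W0_def)
  have p': "1 \<le> p" "0 < p" using p by auto
  note T = test_functions_integral_on[OF \<phi> \<Omega>(1) p'(2)]
  have m: "\<phi> n \<in> borel_measurable (lebesgue_on \<Omega>)" "u \<in> borel_measurable (lebesgue_on \<Omega>)" for n
    using T(4)[of n] u by (auto simp: Lp_on_def)
  have l1: "Lp_tendsto 1 \<Omega> \<phi> u" by (rule Lp_tendsto_imp_L1_tendsto[OF p \<Omega>(2) m l(1)])
  show ?thesis
  proof (rule that[OF \<phi>])
    show "(\<lambda>n. LINT x|lborel. \<bar>\<phi> n x\<bar> powr p) \<longlonglongrightarrow> (Lp_mass p \<Omega> u)"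
      using Lp_tendsto_integral[OF p'(1) T(4) u l(1)] T(1) by simp
    show "(\<lambda>n. LINT x|lborel. norm (grad (\<phi> n) x) powr p) \<longlonglongrightarrow> (energy p \<Omega> g)"
      using Lp_tendsto_integral[OF p'(1) T(5) g l(2)] T(2) by simp
    show "(\<lambda>n. LINT x|lborel. \<bar>\<phi> n x\<bar>) \<longlonglongrightarrow> (L1_mass \<Omega> u)"
      using Lp_tendsto_integral[OF order_refl Lp_on_imp_L1_on[OF p \<Omega>(2) T(4)] Lp_on_imp_L1_on[OF p \<Omega>(2) u] l1]
        T(3) by simp
  qed
qed

lemma W0_saint_venant:
  fixes u :: "'a::euclidean_space \<Rightarrow> real"
  assumes ug: "(u, g) \<in> W0 p \<Omega>" and p: "1 < p" and \<Omega>: "open \<Omega>" "\<Omega> \<in> fmeasurable lebesgue"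
    and \<rho>: "0 \<le> \<rho>" "measure lebesgue \<Omega> = unit_ball_vol (real DIM('a)) * \<rho> ^ DIM('a)"
  shows "(L1_mass \<Omega> u) powr p
      \<le> ball_moment TYPE('a) (p / (p - 1)) \<rho> powr (p - 1) / real DIM('a) powr p
          * (energy p \<Omega> g)"
proof -
  obtain \<phi> where \<phi>: "\<And>n. \<phi> n \<in> test_functions \<Omega>"
    and l: "(\<lambda>n. LINT x|lborel. \<bar>\<phi> n x\<bar>) \<longlonglongrightarrow> (L1_mass \<Omega> u)"
    "(\<lambda>n. LINT x|lborel. norm (grad (\<phi> n) x) powr p) \<longlonglongrightarrow> (energy p \<Omega> g)"
    by (rule W0_approx[OF ug p \<Omega>]) blast
  have b: "\<Omega> \<in> fmeasurable lborel" "vol \<Omega> = measure lebesgue \<Omega>"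
    using \<Omega> by (auto simp: fmeasurable_def)
  show ?thesis
  proof (rule tendsto_le[OF sequentially_bot])
    show "(\<lambda>n. ball_moment TYPE('a) (p / (p - 1)) \<rho> powr (p - 1) / real DIM('a) powr p
          * (LINT x|lborel. norm (grad (\<phi> n) x) powr p)) \<longlonglongrightarrow>
        ball_moment TYPE('a) (p / (p - 1)) \<rho> powr (p - 1) / real DIM('a) powr p
          * (energy p \<Omega> g)" by (intro tendsto_mult tendsto_const l)
    show "(\<lambda>n. (LINT x|lborel. \<bar>\<phi> n x\<bar>) powr p) \<longlonglongrightarrow> (L1_mass \<Omega> u) powr p"
      using p by (intro tendsto_powr2 l tendsto_const) (auto intro!: always_eventually integral_nonneg_AE)
    show "\<forall>\<^sub>F n in sequentially. (LINT x|lborel. \<bar>\<phi> n x\<bar>) powr p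
        \<le> ball_moment TYPE('a) (p / (p - 1)) \<rho> powr (p - 1) / real DIM('a) powr p
          * (LINT x|lborel. norm (grad (\<phi> n) x) powr p)"
      using saint_venant_test_functions[OF \<phi> b(1) p \<rho>(1)] \<rho>(2) b(2) by (intro always_eventually) simp
  qed
qed

section \<open>The Poincare inequality along one direction, and Hoelder's inequality on the
  domain\<close>

lemma nn_integral_translate:
  fixes f :: "'a::euclidean_space \<Rightarrow> ennreal"
  assumes [measurable]: "f \<in> borel_measurable borel"
  shows "(\<integral>\<^sup>+x. f (x + c) \<partial>lborel) = (\<integral>\<^sup>+x. f x \<partial>lborel)"
proof -
  have "(\<integral>\<^sup>+x. f x \<partial>lborel) = (\<integral>\<^sup>+x. f x \<partial>distr lborel borel ((+) c))"
    by (simp add: lborel_distr_plus)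
  also have "\<dots> = (\<integral>\<^sup>+x. f (x + c) \<partial>lborel)" by (subst nn_integral_distr) (auto simp: add.commute)
  finally show ?thesis by simp
qed

text \<open>The endpoint \<open>x + L *\<^sub>R e\<close> is outside \<Omega>, so
  \<open>\<phi> x\<close> is, up to sign, the integral of the directional derivative over the
  segment; Hoelder gives the rest. What the segment does in between is irrelevant, as \<phi> is
  smooth on the whole space.\<close>

lemma poincare_pointwise:
  fixes \<phi> :: "'a::euclidean_space \<Rightarrow> real"
  assumes \<phi>: "\<phi> \<in> test_functions \<Omega>" and p: "1 < p" and L: "0 < L" and e: "norm e = 1"
    and gap: "x \<in> \<Omega> \<Longrightarrow> x + L *\<^sub>R e \<notin> \<Omega>"
  shows "ennreal (\<bar>\<phi> x\<bar> powr p)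
    \<le> ennreal (L powr (p - 1)) * (\<integral>\<^sup>+s. indicator {0..L} s * ennreal (norm (grad \<phi> (x + s *\<^sub>R e)) powr p) \<partial>lborel)"
proof (cases "x \<in> \<Omega>")
  case False
  then show ?thesis using test_functions_outside_domain(1)[OF \<phi>] p by simp
next
  case True
  let ?G = "\<lambda>s. grad \<phi> (x + s *\<^sub>R e)" and ?q = "p / (p - 1)"
  have q: "1 < ?q" "1 / p + 1 / ?q = 1" using p by (auto simp: field_simps)
  have cG: "continuous_on UNIV ?G"
    by (intro continuous_on_compose2[OF test_functionsD(3)[OF \<phi>]] continuous_intros) auto
  then have [measurable]: "?G \<in> borel_measurable borel" by (rule borel_measurable_continuous_onI)
  define A where "A = (LINT s|lborel. indicator {0..L} s * norm (?G s) powr p)"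
  have cp: "continuous_on {0..L} (\<lambda>s. norm (?G s) powr p)"
    using p cG by (intro continuous_on_powr' continuous_intros) (auto intro: continuous_on_subset)
  have "integrable lborel (\<lambda>s. indicator {0..L} s *\<^sub>R (norm (?G s) powr p))"
    by (rule borel_integrable_compact[OF _ cp]) simp
  then have A: "(\<integral>\<^sup>+s. ennreal (indicator {0..L} s * norm (?G s) powr p) \<partial>lborel) = ennreal A" "0 \<le> A"
    unfolding A_def by (auto intro!: nn_integral_eq_integral integral_nonneg_AE)
  have der: "((\<lambda>s. \<phi> (x + s *\<^sub>R e)) has_vector_derivative (?G s \<bullet> e)) (at s within {0..L})" for s
  proof -
    have "((\<lambda>s. x + s *\<^sub>R e) has_derivative (\<lambda>h. h *\<^sub>R e)) (at s)" by (auto intro!: derivative_eq_intros)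
    from has_derivative_compose[OF this test_functionsD(4)[OF \<phi>]]
    have "((\<lambda>s. \<phi> (x + s *\<^sub>R e)) has_derivative (\<lambda>h. h *\<^sub>R (?G s \<bullet> e))) (at s)" by simp
    then show ?thesis unfolding has_vector_derivative_def by (rule has_derivative_at_withinI)
  qed
  have c1: "continuous_on {0..L} (\<lambda>s. ?G s \<bullet> e)"
    using cG by (intro continuous_intros) (auto intro: continuous_on_subset)
  have c2: "continuous_on {0..L} (\<lambda>s. norm (?G s))"
    using cG by (intro continuous_intros) (auto intro: continuous_on_subset)
  have i1: "integrable lborel (\<lambda>s. indicator {0..L} s *\<^sub>R (?G s \<bullet> e))"
    and i2: "integrable lborel (\<lambda>s. indicator {0..L} s *\<^sub>R norm (?G s))"
    by (auto intro!: borel_integrable_compact c1 c2 simp del: real_scaleR_def)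
  have "\<phi> (x + L *\<^sub>R e) - \<phi> (x + 0 *\<^sub>R e) = (LINT s|lborel. indicator {0..L} s *\<^sub>R (?G s \<bullet> e))"
    using L by (intro integral_FTC_Icc[symmetric] der c1) auto
  then have "\<bar>\<phi> x\<bar> = \<bar>LINT s|lborel. indicator {0..L} s *\<^sub>R (?G s \<bullet> e)\<bar>"
    using gap[OF True] test_functions_outside_domain(1)[OF \<phi>] by simp
  also have "\<dots> \<le> (LINT s|lborel. \<bar>indicator {0..L} s *\<^sub>R (?G s \<bullet> e)\<bar>)" by (rule integral_abs_bound)
  also have "\<dots> \<le> (LINT s|lborel. indicator {0..L} s *\<^sub>R norm (?G s))"
  proof (rule integral_mono)
    show "\<bar>indicator {0..L} s *\<^sub>R (?G s \<bullet> e)\<bar> \<le> indicator {0..L} s *\<^sub>R norm (?G s)" for s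
      using Cauchy_Schwarz_ineq2[of "?G s" e] e by (auto simp: indicator_def)
  qed (use i1 i2 in \<open>auto intro: integrable_abs\<close>)
  finally have "ennreal \<bar>\<phi> x\<bar> \<le> ennreal (LINT s|lborel. indicator {0..L} s *\<^sub>R norm (?G s))"
    by (rule ennreal_leI)
  also have "\<dots> = (\<integral>\<^sup>+s. ennreal (indicator {0..L} s *\<^sub>R norm (?G s)) \<partial>lborel)"
    using i2 by (intro nn_integral_eq_integral[symmetric]) auto
  also have "\<dots> = (\<integral>\<^sup>+s. ennreal ((indicator {0..L} s * norm (?G s)) * indicator {0..L} s) \<partial>lborel)"
    by (intro nn_integral_cong) (auto simp: indicator_def)
  also have "\<dots> \<le> ennreal (A powr (1 / p) * L powr (1 / ?q))"
  proof (rule holder_nn_integral[OF p q])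
    have "(\<integral>\<^sup>+s. ennreal ((indicator {0..L} s * norm (?G s)) powr p) \<partial>lborel)
        = (\<integral>\<^sup>+s. ennreal (indicator {0..L} s * norm (?G s) powr p) \<partial>lborel)"
      using p by (intro nn_integral_cong) (auto simp: indicator_def)
    then show "(\<integral>\<^sup>+s. ennreal ((indicator {0..L} s * norm (?G s)) powr p) \<partial>lborel) \<le> ennreal A"
      using A by simp
    have "(\<integral>\<^sup>+s. ennreal (indicator {0..L} s powr ?q) \<partial>lborel) = (\<integral>\<^sup>+s. indicator {0..L} s \<partial>(lborel::real measure))"
      using p by (intro nn_integral_cong) (auto simp: indicator_def)
    then show "(\<integral>\<^sup>+s. ennreal (indicator {0..L} s powr ?q) \<partial>lborel) \<le> ennreal L" using L by simp
  qed (use A L in auto)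
  finally have "\<bar>\<phi> x\<bar> \<le> A powr (1 / p) * L powr (1 / ?q)" by (simp add: ennreal_le_iff)
  then have "\<bar>\<phi> x\<bar> powr p \<le> (A powr (1 / p) * L powr (1 / ?q)) powr p"
    using p by (intro powr_mono2) auto
  also have "\<dots> = L powr (p - 1) * A"
  proof -
    have "1 / ?q * p = p - 1" using p by (simp add: field_simps)
    then show ?thesis using A L p by (simp add: powr_mult powr_powr)
  qed
  finally have "ennreal (\<bar>\<phi> x\<bar> powr p) \<le> ennreal (L powr (p - 1)) * ennreal A"
    using A(2) by (simp add: ennreal_mult[symmetric] ennreal_leI)
  also have "ennreal A = (\<integral>\<^sup>+s. indicator {0..L} s * ennreal (norm (?G s) powr p) \<partial>lborel)"
    unfolding A(1)[symmetric] by (intro nn_integral_cong) (auto simp: indicator_def)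
  finally show ?thesis .
qed

text \<open>Integrating the pointwise bound and exchanging the integrals leaves, for each
  \<open>s\<close> in \<open>{0..L}\<close>, a translate of the energy density; translation
  invariance supplies the last factor \<open>L\<close>.\<close>

lemma poincare_test_functions:
  fixes \<phi> :: "'a::euclidean_space \<Rightarrow> real"
  assumes \<phi>: "\<phi> \<in> test_functions \<Omega>" and p: "1 < p" and L: "0 < L" and e: "norm e = 1"
    and gap: "\<And>x. x \<in> \<Omega> \<Longrightarrow> x + L *\<^sub>R e \<notin> \<Omega>"
  shows "(LINT x|lborel. \<bar>\<phi> x\<bar> powr p) \<le> L powr p * (LINT x|lborel. norm (grad \<phi> x) powr p)"
proof -
  have [measurable]: "\<phi> \<in> borel_measurable borel" "grad \<phi> \<in> borel_measurable borel"
    using test_functionsD[OF \<phi>] by auto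
  have p0: "0 < p" using p by simp
  note i = test_functions_integrable[OF \<phi> p0]
  have nn: "0 \<le> (LINT x|lborel. norm (grad \<phi> x) powr p)" by (intro integral_nonneg_AE) simp
  have "ennreal (LINT x|lborel. \<bar>\<phi> x\<bar> powr p) = (\<integral>\<^sup>+x. ennreal (\<bar>\<phi> x\<bar> powr p) \<partial>lborel)"
    using i by (intro nn_integral_eq_integral[symmetric]) auto
  also have "\<dots> \<le> (\<integral>\<^sup>+x. ennreal (L powr (p - 1)) *
      (\<integral>\<^sup>+s. indicator {0..L} s * ennreal (norm (grad \<phi> (x + s *\<^sub>R e)) powr p) \<partial>lborel) \<partial>lborel)"
    by (intro nn_integral_mono poincare_pointwise[OF \<phi> p L e gap])
  also have "\<dots> = ennreal (L powr (p - 1)) *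
      (\<integral>\<^sup>+x. (\<integral>\<^sup>+s. indicator {0..L} s * ennreal (norm (grad \<phi> (x + s *\<^sub>R e)) powr p) \<partial>lborel) \<partial>lborel)"
    by (rule nn_integral_cmult) measurable
  also have "(\<integral>\<^sup>+x. (\<integral>\<^sup>+s. indicator {0..L} s * ennreal (norm (grad \<phi> (x + s *\<^sub>R e)) powr p) \<partial>lborel) \<partial>lborel)
      = (\<integral>\<^sup>+s. (\<integral>\<^sup>+x. indicator {0..L} s * ennreal (norm (grad \<phi> (x + s *\<^sub>R e)) powr p) \<partial>lborel) \<partial>lborel)"
    by (rule lborel_pair.Fubini'[symmetric]) measurable
  also have "\<dots> = (\<integral>\<^sup>+s. indicator {0..L} s * (\<integral>\<^sup>+x. ennreal (norm (grad \<phi> x) powr p) \<partial>lborel) \<partial>lborel)"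
  proof (rule nn_integral_cong)
    fix s :: real
    have "(\<integral>\<^sup>+x. indicator {0..L} s * ennreal (norm (grad \<phi> (x + s *\<^sub>R e)) powr p) \<partial>lborel)
        = indicator {0..L} s * (\<integral>\<^sup>+x. ennreal (norm (grad \<phi> (x + s *\<^sub>R e)) powr p) \<partial>lborel)"
      by (rule nn_integral_cmult) measurable
    also have "(\<integral>\<^sup>+x. ennreal (norm (grad \<phi> (x + s *\<^sub>R e)) powr p) \<partial>lborel)
        = (\<integral>\<^sup>+x. ennreal (norm (grad \<phi> x) powr p) \<partial>lborel)"
      by (rule nn_integral_translate[of "\<lambda>x. ennreal (norm (grad \<phi> x) powr p)"]) measurable
    finally show "(\<integral>\<^sup>+x. indicator {0..L} s * ennreal (norm (grad \<phi> (x + s *\<^sub>R e)) powr p) \<partial>lborel)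
        = indicator {0..L} s * (\<integral>\<^sup>+x. ennreal (norm (grad \<phi> x) powr p) \<partial>lborel)" .
  qed
  also have "\<dots> = ennreal L * (\<integral>\<^sup>+x. ennreal (norm (grad \<phi> x) powr p) \<partial>lborel)"
    using L by (subst nn_integral_multc) auto
  also have "(\<integral>\<^sup>+x. ennreal (norm (grad \<phi> x) powr p) \<partial>lborel) = ennreal (LINT x|lborel. norm (grad \<phi> x) powr p)"
    using i by (intro nn_integral_eq_integral) auto
  finally have "(LINT x|lborel. \<bar>\<phi> x\<bar> powr p)
      \<le> L powr (p - 1) * (L * (LINT x|lborel. norm (grad \<phi> x) powr p))"
    using L nn by (simp add: ennreal_mult[symmetric] ennreal_le_iff)
  also have "\<dots> = L powr p * (LINT x|lborel. norm (grad \<phi> x) powr p)"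
    using L powr_add[of L "p - 1" 1] by simp
  finally show ?thesis .
qed

lemma W0_poincare:
  fixes u :: "'a::euclidean_space \<Rightarrow> real"
  assumes ug: "(u, g) \<in> W0 p \<Omega>" and p: "1 < p" and \<Omega>: "open \<Omega>" "\<Omega> \<in> fmeasurable lebesgue"
    and L: "0 < L" and e: "norm e = 1" and gap: "\<And>x. x \<in> \<Omega> \<Longrightarrow> x + L *\<^sub>R e \<notin> \<Omega>"
  shows "(Lp_mass p \<Omega> u) \<le> L powr p * (energy p \<Omega> g)"
proof -
  obtain \<phi> where \<phi>: "\<And>n. \<phi> n \<in> test_functions \<Omega>"
    and l: "(\<lambda>n. LINT x|lborel. \<bar>\<phi> n x\<bar> powr p) \<longlonglongrightarrow> (Lp_mass p \<Omega> u)"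
    "(\<lambda>n. LINT x|lborel. norm (grad (\<phi> n) x) powr p) \<longlonglongrightarrow> (energy p \<Omega> g)"
    by (rule W0_approx[OF ug p \<Omega>]) blast
  show ?thesis by (rule LIMSEQ_le[OF l(1) tendsto_mult[OF tendsto_const l(2)]])
       (use poincare_test_functions[OF \<phi> p L e gap] in blast)
qed

lemma W0_holder:
  fixes u :: "'a::euclidean_space \<Rightarrow> real"
  assumes ug: "(u, g) \<in> W0 p \<Omega>" and p: "1 < p" and \<Omega>: "open \<Omega>" "\<Omega> \<in> fmeasurable lebesgue"
  shows "(L1_mass \<Omega> u) powr p
      \<le> measure lebesgue \<Omega> powr (p - 1) * (Lp_mass p \<Omega> u)"
proof -
  let ?M = "lebesgue_on \<Omega>" and ?q = "p / (p - 1)"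
  have q: "1 < ?q" "1 / p + 1 / ?q = 1" using p by (auto simp: field_simps)
  have u: "u \<in> Lp_on p \<Omega>" using ug by (simp add: W0_def)
  have u1: "u \<in> Lp_on 1 \<Omega>" by (rule Lp_on_imp_L1_on[OF p \<Omega>(2) u])
  have [measurable]: "u \<in> borel_measurable ?M" using u by (simp add: Lp_on_def)
  define A where "A = (\<integral>x. \<bar>u x\<bar> powr p \<partial>?M)"
  have A: "(\<integral>\<^sup>+x. ennreal (\<bar>u x\<bar> powr p) \<partial>?M) = ennreal A" "0 \<le> A"
    using u unfolding A_def Lp_on_def by (auto intro!: nn_integral_eq_integral integral_nonneg_AE)
  have "emeasure ?M \<Omega> = emeasure lebesgue \<Omega>" using \<Omega> by (intro emeasure_restrict_space) auto
  then have em: "emeasure ?M \<Omega> = ennreal (measure lebesgue \<Omega>)"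
    using emeasure_eq_measure2[OF \<Omega>(2)] by (rule trans)
  have "ennreal (\<integral>x. \<bar>u x\<bar> \<partial>?M) = (\<integral>\<^sup>+x. ennreal (\<bar>u x\<bar> * 1) \<partial>?M)"
    using u1 unfolding Lp_on_def by (auto intro!: nn_integral_eq_integral[symmetric])
  also have "\<dots> \<le> ennreal (A powr (1 / p) * measure lebesgue \<Omega> powr (1 / ?q))"
  proof (rule holder_nn_integral[OF p q])
    have "(\<integral>\<^sup>+x. ennreal (1 powr ?q) \<partial>?M) = emeasure ?M (space ?M)"
      using nn_integral_const[of ?M 1] by (simp only: powr_one_eq_one ennreal_1 mult_1)
    then have "(\<integral>\<^sup>+x. ennreal (1 powr ?q) \<partial>?M) = emeasure ?M \<Omega>" by (simp only: space_lebesgue_on)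
    then show "(\<integral>\<^sup>+x. ennreal (1 powr ?q) \<partial>?M) \<le> ennreal (measure lebesgue \<Omega>)"
      unfolding em by (rule eq_refl)
  qed (use A in auto)
  finally have "(\<integral>x. \<bar>u x\<bar> \<partial>?M) \<le> A powr (1 / p) * measure lebesgue \<Omega> powr (1 / ?q)"
    by (simp add: ennreal_le_iff)
  then have "(\<integral>x. \<bar>u x\<bar> \<partial>?M) powr p \<le> (A powr (1 / p) * measure lebesgue \<Omega> powr (1 / ?q)) powr p"
    using p by (intro powr_mono2) (auto intro!: integral_nonneg_AE)
  also have "\<dots> = measure lebesgue \<Omega> powr (p - 1) * A"
  proof -
    have "1 / ?q * p = p - 1" using p by (simp add: field_simps)
    then show ?thesis using A p by (simp add: powr_mult powr_powr)
  qed
  finally show ?thesis by (simp add: A_def)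
qed

section \<open>Construction of test functions\<close>

lemma Ck_SucI:
  assumes d: "\<And>x. (f has_derivative f' x) (at x)" and "\<And>b. b \<in> Basis \<Longrightarrow> Ck n (\<lambda>x. f' x b)"
  shows "Ck (Suc n) f"
proof -
  have "frechet_derivative f (at x) = f' x" for x using frechet_derivative_at[OF d] by simp
  then show ?thesis using assms by (auto simp: differentiable_def)
qed

lemma Ck_SucD: "Ck (Suc n) f \<Longrightarrow> Ck n f"
proof (induction n arbitrary: f)
  case 0
  then show ?case using Ck_imp_continuous[of "Suc 0" f] by simp
next
  case (Suc n)
  then show ?case by (metis Ck.simps(2))
qed

lemma Ck_Suc_derivative:
  assumes "Ck (Suc n) f"
  obtains f' where "\<And>x. (f has_derivative f' x) (at x)" "\<And>b. b \<in> Basis \<Longrightarrow> Ck n (\<lambda>x. f' x b)"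
  using assms that[of "\<lambda>x. frechet_derivative f (at x)"] by (simp add: frechet_derivative_works[symmetric])

lemma Ck_const: "Ck n (\<lambda>x. c)"
proof (induction n arbitrary: c)
  case (Suc n)
  show ?case by (rule Ck_SucI[OF has_derivative_const]) (rule Suc)
qed simp

lemma Ck_add: "Ck n f \<Longrightarrow> Ck n g \<Longrightarrow> Ck n (\<lambda>x. f x + g x)"
proof (induction n arbitrary: f g)
  case 0
  then show ?case by (auto intro: continuous_intros)
next
  case (Suc n)
  obtain f' where f': "\<And>x. (f has_derivative f' x) (at x)" "\<And>b. b \<in> Basis \<Longrightarrow> Ck n (\<lambda>x. f' x b)"
    by (rule Ck_Suc_derivative[OF Suc.prems(1)]) blast
  obtain g' where g': "\<And>x. (g has_derivative g' x) (at x)" "\<And>b. b \<in> Basis \<Longrightarrow> Ck n (\<lambda>x. g' x b)"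
    by (rule Ck_Suc_derivative[OF Suc.prems(2)]) blast
  show ?case by (rule Ck_SucI[OF has_derivative_add[OF f'(1) g'(1)]]) (intro Suc.IH f' g')
qed

lemma Ck_mult: "Ck n f \<Longrightarrow> Ck n g \<Longrightarrow> Ck n (\<lambda>x. f x * g x)"
proof (induction n arbitrary: f g)
  case 0
  then show ?case by (auto intro: continuous_intros)
next
  case (Suc n)
  obtain f' where f': "\<And>x. (f has_derivative f' x) (at x)" "\<And>b. b \<in> Basis \<Longrightarrow> Ck n (\<lambda>x. f' x b)"
    by (rule Ck_Suc_derivative[OF Suc.prems(1)]) blast
  obtain g' where g': "\<And>x. (g has_derivative g' x) (at x)" "\<And>b. b \<in> Basis \<Longrightarrow> Ck n (\<lambda>x. g' x b)"
    by (rule Ck_Suc_derivative[OF Suc.prems(2)]) blast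
  show ?case by (rule Ck_SucI[OF has_derivative_mult[OF f'(1) g'(1)]])
       (intro Ck_add Suc.IH f' g' Ck_SucD[OF Suc.prems(1)] Ck_SucD[OF Suc.prems(2)])
qed

lemma Ck_sum: "(\<And>i. i \<in> I \<Longrightarrow> Ck n (f i)) \<Longrightarrow> Ck n (\<lambda>x. \<Sum>i\<in>I. f i x)"
proof (induction I rule: infinite_finite_induct)
  case (insert i I)
  then have "Ck n (\<lambda>x. f i x + (\<Sum>i\<in>I. f i x))" by (intro Ck_add) simp_all
  then show ?case using insert.hyps by simp
qed (simp_all add: Ck_const)

lemma Ck_translate: "Ck n f \<Longrightarrow> Ck n (\<lambda>x. f (x - a))"
proof (induction n arbitrary: f)
  case 0
  then have f: "continuous_on UNIV f" by simp
  have "continuous_on UNIV (\<lambda>x. x - a)" by (intro continuous_intros)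
  from continuous_on_compose2[OF f this subset_UNIV] show ?case by simp
next
  case (Suc n)
  obtain f' where f': "\<And>x. (f has_derivative f' x) (at x)" "\<And>b. b \<in> Basis \<Longrightarrow> Ck n (\<lambda>x. f' x b)"
    by (rule Ck_Suc_derivative[OF Suc.prems]) blast
  have "((\<lambda>x. x - a) has_derivative (\<lambda>h. h)) (at x)" for x by (auto intro!: derivative_eq_intros)
  from Ck_SucI[OF has_derivative_compose[OF this f'(1)]] Suc.IH[OF f'(2)] show ?case by blast
qed

lemma Ck_inner: "Ck n (\<lambda>x. x \<bullet> b)"
proof (cases n)
  case (Suc m)
  have "((\<lambda>x. x \<bullet> b) has_derivative (\<lambda>h. h \<bullet> b)) (at x)" for x by (auto intro!: derivative_eq_intros)
  from Ck_SucI[OF this Ck_const] show ?thesis by (simp add: Suc)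
qed (auto intro!: continuous_intros)

lemma has_derivative_inner_self: "((\<lambda>x. x \<bullet> x) has_derivative (\<lambda>h. 2 * (x \<bullet> h))) (at x)"
  by (auto intro!: derivative_eq_intros simp: inner_commute)

lemma has_derivative_shifted_norm_powr:
  assumes "0 < \<delta>"
  shows "((\<lambda>x. (x \<bullet> x + \<delta>) powr \<beta>) has_derivative (\<lambda>h. (2 * \<beta>) * (x \<bullet> x + \<delta>) powr (\<beta> - 1) * (x \<bullet> h))) (at x)"
proof -
  have "((\<lambda>x. x \<bullet> x + \<delta>) has_derivative (\<lambda>h. 2 * (x \<bullet> h))) (at x)"
    using has_derivative_add[OF has_derivative_inner_self has_derivative_const] by simp
  moreover have "((\<lambda>z. z powr \<beta>) has_real_derivative \<beta> * (x \<bullet> x + \<delta>) powr (\<beta> - 1)) (at (x \<bullet> x + \<delta>))"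
    using assms by (intro has_real_derivative_powr) (simp add: add_nonneg_pos)
  ultimately have "((\<lambda>x. (x \<bullet> x + \<delta>) powr \<beta>) has_derivative
      (\<lambda>h. 2 * (x \<bullet> h) * (\<beta> * (x \<bullet> x + \<delta>) powr (\<beta> - 1)))) (at x)"
    by (rule DERIV_compose_FDERIV[rotated])
  then show ?thesis by (simp add: algebra_simps)
qed

text \<open>The shift keeps the base positive. A partial derivative is again a function of this kind
  times a linear one, with exponent \<open>\<beta> - 1\<close>, so the induction runs over all
  \<beta> at once.\<close>

lemma Ck_shifted_norm_powr:
  assumes "0 < \<delta>" shows "Ck n (\<lambda>x. (x \<bullet> x + \<delta>) powr \<beta>)"
proof (induction n arbitrary: \<beta>)
  case 0
  have "x \<bullet> x + \<delta> \<noteq> 0" for x :: 'a using assms by (metis add_nonneg_pos inner_ge_zero less_irrefl)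
  then show ?case by (auto intro!: continuous_intros)
next
  case (Suc n)
  show ?case by (rule Ck_SucI[OF has_derivative_shifted_norm_powr[OF assms]])
       (intro Ck_mult Ck_const Ck_inner Suc)
qed

text \<open>The usual smooth function \<open>exp (- 1 / t)\<close> extended by 0, multiplied by
  powers of \<open>1 / t\<close>. The powers make the family closed under differentiation, up to
  linear combinations.\<close>

definition flat :: "nat \<Rightarrow> real \<Rightarrow> real" where
  "flat k t = (if 0 < t then inverse t ^ k * exp (- inverse t) else 0)"

lemma flat_has_derivative:
  "(flat k has_real_derivative flat (Suc (Suc k)) t - real k * flat (Suc k) t) (at t)"
proof -
  consider "t < 0" | "t = 0" | "0 < t" by linarith
  then show ?thesis
  proof cases
    case 1
    have "((\<lambda>t. 0) has_real_derivative 0) (at t)" by simp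
    then have "(flat k has_real_derivative 0) (at t)"
      by (rule has_field_derivative_transform_within_open[where S="{..<0}"]) (use 1 in \<open>auto simp: flat_def\<close>)
    then show ?thesis using 1 by (simp add: flat_def)
  next
    case 2
    \<comment> \<open>The difference quotient from the right at 0, written in
      \<open>inverse h\<close>: a power against an exponential.\<close>
    have "((\<lambda>h. inverse h ^ Suc k / exp (inverse h)) \<longlongrightarrow> 0) (at_right (0::real))"
      by (rule filterlim_compose[OF tendsto_power_div_exp_0 filterlim_inverse_at_top_right])
    moreover have "\<forall>\<^sub>F h in at_right (0::real). inverse h ^ Suc k / exp (inverse h) = (flat k (0 + h) - flat k 0) / h"
      using eventually_at_right_less[of "0::real"]
      by eventually_elim (simp add: flat_def exp_minus field_simps)
    ultimately have r: "((\<lambda>h. (flat k (0 + h) - flat k 0) / h) \<longlongrightarrow> 0) (at_right 0)"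
      by (rule Lim_transform_eventually)
    have "\<forall>\<^sub>F h in at_left (0::real). 0 = (flat k (0 + h) - flat k 0) / h"
      by (auto simp: eventually_at_left_field flat_def intro!: exI[of _ "-1"])
    then have l: "((\<lambda>h. (flat k (0 + h) - flat k 0) / h) \<longlongrightarrow> 0) (at_left 0)"
      by (rule Lim_transform_eventually[OF tendsto_const])
    have "((\<lambda>h. (flat k (0 + h) - flat k 0) / h) \<longlongrightarrow> 0) (at 0)"
      using l r by (simp add: filterlim_split_at)
    then have "(flat k has_real_derivative 0) (at 0)" unfolding DERIV_def .
    then show ?thesis using 2 by (simp add: flat_def)
  next
    case 3
    have "((\<lambda>t. inverse t ^ k * exp (- inverse t)) has_real_derivative
        inverse t ^ k * (exp (- inverse t) * (inverse t * inverse t))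
        + (real k * inverse t ^ (k - 1) * (- (inverse t * inverse t))) * exp (- inverse t)) (at t)"
      using 3 by (auto intro!: derivative_eq_intros simp: power2_eq_square algebra_simps)
    then have "(flat k has_real_derivative
        inverse t ^ k * (exp (- inverse t) * (inverse t * inverse t))
        + (real k * inverse t ^ (k - 1) * (- (inverse t * inverse t))) * exp (- inverse t)) (at t)"
      by (rule has_field_derivative_transform_within_open[where S="{0<..}"]) (use 3 in \<open>auto simp: flat_def\<close>)
    moreover have "inverse t ^ k * (exp (- inverse t) * (inverse t * inverse t))
        + (real k * inverse t ^ (k - 1) * (- (inverse t * inverse t))) * exp (- inverse t)
        = flat (Suc (Suc k)) t - real k * flat (Suc k) t"
      using 3 by (cases k) (simp_all add: flat_def algebra_simps)
    ultimately show ?thesis by simp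
  qed
qed

lemma flat_compose_has_derivative:
  assumes "(v has_derivative v') (at x)"
  shows "((\<lambda>x. flat k (v x)) has_derivative (\<lambda>h. v' h * (flat (Suc (Suc k)) (v x) + (- real k) * flat (Suc k) (v x)))) (at x)"
  using DERIV_compose_FDERIV[OF flat_has_derivative assms] by simp

lemma Ck_flat_compose:
  assumes v: "\<And>n. Ck n v" shows "Ck n (\<lambda>x. flat k (v x))"
proof (induction n arbitrary: k)
  case 0
  have "isCont (flat k) t" for t using flat_has_derivative DERIV_isCont by blast
  then have "continuous_on UNIV (flat k)" by (simp add: continuous_at_imp_continuous_on)
  then show ?case using continuous_on_compose2[OF _ Ck_imp_continuous[OF v[of 0]], of UNIV "flat k"] by simp
next
  case (Suc n)
  obtain v' where v': "\<And>x. (v has_derivative v' x) (at x)" "\<And>b. b \<in> Basis \<Longrightarrow> Ck n (\<lambda>x. v' x b)"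
    by (rule Ck_Suc_derivative[OF v]) blast
  show ?case by (rule Ck_SucI[OF flat_compose_has_derivative[OF v'(1)]])
       (intro Ck_mult Ck_add Ck_const Suc v'(2))
qed

lemma flat_nonneg [simp]: "0 \<le> flat k t" by (simp add: flat_def)

text \<open>With \<open>y = inverse t\<close>, the single term \<open>y ^ k / fact k\<close> of the
  exponential series is at most \<open>exp y\<close>.\<close>

lemma flat_le: "flat k t \<le> fact k"
proof (cases "0 < t")
  case True
  define y where "y = inverse t"
  have y: "0 < y" using True by (simp add: y_def)
  have "y ^ k / fact k \<le> exp y"
  proof -
    have "(\<lambda>n. y ^ n /\<^sub>R fact n) sums exp y" by (rule exp_converges)
    note s = this
    have "(\<Sum>n\<in>{k}. y ^ n /\<^sub>R fact n) \<le> (\<Sum>n. y ^ n /\<^sub>R fact n)"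
      by (rule sum_le_suminf[OF sums_summable[OF s]]) (use y in auto)
    then have "(\<Sum>n\<in>{k}. y ^ n /\<^sub>R fact n) \<le> exp y" unfolding sums_unique[OF s, symmetric] .
    then show ?thesis by (simp add: divide_inverse_commute)
  qed
  then have "y ^ k \<le> fact k * exp y" by (simp add: field_simps)
  then have "y ^ k * exp (- y) \<le> fact k * exp y * exp (- y)" by (intro mult_right_mono) auto
  then show ?thesis using True by (simp add: flat_def y_def exp_minus mult.assoc)
qed (simp add: flat_def)

lemma flat_tendsto:
  assumes "filterlim y at_top G"
  shows "((\<lambda>n. flat 0 (y n)) \<longlongrightarrow> 1) G" "((\<lambda>n. flat (Suc k) (y n)) \<longlongrightarrow> 0) G"
proof -
  have i: "((\<lambda>n. inverse (y n)) \<longlongrightarrow> 0) G" by (rule tendsto_inverse_0_at_top[OF assms])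
  have pos: "\<forall>\<^sub>F n in G. 0 < y n" using assms by (simp add: filterlim_at_top_dense)
  have "((\<lambda>n. inverse (y n) ^ 0 * exp (- inverse (y n))) \<longlongrightarrow> 0 ^ 0 * exp (- 0)) G"
    by (intro tendsto_intros i)
  moreover have "((\<lambda>n. inverse (y n) ^ Suc k * exp (- inverse (y n))) \<longlongrightarrow> 0 ^ Suc k * exp (- 0)) G"
    by (intro tendsto_intros i)
  ultimately show "((\<lambda>n. flat 0 (y n)) \<longlongrightarrow> 1) G" "((\<lambda>n. flat (Suc k) (y n)) \<longlongrightarrow> 0) G"
    using pos by (auto elim!: Lim_transform_eventually eventually_mono simp: flat_def)
qed

lemma test_functions_translate:
  fixes \<phi> :: "'a::euclidean_space \<Rightarrow> real"
  assumes \<phi>: "\<phi> \<in> test_functions \<Omega>"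
  shows "(\<lambda>x. \<phi> (x - a)) \<in> test_functions ((+) a ` \<Omega>)"
    and "grad (\<lambda>x. \<phi> (x - a)) x = grad \<phi> (x - a)"
proof -
  have "{x. \<phi> (x - a) \<noteq> 0} = (+) a ` {x. \<phi> x \<noteq> 0}"
    by (auto simp: image_iff) (metis add_diff_cancel_left' diff_add_cancel add.commute)
  then have "closure {x. \<phi> (x - a) \<noteq> 0} = (+) a ` closure {x. \<phi> x \<noteq> 0}"
    by (simp add: closure_translation)
  moreover have "compact ((+) a ` closure {x. \<phi> x \<noteq> 0})" "(+) a ` closure {x. \<phi> x \<noteq> 0} \<subseteq> (+) a ` \<Omega>"
    using \<phi> unfolding test_functions_def by (blast intro: compact_translation)+
  moreover have "Ck n (\<lambda>x. \<phi> (x - a))" for n by (rule Ck_translate[OF test_functionsD(1)[OF \<phi>]])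
  ultimately show "(\<lambda>x. \<phi> (x - a)) \<in> test_functions ((+) a ` \<Omega>)"
    unfolding test_functions_def mem_Collect_eq by simp
  have "((\<lambda>x. x - a) has_derivative (\<lambda>h. h)) (at x)" by (auto intro!: derivative_eq_intros)
  from has_derivative_compose[OF this test_functionsD(4)[OF \<phi>]]
  show "grad (\<lambda>x. \<phi> (x - a)) x = grad \<phi> (x - a)" by (rule has_derivative_imp_grad)
qed

lemma test_functions_sum:
  fixes \<phi> :: "'i \<Rightarrow> 'a::euclidean_space \<Rightarrow> real"
  assumes "finite I" and \<phi>: "\<And>i. i \<in> I \<Longrightarrow> \<phi> i \<in> test_functions \<Omega>"
  shows "(\<lambda>x. \<Sum>i\<in>I. \<phi> i x) \<in> test_functions \<Omega>"
    and "grad (\<lambda>x. \<Sum>i\<in>I. \<phi> i x) x = (\<Sum>i\<in>I. grad (\<phi> i) x)"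
proof -
  let ?K = "\<Union>i\<in>I. closure {x. \<phi> i x \<noteq> 0}"
  have K: "compact ?K" "?K \<subseteq> \<Omega>"
  proof -
    have c: "compact (closure {x. \<phi> i x \<noteq> 0})" "closure {x. \<phi> i x \<noteq> 0} \<subseteq> \<Omega>" if "i \<in> I" for i
      using \<phi>[OF that] unfolding test_functions_def by blast+
    show "compact ?K" by (rule compact_UN[OF \<open>finite I\<close> c(1)])
    show "?K \<subseteq> \<Omega>" by (rule UN_least[OF c(2)])
  qed
  have "x \<in> ?K" if nz: "(\<Sum>i\<in>I. \<phi> i x) \<noteq> 0" for x
  proof -
    have "\<exists>i\<in>I. \<phi> i x \<noteq> 0" using nz by (rule contrapos_np) (auto intro: sum.neutral)
    then obtain i where i: "i \<in> I" "\<phi> i x \<noteq> 0" by (rule bexE)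
    have "x \<in> closure {x. \<phi> i x \<noteq> 0}" by (rule subsetD[OF closure_subset]) (simp add: i)
    then show ?thesis by (rule UN_I[OF i(1)])
  qed
  then have sub: "closure {x. (\<Sum>i\<in>I. \<phi> i x) \<noteq> 0} \<subseteq> ?K"
    using K(1) by (intro closure_minimal compact_imp_closed) auto
  have "compact (closure {x. (\<Sum>i\<in>I. \<phi> i x) \<noteq> 0})" unfolding compact_closure
    by (rule bounded_subset[OF compact_imp_bounded[OF K(1)] order_trans[OF closure_subset sub]])
  moreover have "Ck n (\<lambda>x. \<Sum>i\<in>I. \<phi> i x)" for n using test_functionsD(1)[OF \<phi>] by (intro Ck_sum) auto
  ultimately show "(\<lambda>x. \<Sum>i\<in>I. \<phi> i x) \<in> test_functions \<Omega>"
    using sub K(2) by (auto simp: test_functions_def)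
  have "((\<lambda>x. \<Sum>i\<in>I. \<phi> i x) has_derivative (\<lambda>h. \<Sum>i\<in>I. grad (\<phi> i) x \<bullet> h)) (at x)"
    using test_functionsD(4)[OF \<phi>] by (intro has_derivative_sum)
  then show "grad (\<lambda>x. \<Sum>i\<in>I. \<phi> i x) x = (\<Sum>i\<in>I. grad (\<phi> i) x)"
    by (intro has_derivative_imp_grad) (simp add: inner_sum_left)
qed

section \<open>Scaling\<close>

lemma lborel_integral_scale:
  fixes f :: "'a::euclidean_space \<Rightarrow> real"
  assumes [measurable]: "f \<in> borel_measurable borel" and "0 < c"
  shows "(LINT x|lborel. f x) = c ^ DIM('a) * (LINT x|lborel. f (c *\<^sub>R x))"
    and "integrable lborel f \<Longrightarrow> integrable lborel (\<lambda>x. f (c *\<^sub>R x))"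
proof -
  have eq: "(lborel :: 'a measure) = density (distr lborel borel (\<lambda>x. 0 + c *\<^sub>R x)) (\<lambda>_. \<bar>c\<bar> ^ DIM('a))"
    using \<open>0 < c\<close> by (intro lborel_affine) simp
  have "(LINT x|lborel. f x) = (LINT x|density (distr lborel borel (\<lambda>x. 0 + c *\<^sub>R x)) (\<lambda>_. \<bar>c\<bar> ^ DIM('a)). f x)"
    by (subst eq) (rule refl)
  also have "\<dots> = (LINT x|lborel. c ^ DIM('a) * f (c *\<^sub>R x))"
    using \<open>0 < c\<close> by (subst integral_density) (auto simp: integral_distr)
  finally show "(LINT x|lborel. f x) = c ^ DIM('a) * (LINT x|lborel. f (c *\<^sub>R x))" by simp
  assume i: "integrable lborel f"
  have "integrable (density (distr lborel borel (\<lambda>x. 0 + c *\<^sub>R x)) (\<lambda>_. \<bar>c\<bar> ^ DIM('a))) f"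
    using i by (subst (asm) eq)
  then have "integrable lborel (\<lambda>x. c ^ DIM('a) * f (c *\<^sub>R x))"
    using \<open>0 < c\<close> by (subst (asm) integrable_density) (auto simp: integrable_distr_eq)
  then show "integrable lborel (\<lambda>x. f (c *\<^sub>R x))" using \<open>0 < c\<close> by simp
qed

lemma lborel_integral_translate:
  fixes f :: "'a::euclidean_space \<Rightarrow> real"
  assumes [measurable]: "f \<in> borel_measurable borel"
  shows "(LINT x|lborel. f (x - a)) = (LINT x|lborel. f x)"
proof -
  have "(LINT x|lborel. f x) = (LINT x|distr lborel borel ((+) (- a)). f x)"
    by (simp add: lborel_distr_plus)
  also have "\<dots> = (LINT x|lborel. f (x - a))" by (subst integral_distr) auto
  finally show ?thesis by simp
qed

text \<open>Obtained by differentiating \<open>\<integral> u ((1 + t) x) dx = (1 + t) ^ (- d) * \<integral> u\<close> at \<open>t = 0\<close>.\<close>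

lemma integral_grad_inner_self:
  fixes u :: "'a::euclidean_space \<Rightarrow> real"
  assumes u: "u \<in> test_functions \<Omega>"
  shows "(LINT x|lborel. grad u x \<bullet> x) = - real DIM('a) * (LINT x|lborel. u x)"
proof -
  let ?d = "DIM('a)"
  define I where "I = (LINT x|lborel. u x)"
  define D where "D = (LINT x|lborel. grad u x \<bullet> x)"
  have c: "continuous_on UNIV u" "continuous_on UNIV (grad u)" using test_functionsD[OF u] by auto
  have [measurable]: "u \<in> borel_measurable borel" using test_functionsD[OF u] by auto
  obtain M where M: "0 < M" "\<And>x. M < norm x \<Longrightarrow> u x = 0 \<and> grad u x = 0"
    by (rule test_functions_support_bounded[OF u]) blast
  have iu: "integrable lborel u" using M by (intro compact_support_integrable[OF c(1), of M]) auto
  have ig: "integrable lborel (\<lambda>x. grad u x \<bullet> x)"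
    using M by (intro compact_support_integrable[of _ M] continuous_intros c) auto
  define B where "B = vol (cball (0::'a) M)"
  have lim: "((\<lambda>t. ((inverse ((1 + t) ^ ?d) - 1) / t) * I - D) \<longlongrightarrow> (- real ?d) * I - D) (at_right 0)"
  proof -
    have "((\<lambda>t. inverse ((1 + t) ^ ?d)) has_real_derivative - real ?d) (at 0)"
      by (auto intro!: derivative_eq_intros)
    then have "((\<lambda>t. (inverse ((1 + t) ^ ?d) - 1) / t) \<longlongrightarrow> - real ?d) (at 0)"
      unfolding DERIV_def by simp
    then have "((\<lambda>t. (inverse ((1 + t) ^ ?d) - 1) / t) \<longlongrightarrow> - real ?d) (at_right 0)"
      by (rule filterlim_mono) (auto intro: at_le)
    then show ?thesis by (intro tendsto_intros)
  qed
  \<comment> \<open>Taylor is used for the displacement \<open>t *\<^sub>R x\<close>, of length at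
    most \<open>t * M\<close> in the ball of radius \<open>M\<close>. Beyond that ball
    \<open>x\<close> and the still more distant \<open>(1 + t) *\<^sub>R x\<close> are both outside
    the support.\<close>
  have bound: "\<bar>(- real ?d) * I - D\<bar> \<le> \<epsilon> * (M * B)" if \<epsilon>: "0 < \<epsilon>" for \<epsilon>
  proof -
    obtain \<eta> where \<eta>: "0 < \<eta>"
      "\<And>x z. dist x z < \<eta> \<Longrightarrow> \<bar>u x - u z - grad u z \<bullet> (x - z)\<bar> \<le> \<epsilon> * norm (x - z)"
      by (rule test_functions_taylor[OF u \<epsilon>]) blast
    have "\<bar>((inverse ((1 + t) ^ ?d) - 1) / t) * I - D\<bar> \<le> \<epsilon> * (M * B)" if t: "0 < t" "t < \<eta> / M" for t
    proof -
      have tM: "t * M < \<eta>" using t M by (simp add: field_simps)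
      have i1: "integrable lborel (\<lambda>x. u ((1 + t) *\<^sub>R x))" using t iu by (intro lborel_integral_scale(2)) auto
      have "I = (1 + t) ^ ?d * (LINT x|lborel. u ((1 + t) *\<^sub>R x))"
        using t unfolding I_def by (intro lborel_integral_scale(1)) auto
      then have s: "(LINT x|lborel. u ((1 + t) *\<^sub>R x)) = inverse ((1 + t) ^ ?d) * I"
        using t by (simp add: field_simps)
      have "(LINT x|lborel. u ((1 + t) *\<^sub>R x) - u x - t * (grad u x \<bullet> x))
          = (LINT x|lborel. u ((1 + t) *\<^sub>R x)) - I - t * D"
        unfolding I_def D_def using i1 iu ig by simp
      then have "(inverse ((1 + t) ^ ?d) - 1) * I - t * D
          = (LINT x|lborel. u ((1 + t) *\<^sub>R x) - u x - t * (grad u x \<bullet> x))"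
        unfolding s by (simp add: left_diff_distrib)
      also have "\<bar>\<dots>\<bar> \<le> (LINT x|lborel. \<bar>u ((1 + t) *\<^sub>R x) - u x - t * (grad u x \<bullet> x)\<bar>)"
        by (rule integral_abs_bound)
      also have "\<dots> \<le> (LINT x|lborel. (\<epsilon> * (t * M)) * indicator (cball (0::'a) M) x)"
      proof (rule Bochner_Integration.integral_mono)
        show "integrable lborel (\<lambda>x. \<bar>u ((1 + t) *\<^sub>R x) - u x - t * (grad u x \<bullet> x)\<bar>)"
          using i1 iu ig by (intro integrable_abs Bochner_Integration.integrable_diff integrable_mult_right) auto
        show "integrable lborel (\<lambda>x. (\<epsilon> * (t * M)) * indicator (cball (0::'a) M) x)"
          using emeasure_lborel_cball_finite[of "0::'a" M] by (intro integrable_mult_right integrable_real_indicator) auto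
        fix x
        show "\<bar>u ((1 + t) *\<^sub>R x) - u x - t * (grad u x \<bullet> x)\<bar> \<le> (\<epsilon> * (t * M)) * indicator (cball 0 M) x"
        proof (cases "norm x \<le> M")
          case True
          have eq: "(1 + t) *\<^sub>R x - x = t *\<^sub>R x" by (simp add: algebra_simps)
          have le: "t * norm x \<le> t * M" using True t by simp
          have "t * norm x < \<eta>" using le tM by linarith
          then have "dist ((1 + t) *\<^sub>R x) x < \<eta>" using t by (simp add: dist_norm eq)
          from \<eta>(2)[OF this] have "\<bar>u ((1 + t) *\<^sub>R x) - u x - t * (grad u x \<bullet> x)\<bar> \<le> \<epsilon> * (t * norm x)"
            using t by (simp add: eq)
          also have "\<dots> \<le> \<epsilon> * (t * M)" by (rule mult_left_mono[OF le less_imp_le[OF \<epsilon>]])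
          finally show ?thesis using True by (simp add: indicator_def)
        next
          case False
          have "1 * norm x \<le> (1 + t) * norm x" using t by (intro mult_right_mono) auto
          then have "M < norm ((1 + t) *\<^sub>R x)" using False t by simp
          then show ?thesis using M(2)[of x] M(2)[of "(1 + t) *\<^sub>R x"] False by (simp add: indicator_def)
        qed
      qed
      also have "\<dots> = t * (\<epsilon> * (M * B))" by (simp add: B_def)
      finally have "\<bar>(inverse ((1 + t) ^ ?d) - 1) * I - t * D\<bar> / t \<le> \<epsilon> * (M * B)"
        using t by (simp add: field_simps)
      moreover have "\<bar>(inverse ((1 + t) ^ ?d) - 1) * I - t * D\<bar> / t
          = \<bar>((inverse ((1 + t) ^ ?d) - 1) * I - t * D) / t\<bar>" using t by simp
      moreover have "(a * I - t * D) / t = (a / t) * I - D" for a using t by (simp add: field_simps)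
      ultimately show ?thesis by metis
    qed
    moreover have "\<forall>\<^sub>F t in at_right 0. 0 < t \<and> t < \<eta> / M"
      using \<eta> M by (auto simp: eventually_at_right_field intro!: exI[of _ "\<eta> / M"])
    ultimately have "\<forall>\<^sub>F t in at_right 0. \<bar>((inverse ((1 + t) ^ ?d) - 1) / t) * I - D\<bar> \<le> \<epsilon> * (M * B)"
      by (auto elim: eventually_mono)
    then show ?thesis by (rule tendsto_upperbound[OF tendsto_rabs[OF lim]]) simp
  qed
  have "\<bar>(- real ?d) * I - D\<bar> \<le> 0"
  proof (rule field_le_epsilon)
    fix e :: real assume e: "0 < e"
    have MB: "0 \<le> M * B" using M by (simp add: B_def)
    have "\<bar>(- real ?d) * I - D\<bar> \<le> e / (M * B + 1) * (M * B)" using e MB by (intro bound) simp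
    also have "\<dots> \<le> e" using e MB by (simp add: field_simps)
    finally show "\<bar>(- real ?d) * I - D\<bar> \<le> 0 + e" by simp
  qed
  then show ?thesis by (simp add: I_def D_def)
qed

lemma ball_moment_scale:
  assumes "0 < \<rho>"
  shows "ball_moment TYPE('a::euclidean_space) a \<rho> = \<rho> ^ DIM('a) * \<rho> powr a * ball_moment TYPE('a) a 1"
proof -
  have "ball_moment TYPE('a) a \<rho> = \<rho> ^ DIM('a) *
      (LINT x|lborel. indicator (ball (0::'a) \<rho>) (\<rho> *\<^sub>R x) *\<^sub>R norm (\<rho> *\<^sub>R x) powr a)"
    unfolding ball_moment_def set_lebesgue_integral_def
    by (rule lborel_integral_scale(1)[OF _ assms]) simp
  also have "(\<lambda>x. indicator (ball (0::'a) \<rho>) (\<rho> *\<^sub>R x) *\<^sub>R norm (\<rho> *\<^sub>R x) powr a)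
      = (\<lambda>x. \<rho> powr a * (indicator (ball (0::'a) 1) x *\<^sub>R norm x powr a))"
    using assms by (auto simp: fun_eq_iff indicator_def powr_mult)
  finally show ?thesis by (simp add: ball_moment_def set_lebesgue_integral_def)
qed

lemma ball_moment_pos:
  assumes "0 < \<rho>" "0 < a" shows "0 < ball_moment TYPE('a::euclidean_space) a \<rho>"
proof -
  \<comment> \<open>On this shell the integrand is at least
    \<open>(\<rho> / 2) powr a\<close>.\<close>
  let ?A = "ball (0::'a) \<rho> - cball 0 (\<rho> / 2)"
  obtain b :: 'a where b: "b \<in> Basis" using nonempty_Basis by blast
  have "(3 / 4 * \<rho>) *\<^sub>R b \<in> ?A" using assms b by simp
  then have "?A \<noteq> {}" by blast
  moreover have fA: "?A \<in> fmeasurable lborel"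
    by (intro bounded_open_fmeasurable open_Diff bounded_diff) auto
  ultimately have pA: "0 < vol ?A" by (intro open_measure_pos) auto
  have "ennreal ((\<rho> / 2) powr a * vol ?A) = (\<integral>\<^sup>+y. ennreal ((\<rho> / 2) powr a) * indicator ?A y \<partial>lborel)"
    using fA by (subst nn_integral_cmult_indicator) (auto simp: ennreal_mult emeasure_eq_measure2)
  also have "\<dots> \<le> (\<integral>\<^sup>+y. ennreal (indicator (ball (0::'a) \<rho>) y * norm y powr a) \<partial>lborel)"
    using assms by (intro nn_integral_mono) (auto simp: indicator_def intro!: ennreal_leI powr_mono2)
  finally have "(\<rho> / 2) powr a * vol ?A \<le> ball_moment TYPE('a) a \<rho>"
    using ball_moment_eq[OF assms(2), where 'a='a and \<rho>=\<rho>] by (simp add: ennreal_le_iff)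
  moreover have "0 < (\<rho> / 2) powr a * vol ?A" using pA assms by simp
  ultimately show ?thesis by linarith
qed

section \<open>The torsion of a ball\<close>

text \<open>The torsion function of the ball of radius \<open>r\<close> is a multiple of \<open>r powr q - norm x powr q\<close> with
  \<open>q = p / (p - 1)\<close>. It is regularised at the origin by \<open>\<delta> = inverse N\<close> and near the boundary
  by a smooth truncation of its values below \<open>inverse N\<close>.\<close>

definition profile :: "real \<Rightarrow> real \<Rightarrow> real \<Rightarrow> 'a::euclidean_space \<Rightarrow> real" where
  "profile q r N x = (r\<^sup>2 + inverse N) powr (q / 2) - (x \<bullet> x + inverse N) powr (q / 2)"

definition bump :: "real \<Rightarrow> real \<Rightarrow> real \<Rightarrow> 'a::euclidean_space \<Rightarrow> real" where
  "bump q r N x = profile q r N x * flat 0 (N * profile q r N x - 1)"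

text \<open>The derivative of \<open>(y + 1) * flat 0 y\<close>. With
  \<open>y = N * profile - 1\<close>, \<open>bump\<close> is this product divided by
  \<open>N\<close>, so its gradient is that of \<open>profile\<close> times this slope, and the
  factor \<open>N\<close> cancels.\<close>

definition cutoff_slope :: "real \<Rightarrow> real" where
  "cutoff_slope y = flat 0 y + flat 1 y + flat 2 y"

text \<open>The constant is \<open>fact 0 + fact 1 + fact 2\<close>. It does not depend on
  \<open>N\<close>, which later provides a dominating function.\<close>

lemma cutoff_slope_bounds: "0 \<le> cutoff_slope y" "cutoff_slope y \<le> 4"
proof -
  show "0 \<le> cutoff_slope y" unfolding cutoff_slope_def by (intro add_nonneg_nonneg) auto
  show "cutoff_slope y \<le> 4"
    using flat_le[of 0 y] flat_le[of 1 y] flat_le[of 2 y] unfolding cutoff_slope_def by simp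
qed

lemma profile_has_derivative:
  assumes "0 < N"
  shows "(profile q r N has_derivative (\<lambda>h. - q * (x \<bullet> x + inverse N) powr (q / 2 - 1) * (x \<bullet> h))) (at x)"
proof -
  have "0 < inverse N" using assms by simp
  from has_derivative_diff[OF has_derivative_const has_derivative_shifted_norm_powr[OF this]]
  have "((\<lambda>x. (r\<^sup>2 + inverse N) powr (q / 2) - (x \<bullet> x + inverse N) powr (q / 2)) has_derivative
      (\<lambda>h. 0 - 2 * (q / 2) * (x \<bullet> x + inverse N) powr (q / 2 - 1) * (x \<bullet> h))) (at x)" .
  then show ?thesis by (simp add: profile_def[abs_def])
qed

lemma Ck_profile:
  assumes "0 < N" shows "Ck n (profile q r N)"
proof -
  have "0 < inverse N" using assms by simp
  have "Ck n (\<lambda>x. (r\<^sup>2 + inverse N) powr (q / 2) + (- 1) * (x \<bullet> x + inverse N) powr (q / 2))"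
    by (intro Ck_add Ck_mult Ck_const Ck_shifted_norm_powr \<open>0 < inverse N\<close>)
  then show ?thesis by (simp add: profile_def[abs_def])
qed

lemma Ck_bump:
  assumes "0 < N" shows "Ck n (bump q r N)"
proof -
  have "Ck n (\<lambda>x. profile q r N x * flat 0 (N * profile q r N x + (- 1)))" for n
    by (intro Ck_mult Ck_flat_compose Ck_add Ck_const Ck_profile assms)
  then show ?thesis by (simp add: bump_def[abs_def])
qed

lemma grad_bump:
  assumes N: "0 < N"
  shows "grad (bump q r N) x = (- q * (x \<bullet> x + inverse N) powr (q / 2 - 1) * cutoff_slope (N * profile q r N x - 1)) *\<^sub>R x"
proof (rule has_derivative_imp_grad)
  let ?v = "profile q r N"
  let ?y = "N * ?v x - 1"
  define c where "c = - q * (x \<bullet> x + inverse N) powr (q / 2 - 1)"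
  have v: "(?v has_derivative (\<lambda>h. c * (x \<bullet> h))) (at x)"
    unfolding c_def by (rule profile_has_derivative[OF N])
  have y: "((\<lambda>x. N * ?v x - 1) has_derivative (\<lambda>h. N * (c * (x \<bullet> h)))) (at x)"
    using has_derivative_diff[OF has_derivative_mult_right[OF v] has_derivative_const] by simp
  have "(bump q r N has_derivative
      (\<lambda>h. ?v x * (N * (c * (x \<bullet> h)) * (flat (Suc (Suc 0)) ?y + (- real 0) * flat (Suc 0) ?y)) + c * (x \<bullet> h) * flat 0 ?y)) (at x)"
    unfolding bump_def[abs_def] by (rule has_derivative_mult[OF v flat_compose_has_derivative[OF y]])
  also have "(\<lambda>h. ?v x * (N * (c * (x \<bullet> h)) * (flat (Suc (Suc 0)) ?y + (- real 0) * flat (Suc 0) ?y)) + c * (x \<bullet> h) * flat 0 ?y)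
      = (\<lambda>h. (c * cutoff_slope ?y) *\<^sub>R x \<bullet> h)"
  proof
    fix h
    \<comment> \<open>The derivative of \<open>flat 0\<close> is \<open>flat 2\<close>;
      multiplication by \<open>y + 1 = N * profile\<close> turns it back into bounded terms without
      \<open>N\<close>.\<close>
    have "(y + 1) * flat 2 y = flat 1 y + flat 2 y" for y
      by (auto simp: flat_def power2_eq_square field_simps)
    from this[of ?y] have "N * ?v x * flat 2 ?y = flat 1 ?y + flat 2 ?y" by simp
    then have "?v x * (N * flat 2 ?y) = flat 1 ?y + flat 2 ?y" by (simp add: algebra_simps)
    then have "(c * (x \<bullet> h)) * (?v x * (N * flat 2 ?y) + flat 0 ?y) = (c * (x \<bullet> h)) * cutoff_slope ?y"
      by (simp add: cutoff_slope_def)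
    then show "?v x * (N * (c * (x \<bullet> h)) * (flat (Suc (Suc 0)) ?y + (- real 0) * flat (Suc 0) ?y)) + c * (x \<bullet> h) * flat 0 ?y
        = (c * cutoff_slope ?y) *\<^sub>R x \<bullet> h" by (simp add: numeral_2_eq_2 algebra_simps)
  qed
  finally show "(bump q r N has_derivative (\<lambda>h. (- q * (x \<bullet> x + inverse N) powr (q / 2 - 1) * cutoff_slope ?y) *\<^sub>R x \<bullet> h)) (at x)"
    unfolding c_def .
qed

lemma profile_pos_iff:
  fixes x :: "'a::euclidean_space"
  assumes "0 < N" "0 < r" "0 < q" shows "0 < profile q r N x \<longleftrightarrow> norm x < r"
proof -
  have i: "0 < inverse N" using assms by simp
  have "0 < profile q r N x \<longleftrightarrow> x \<bullet> x + inverse N < r\<^sup>2 + inverse N"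
  proof -
    have "0 \<le> x \<bullet> x + inverse N" "0 \<le> r\<^sup>2 + inverse N" using i by (simp_all add: add_nonneg_nonneg less_imp_le)
    then have "(x \<bullet> x + inverse N) powr (q / 2) < (r\<^sup>2 + inverse N) powr (q / 2) \<longleftrightarrow> x \<bullet> x + inverse N < r\<^sup>2 + inverse N"
      using assms powr_less_mono2[of "q / 2" "x \<bullet> x + inverse N" "r\<^sup>2 + inverse N"]
        powr_mono2[of "q / 2" "r\<^sup>2 + inverse N" "x \<bullet> x + inverse N"] by linarith
    then show ?thesis by (simp add: profile_def)
  qed
  also have "\<dots> \<longleftrightarrow> norm x ^ 2 < r ^ 2" by (simp add: dot_square_norm)
  also have "\<dots> \<longleftrightarrow> norm x < r" using assms by (metis less_imp_le norm_ge_zero power2_less_imp_less power_strict_mono zero_less_numeral)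
  finally show ?thesis .
qed

lemma bump_nonneg:
  assumes "0 < N" shows "0 \<le> bump q r N x"
proof (cases "0 \<le> profile q r N x")
  case False
  then have "N * profile q r N x - 1 \<le> 0" using assms by (simp add: mult_le_0_iff order_trans[of _ 0])
  then show ?thesis by (simp add: bump_def flat_def)
qed (simp add: bump_def)

text \<open>The cutoff is 0 wherever \<open>profile\<close> is at most \<open>inverse N\<close>. The
  support thus lies in the closed set where \<open>profile\<close> is at least
  \<open>inverse N\<close>, which is inside the open ball.\<close>

lemma bump_test_function:
  assumes "0 < N" "0 < r" "0 < q"
  shows "bump q r N \<in> test_functions (ball (0::'a::euclidean_space) r)"
proof -
  let ?S = "{x::'a. inverse N \<le> profile q r N x}"
  have c: "continuous_on UNIV (profile q r N :: 'a \<Rightarrow> real)" by (rule Ck_imp_continuous[OF Ck_profile[OF assms(1), of 0]])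
  then have "closed ?S" by (intro closed_Collect_le continuous_intros)
  have "inverse N \<le> profile q r N x" if "bump q r N x \<noteq> 0" for x :: 'a
  proof (rule ccontr)
    assume "\<not> inverse N \<le> profile q r N x"
    then have "N * profile q r N x - 1 < 0" using assms(1) by (simp add: field_simps)
    then show False using that by (simp add: bump_def flat_def)
  qed
  then have sub: "closure {x::'a. bump q r N x \<noteq> 0} \<subseteq> ?S"
    using \<open>closed ?S\<close> by (intro closure_minimal) auto
  have S: "?S \<subseteq> ball 0 r"
  proof
    fix x assume "x \<in> ?S"
    then have "0 < profile q r N x" using assms(1) by (simp add: less_le_trans[of 0 "inverse N"])
    then show "x \<in> ball 0 r" using profile_pos_iff[OF assms, of x] by simp
  qed
  have "bounded (closure {x::'a. bump q r N x \<noteq> 0})"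
    by (rule bounded_subset[OF bounded_ball order_trans[OF sub S]])
  then have "compact (closure {x::'a. bump q r N x \<noteq> 0})" by (simp add: compact_eq_bounded_closed)
  then show ?thesis
    using Ck_bump[OF assms(1)] order_trans[OF sub S] unfolding test_functions_def mem_Collect_eq by blast
qed

lemma profile_tendsto:
  fixes x :: "'a::euclidean_space"
  assumes q: "0 < q"
  shows "(\<lambda>n. profile q r (real (Suc n)) x) \<longlonglongrightarrow> \<bar>r\<bar> powr q - norm x powr q"
proof -
  have i: "(\<lambda>n. inverse (real (Suc n))) \<longlonglongrightarrow> 0" by (rule LIMSEQ_inverse_real_of_nat)
  have sq: "(s\<^sup>2) powr (q / 2) = \<bar>s\<bar> powr q" for s :: real
  proof -
    have "s\<^sup>2 = \<bar>s\<bar> powr 2" by simp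
    then show ?thesis by (simp only: powr_powr) simp
  qed
  have "(\<lambda>n. (s\<^sup>2 + inverse (real (Suc n))) powr (q / 2)) \<longlonglongrightarrow> (s\<^sup>2 + 0) powr (q / 2)" for s :: real
    using q by (intro tendsto_powr2 tendsto_add tendsto_const i)
      (auto intro!: always_eventually add_nonneg_nonneg)
  from tendsto_diff[OF this[of r] this[of "norm x"]] show ?thesis
    by (simp add: profile_def dot_square_norm sq)
qed

text \<open>Inside the ball \<open>profile\<close> has a positive limit, so the argument of the
  cutoff tends to infinity; there \<open>flat 0\<close> tends to 1 and the other two terms to
  0.\<close>

lemma cutoff_slope_profile_tendsto:
  fixes x :: "'a::euclidean_space"
  assumes q: "0 < q" and x: "norm x < r"
  shows "(\<lambda>n. cutoff_slope (real (Suc n) * profile q r (real (Suc n)) x - 1)) \<longlonglongrightarrow> 1"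
proof -
  have "norm x powr q < \<bar>r\<bar> powr q" using x q norm_ge_zero[of x] by (intro powr_less_mono2) auto
  then have pos: "0 < \<bar>r\<bar> powr q - norm x powr q" by simp
  have "filterlim (\<lambda>n. profile q r (real (Suc n)) x * real (Suc n)) at_top sequentially"
    by (rule filterlim_tendsto_pos_mult_at_top[OF profile_tendsto[OF q] pos])
       (rule filterlim_compose[OF filterlim_real_sequentially filterlim_Suc])
  then have "filterlim (\<lambda>n. - 1 + profile q r (real (Suc n)) x * real (Suc n)) at_top sequentially"
    by (rule filterlim_tendsto_add_at_top[OF tendsto_const])
  then have top: "filterlim (\<lambda>n. real (Suc n) * profile q r (real (Suc n)) x - 1) at_top sequentially"
    by (simp add: algebra_simps)
  have "(\<lambda>n. cutoff_slope (real (Suc n) * profile q r (real (Suc n)) x - 1)) \<longlonglongrightarrow> 1 + 0 + 0"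
    unfolding cutoff_slope_def
    using flat_tendsto(1)[OF top] flat_tendsto(2)[OF top, of 0] flat_tendsto(2)[OF top, of 1]
    by (intro tendsto_add) (simp_all add: numeral_2_eq_2)
  then show ?thesis by simp
qed

lemma norm_grad_bump:
  assumes N: "0 < N" and q: "0 < q"
  shows "norm (grad (bump q r N) x) = q * (x \<bullet> x + inverse N) powr (q / 2 - 1) * norm x * cutoff_slope (N * profile q r N x - 1)"
  using q cutoff_slope_bounds(1) by (simp add: grad_bump[OF N] abs_mult mult.commute mult.left_commute)

lemma grad_bump_outside:
  assumes "0 < N" "0 < r" "0 < q" "r \<le> norm x"
  shows "grad (bump q r N) x = 0"
  using test_functions_outside_domain(2)[OF bump_test_function[OF assms(1-3)], of x] assms(4) by simp

lemma grad_bump_limit: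
  fixes x :: "'a::euclidean_space"
  assumes q: "1 < q" and r: "0 < r"
  shows "(\<lambda>n. norm (grad (bump q r (real (Suc n))) x)) \<longlonglongrightarrow> indicator (ball 0 r) x * (q * norm x powr (q - 1))"
proof (cases "norm x < r")
  case False
  have "grad (bump q r (real (Suc n))) x = 0" for n using False q r by (intro grad_bump_outside) auto
  then show ?thesis using False by (simp del: of_nat_Suc)
next
  case True
  have i: "(\<lambda>n. inverse (real (Suc n))) \<longlonglongrightarrow> 0" by (rule LIMSEQ_inverse_real_of_nat)
  have q0: "0 < q" using q by simp
  show ?thesis
  proof (cases "x = 0")
    \<comment> \<open>At the origin the shifted power may blow up as the shift tends to 0, but the
      factor \<open>norm x\<close> makes every term 0.\<close>
    case True
    then show ?thesis using norm_grad_bump[of "real (Suc n)" q r x for n] q0 by (simp del: of_nat_Suc)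
  next
    case nz: False
    have "(\<lambda>n. (x \<bullet> x + inverse (real (Suc n))) powr (q / 2 - 1)) \<longlonglongrightarrow> (x \<bullet> x + 0) powr (q / 2 - 1)"
      using nz by (intro tendsto_powr tendsto_add tendsto_const i) auto
    then have "(\<lambda>n. q * (x \<bullet> x + inverse (real (Suc n))) powr (q / 2 - 1) * norm x * cutoff_slope (real (Suc n) * profile q r (real (Suc n)) x - 1))
        \<longlonglongrightarrow> q * (x \<bullet> x + 0) powr (q / 2 - 1) * norm x * 1"
      by (intro tendsto_mult tendsto_const cutoff_slope_profile_tendsto[OF q0 True])
    also have "q * (x \<bullet> x + 0) powr (q / 2 - 1) * norm x * 1 = q * norm x powr (q - 1)"
    proof -
      have "(x \<bullet> x + 0) powr (q / 2 - 1) = (norm x powr 2) powr (q / 2 - 1)" by (simp add: dot_square_norm)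
      also have "\<dots> = norm x powr (q - 2)" by (simp only: powr_powr) (simp add: right_diff_distrib)
      finally have "(x \<bullet> x + 0) powr (q / 2 - 1) = norm x powr (q - 2)" .
      moreover have "norm x powr (q - 2) * norm x = norm x powr (q - 1)"
        using nz powr_add[of "norm x" "q - 2" 1] by simp
      ultimately show ?thesis by simp
    qed
    finally show ?thesis using norm_grad_bump[OF _ q0, of "real (Suc n)" r x for n] True
      by (simp del: of_nat_Suc)
  qed
qed

text \<open>For \<open>q < 2\<close> the power with exponent \<open>q / 2 - 1\<close> is not bounded
  uniformly in the shift. Bounding \<open>norm x\<close> by the square root of the same base raises
  the exponent to the positive \<open>(q - 1) / 2\<close>; the factor 4 is that of
  \<open>cutoff_slope_bounds\<close>.\<close>

lemma norm_grad_bump_le: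
  fixes x :: "'a::euclidean_space"
  assumes q: "1 < q" and r: "0 < r"
  shows "norm (grad (bump q r (real (Suc n))) x) \<le> 4 * q * (r\<^sup>2 + 1) powr ((q - 1) / 2) * indicator (ball 0 r) x"
proof (cases "norm x < r")
  case False
  have "grad (bump q r (real (Suc n))) x = 0" using False q r by (intro grad_bump_outside) auto
  then show ?thesis using False by simp
next
  case True
  let ?\<delta> = "inverse (real (Suc n))"
  have \<delta>: "0 < ?\<delta>" "?\<delta> \<le> 1" by (auto simp: inverse_le_1_iff)
  have P: "0 < x \<bullet> x + ?\<delta>" using \<delta>(1) by (simp add: add_nonneg_pos del: of_nat_Suc)
  have "norm x = (norm x ^ 2) powr (1 / 2)" by (simp add: powr_half_sqrt)
  also have "\<dots> \<le> (x \<bullet> x + ?\<delta>) powr (1 / 2)"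
    using \<delta>(1) by (intro powr_mono2) (auto simp: dot_square_norm simp del: of_nat_Suc)
  finally have nx: "norm x \<le> (x \<bullet> x + ?\<delta>) powr (1 / 2)" .
  have "norm x ^ 2 \<le> r ^ 2" using True by (intro power_mono) auto
  then have le: "x \<bullet> x + ?\<delta> \<le> r\<^sup>2 + 1" using \<delta>(2) unfolding dot_square_norm by linarith
  have "(x \<bullet> x + ?\<delta>) powr (q / 2 - 1) * norm x \<le> (x \<bullet> x + ?\<delta>) powr (q / 2 - 1) * (x \<bullet> x + ?\<delta>) powr (1 / 2)"
    using nx by (intro mult_left_mono) auto
  also have "\<dots> = (x \<bullet> x + ?\<delta>) powr ((q - 1) / 2)"
    by (simp add: powr_add[symmetric] diff_divide_distrib)
  also have "\<dots> \<le> (r\<^sup>2 + 1) powr ((q - 1) / 2)" using le P q by (intro powr_mono2) auto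
  finally have "q * ((x \<bullet> x + ?\<delta>) powr (q / 2 - 1) * norm x) * cutoff_slope (real (Suc n) * profile q r (real (Suc n)) x - 1)
      \<le> q * (r\<^sup>2 + 1) powr ((q - 1) / 2) * 4"
    using q cutoff_slope_bounds by (intro mult_mono) (auto intro!: mult_nonneg_nonneg)
  moreover have "norm (grad (bump q r (real (Suc n))) x)
      = q * ((x \<bullet> x + ?\<delta>) powr (q / 2 - 1) * norm x) * cutoff_slope (real (Suc n) * profile q r (real (Suc n)) x - 1)"
    using norm_grad_bump[of "real (Suc n)" q r x] q by (simp add: mult.assoc del: of_nat_Suc)
  ultimately show ?thesis using True by (simp add: mult_ac)
qed

text \<open>Dominated convergence for gradients tending to \<open>q * norm x powr (q - 1)\<close> in
  length. Conjugacy, \<open>(q - 1) * p = q\<close>, makes the energy a multiple of the moment. The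
  mass is first rewritten by \<open>integral_grad_inner_self\<close>; the gradient points towards
  the origin, so its inner product with \<open>- x\<close> is the product of the norms.\<close>

lemma bump_integral_limits:
  assumes p: "1 < p" and q: "q = p / (p - 1)" and r: "0 < r"
  shows "(\<lambda>n. LINT x|lborel. norm (grad (bump q r (real (Suc n))) (x::'a::euclidean_space)) powr p) \<longlonglongrightarrow> q powr p * ball_moment TYPE('a) q r"
    and "(\<lambda>n. real DIM('a) * (LINT x|lborel. bump q r (real (Suc n)) (x::'a))) \<longlonglongrightarrow> q * ball_moment TYPE('a) q r"
proof -
  have q1: "1 < q" using p by (simp add: q field_simps)
  have qp: "(q - 1) * p = q" using p by (simp add: q field_simps)
  let ?b = "\<lambda>n. bump q r (real (Suc n)) :: 'a \<Rightarrow> real"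
  let ?C = "4 * q * (r\<^sup>2 + 1) powr ((q - 1) / 2)"
  have T: "?b n \<in> test_functions (ball 0 r)" for n using q1 r by (intro bump_test_function) auto
  have [measurable]: "grad (?b n) \<in> borel_measurable borel" for n by (rule test_functionsD[OF T])
  have ind: "integrable lborel (\<lambda>x. c * indicator (ball (0::'a) r) x :: real)" for c
    using emeasure_lborel_ball_finite[of "0::'a" r] by (intro integrable_mult_right integrable_real_indicator) auto
  have C: "0 \<le> ?C" using q1 by simp
  have "(\<lambda>n. LINT x|lborel. norm (grad (?b n) x) powr p) \<longlonglongrightarrow> (LINT x|lborel. (indicator (ball (0::'a) r) x * (q * norm x powr (q - 1))) powr p)"
  proof (rule integral_dominated_convergence[where w="\<lambda>x. ?C powr p * indicator (ball 0 r) x"])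
    show "AE x in lborel. (\<lambda>n. norm (grad (?b n) x) powr p) \<longlonglongrightarrow> (indicator (ball (0::'a) r) x * (q * norm x powr (q - 1))) powr p"
      using p by (intro AE_I2 tendsto_powr2 grad_bump_limit q1 r tendsto_const) (auto intro: always_eventually)
    show "AE x in lborel. norm (norm (grad (?b n) x) powr p) \<le> ?C powr p * indicator (ball 0 r) x" for n
    proof (rule AE_I2)
      fix x :: 'a
      have "norm (grad (?b n) x) powr p \<le> (?C * indicator (ball 0 r) x) powr p"
        using p by (intro powr_mono2 norm_grad_bump_le q1 r) auto
      then show "norm (norm (grad (?b n) x) powr p) \<le> ?C powr p * indicator (ball 0 r) x"
        by (auto simp: indicator_def split: if_splits)
    qed
  qed (use ind in \<open>auto simp del: of_nat_Suc\<close>)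
  also have "(LINT x|lborel. (indicator (ball (0::'a) r) x * (q * norm x powr (q - 1))) powr p)
      = (LINT x|lborel. q powr p * (indicator (ball (0::'a) r) x *\<^sub>R norm x powr q))"
    using q1 qp by (intro Bochner_Integration.integral_cong refl) (auto simp: indicator_def powr_mult powr_powr)
  also have "\<dots> = q powr p * ball_moment TYPE('a) q r"
    by (simp add: ball_moment_def set_lebesgue_integral_def)
  finally show "(\<lambda>n. LINT x|lborel. norm (grad (?b n) x) powr p) \<longlonglongrightarrow> q powr p * ball_moment TYPE('a) q r" .
  have eq: "real DIM('a) * (LINT x|lborel. ?b n x) = (LINT x|lborel. norm (grad (?b n) x) * norm x)" for n
  proof -
    have "real DIM('a) * (LINT x|lborel. ?b n x) = - (LINT x|lborel. grad (?b n) x \<bullet> x)"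
      using integral_grad_inner_self[OF T[of n]] by simp
    also have "\<dots> = (LINT x|lborel. - (grad (?b n) x \<bullet> x))" by simp
    also have "\<dots> = (LINT x|lborel. norm (grad (?b n) x) * norm x)"
    proof (intro Bochner_Integration.integral_cong refl)
      fix x :: 'a
      have "- (grad (?b n) x \<bullet> x) = norm (grad (?b n) x) * norm x"
        if "grad (?b n) x = (- a) *\<^sub>R x" "0 \<le> a" for a
        using that by (simp add: dot_square_norm power2_eq_square)
      moreover have "grad (?b n) x = (- (q * (x \<bullet> x + inverse (real (Suc n))) powr (q / 2 - 1) * cutoff_slope (real (Suc n) * profile q r (real (Suc n)) x - 1))) *\<^sub>R x"
        using grad_bump[of "real (Suc n)" q r x] by (simp del: of_nat_Suc)
      moreover have "0 \<le> q * (x \<bullet> x + inverse (real (Suc n))) powr (q / 2 - 1) * cutoff_slope (real (Suc n) * profile q r (real (Suc n)) x - 1)"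
        using q1 cutoff_slope_bounds(1) by (intro mult_nonneg_nonneg) auto
      ultimately show "- (grad (?b n) x \<bullet> x) = norm (grad (?b n) x) * norm x" by blast
    qed
    finally show ?thesis .
  qed
  have "(\<lambda>n. LINT x|lborel. norm (grad (?b n) x) * norm x) \<longlonglongrightarrow> (LINT x|lborel. (indicator (ball (0::'a) r) x * (q * norm x powr (q - 1))) * norm x)"
  proof (rule integral_dominated_convergence[where w="\<lambda>x. (?C * r) * indicator (ball 0 r) x"])
    show "AE x in lborel. (\<lambda>n. norm (grad (?b n) x) * norm x) \<longlonglongrightarrow> (indicator (ball (0::'a) r) x * (q * norm x powr (q - 1))) * norm x"
      by (intro AE_I2 tendsto_mult grad_bump_limit q1 r tendsto_const)
    show "AE x in lborel. norm (norm (grad (?b n) x) * norm x) \<le> (?C * r) * indicator (ball 0 r) x" for n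
    proof (rule AE_I2)
      fix x :: 'a
      have "norm (grad (?b n) x) * norm x \<le> (?C * indicator (ball 0 r) x) * norm x"
        by (intro mult_right_mono norm_grad_bump_le q1 r) auto
      also have "\<dots> \<le> (?C * r) * indicator (ball 0 r) x"
      proof (cases "norm x < r")
        case True
        then have "?C * norm x \<le> ?C * r" by (intro mult_left_mono C) simp
        then show ?thesis using True by simp
      qed simp
      finally show "norm (norm (grad (?b n) x) * norm x) \<le> (?C * r) * indicator (ball 0 r) x" by simp
    qed
  qed (use ind in \<open>auto simp del: of_nat_Suc\<close>)
  also have "(LINT x|lborel. (indicator (ball (0::'a) r) x * (q * norm x powr (q - 1))) * norm x)
      = (LINT x|lborel. q * (indicator (ball (0::'a) r) x *\<^sub>R norm x powr q))"
  proof (intro Bochner_Integration.integral_cong refl)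
    fix x :: 'a
    have "norm x powr (q - 1) * norm x = norm x powr q"
      using powr_add[of "norm x" "q - 1" 1] by (cases "x = 0") auto
    then show "(indicator (ball (0::'a) r) x * (q * norm x powr (q - 1))) * norm x
        = q * (indicator (ball (0::'a) r) x *\<^sub>R norm x powr q)"
      by (simp add: mult.assoc mult.left_commute)
  qed
  also have "\<dots> = q * ball_moment TYPE('a) q r"
    by (simp add: ball_moment_def set_lebesgue_integral_def)
  finally show "(\<lambda>n. real DIM('a) * (LINT x|lborel. ?b n x)) \<longlonglongrightarrow> q * ball_moment TYPE('a) q r"
    unfolding eq .
qed

section \<open>Torsion and principal eigenvalue\<close>

lemma admissibleD:
  assumes "\<Omega> \<in> admissible"
  shows "open \<Omega>" "\<Omega> \<in> fmeasurable lebesgue" "0 < measure lebesgue \<Omega>"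
proof -
  show o: "open \<Omega>" using assms by (simp add: admissible_def)
  have e: "0 < emeasure lebesgue \<Omega>" "emeasure lebesgue \<Omega> < \<infinity>" using assms by (auto simp: admissible_def)
  have s: "\<Omega> \<in> sets lebesgue" using o by simp
  show f: "\<Omega> \<in> fmeasurable lebesgue" by (rule fmeasurableI[OF s e(2)])
  have "0 < ennreal (measure lebesgue \<Omega>)" using e(1) unfolding emeasure_eq_measure2[OF f] .
  then show "0 < measure lebesgue \<Omega>" by (simp only: ennreal_less_zero_iff)
qed

lemma admissible_radius:
  assumes "\<Omega> \<in> admissible"
  obtains \<rho> where "0 < \<rho>" "measure lebesgue (\<Omega> :: 'a::euclidean_space set) = unit_ball_vol (real DIM('a)) * \<rho> ^ DIM('a)"
proof (rule that[of "root DIM('a) (measure lebesgue \<Omega> / unit_ball_vol (real DIM('a)))"])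
  have p: "0 < measure lebesgue \<Omega> / unit_ball_vol (real DIM('a))"
    using admissibleD(3)[OF assms] by (intro divide_pos_pos) auto
  then show "0 < root DIM('a) (measure lebesgue \<Omega> / unit_ball_vol (real DIM('a)))"
    by (intro real_root_gt_zero) auto
  have "root DIM('a) (measure lebesgue \<Omega> / unit_ball_vol (real DIM('a))) ^ DIM('a) = measure lebesgue \<Omega> / unit_ball_vol (real DIM('a))"
    using p by (intro real_root_pow_pos2) auto
  moreover have "unit_ball_vol (real DIM('a)) \<noteq> 0"
    using unit_ball_vol_pos[of "real DIM('a)"] by linarith
  ultimately show "measure lebesgue \<Omega> = unit_ball_vol (real DIM('a)) * root DIM('a) (measure lebesgue \<Omega> / unit_ball_vol (real DIM('a))) ^ DIM('a)"
    by (simp only: times_divide_eq_right) (rule nonzero_mult_div_cancel_left[symmetric])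
qed

text \<open>For \<open>1 < p\<close> and \<open>0 < \<rho>\<close> this is the torsion of a ball of
  radius \<rho>: \<open>torsion_elem_le\<close> yields the upper bound and
  \<open>torsion_const_le_torsion_ball\<close> the lower one.\<close>

definition torsion_const :: "'a::euclidean_space itself \<Rightarrow> real \<Rightarrow> real \<Rightarrow> real" where
  "torsion_const _ p \<rho> = ball_moment TYPE('a) (p / (p - 1)) \<rho> powr (p - 1) / real DIM('a) powr p"

text \<open>Stated in powers of \<open>\<rho> ^ d\<close>, which is proportional to volume: the
  dilation of Lebesgue measure gives \<open>p - 1\<close>, and the remaining
  \<open>\<rho> powr p\<close> gives \<open>p / d\<close>.\<close>

lemma torsion_const_scale:
  assumes "1 < p" "0 < \<rho>"
  shows "torsion_const TYPE('a::euclidean_space) p \<rho>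
      = (\<rho> ^ DIM('a)) powr (p - 1 + p / real DIM('a)) * torsion_const TYPE('a) p 1"
proof -
  let ?q = "p / (p - 1)" and ?d = "real DIM('a)"
  have q: "0 < ?q" using assms by simp
  have J: "0 < ball_moment TYPE('a) ?q 1" by (rule ball_moment_pos) (use q in auto)
  have d: "0 < ?d" by simp
  have "ball_moment TYPE('a) ?q \<rho> powr (p - 1)
      = (\<rho> ^ DIM('a)) powr (p - 1) * (\<rho> powr ?q) powr (p - 1) * ball_moment TYPE('a) ?q 1 powr (p - 1)"
    unfolding ball_moment_scale[OF assms(2)] using assms J by (simp add: powr_mult)
  also have "(\<rho> powr ?q) powr (p - 1) = \<rho> powr p" using assms by (simp add: powr_powr)
  also have "\<rho> powr p = (\<rho> ^ DIM('a)) powr (p / ?d)"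
    using assms d by (simp add: powr_realpow[symmetric] powr_powr)
  finally show ?thesis unfolding torsion_const_def by (simp add: powr_add)
qed

lemma torsion_elem_le:
  assumes p: "1 < p" and \<Omega>: "\<Omega> \<in> admissible"
    and \<rho>: "0 < \<rho>" "measure lebesgue (\<Omega> :: 'a::euclidean_space set) = unit_ball_vol (real DIM('a)) * \<rho> ^ DIM('a)"
    and ug: "(u, g) \<in> W0 p \<Omega>"
  shows "(L1_mass \<Omega> u) powr p * inverse (energy p \<Omega> g)
      \<le> torsion_const TYPE('a) p \<rho>"
proof -
  define G where "G = (energy p \<Omega> g)"
  define U where "U = (L1_mass \<Omega> u) powr p"
  have sv: "U \<le> torsion_const TYPE('a) p \<rho> * G" unfolding U_def G_def torsion_const_def
    using W0_saint_venant[OF ug p admissibleD(1,2)[OF \<Omega>] less_imp_le[OF \<rho>(1)] \<rho>(2)] by simp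
  have "0 \<le> G" unfolding G_def by (intro integral_nonneg_AE) simp
  have K: "0 \<le> torsion_const TYPE('a) p \<rho>" by (simp add: torsion_const_def)
  have "U * inverse G \<le> torsion_const TYPE('a) p \<rho>"
  proof (cases "G = 0")
    case False
    then show ?thesis using sv \<open>0 \<le> G\<close> by (simp add: divide_inverse[symmetric] divide_le_eq)
  \<comment> \<open>If the energy is 0, then \<open>inverse 0 = 0\<close> makes the quotient
    0.\<close>
  qed (use K in simp)
  then show ?thesis by (simp only: U_def G_def)
qed

text \<open>Without an upper bound \<open>Sup\<close> on the reals would carry no information; this
  is what makes each quotient a lower bound for \<open>torsion\<close>.\<close>

lemma torsion_bdd:
  assumes p: "1 < p" and \<Omega>: "\<Omega> \<in> admissible"
  shows "bdd_above (torsion_quotients p \<Omega>)"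
proof -
  obtain \<rho> where \<rho>: "0 < \<rho>" "measure lebesgue \<Omega> = unit_ball_vol (real DIM('a)) * \<rho> ^ DIM('a)"
    by (rule admissible_radius[OF \<Omega>])
  show ?thesis
    by (rule bdd_aboveI[of _ "torsion_const TYPE('a) p \<rho>"]) (use torsion_elem_le[OF p \<Omega> \<rho>] in blast)
qed

lemma nonzero_onI:
  assumes "open \<Omega>" "\<phi> \<in> borel_measurable borel" and z: "\<And>x. x \<notin> \<Omega> \<Longrightarrow> \<phi> x = 0"
    and nz: "(LINT x|lborel. \<bar>\<phi> x\<bar>) \<noteq> 0"
  shows "nonzero_on \<Omega> \<phi>" unfolding nonzero_on_def
proof
  assume "AE x in lebesgue_on \<Omega>. \<phi> x = 0"
  then have "(L1_mass \<Omega> \<phi>) = (\<integral>x. 0 \<partial>lebesgue_on \<Omega>)"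
    using assms(2) by (intro integral_cong_AE) (auto intro!: measurable_restrict_space1 measurable_completion)
  moreover have "(L1_mass \<Omega> \<phi>) = (LINT x|lborel. \<bar>\<phi> x\<bar>)"
    by (rule lebesgue_on_integral_lborel(1)[OF assms(1)]) (use assms(2) z in auto)
  ultimately show False using nz by simp
qed

lemma test_function_nonzero_on:
  assumes "\<phi> \<in> test_functions \<Omega>" "open \<Omega>" "(LINT x|lborel. \<bar>\<phi> x\<bar>) \<noteq> 0"
  shows "nonzero_on \<Omega> \<phi>"
  by (rule nonzero_onI[OF assms(2) test_functionsD(5)[OF assms(1)] _ assms(3)])
     (rule test_functions_outside_domain(1)[OF assms(1)])

lemma torsion_ge_test_function:
  assumes p: "1 < p" and \<Omega>: "\<Omega> \<in> admissible" and \<phi>: "\<phi> \<in> test_functions \<Omega>"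
    and nz: "(LINT x|lborel. \<bar>\<phi> x\<bar>) \<noteq> 0"
  shows "(LINT x|lborel. \<bar>\<phi> x\<bar>) powr p / (LINT x|lborel. norm (grad \<phi> x) powr p) \<le> torsion p \<Omega>"
proof -
  have p0: "0 < p" using p by simp
  note o = admissibleD(1)[OF \<Omega>]
  have "(L1_mass \<Omega> \<phi>) powr p * inverse (energy p \<Omega> (grad \<phi>)) \<le> torsion p \<Omega>" unfolding torsion_def
  proof (rule cSup_upper[OF _ torsion_bdd[OF p \<Omega>]])
    have "(\<phi>, grad \<phi>) \<in> W0 p \<Omega> \<and> nonzero_on \<Omega> \<phi>"
      using test_functions_W0[OF \<phi> o p0] test_function_nonzero_on[OF \<phi> o nz] by (rule conjI)
    then show "(L1_mass \<Omega> \<phi>) powr p * inverse (energy p \<Omega> (grad \<phi>))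
      \<in> torsion_quotients p \<Omega>" by blast
  qed
  then show ?thesis using test_functions_integral_on(2,3)[OF \<phi> o p0] by (simp add: divide_inverse)
qed

lemma bump_eventually:
  assumes p: "1 < p" and r: "0 < r"
  shows "\<forall>\<^sub>F n in sequentially. 0 < (LINT x|lborel. bump (p / (p - 1)) r (real (Suc n)) (x::'a::euclidean_space))"
proof -
  let ?q = "p / (p - 1)"
  have q: "0 < ?q" using p by simp
  have "0 < ?q * ball_moment TYPE('a) ?q r" using ball_moment_pos[OF r q, where 'a='a] q by (rule mult_pos_pos[rotated])
  from order_tendstoD(1)[OF bump_integral_limits(2)[OF p refl r, where 'a='a] this]
  show ?thesis by eventually_elim (simp add: zero_less_mult_iff del: of_nat_Suc)
qed

text \<open>A late bump for exponent 2; the choice is arbitrary, since only nonnegativity and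
  positive mass are wanted.\<close>

lemma exists_test_function:
  assumes r: "0 < r"
  obtains \<phi> where "\<phi> \<in> test_functions (ball (0::'a::euclidean_space) r)" "\<And>x. 0 \<le> \<phi> x" "0 < (LINT x|lborel. \<phi> x)"
proof -
  have "\<forall>\<^sub>F n in sequentially. 0 < (LINT x|lborel. bump (2 / (2 - 1)) r (real (Suc n)) (x::'a))"
    by (rule bump_eventually) (use r in auto)
  then obtain n where "0 < (LINT x|lborel. bump (2 / (2 - 1)) r (real (Suc n)) (x::'a))"
    by (auto simp: eventually_sequentially simp del: of_nat_Suc)
  moreover have "bump (2 / (2 - 1)) r (real (Suc n)) \<in> test_functions (ball (0::'a) r)"
    by (rule bump_test_function) (use r in auto)
  moreover have "0 \<le> bump (2 / (2 - 1)) r (real (Suc n)) x" for x :: 'a by (rule bump_nonneg) simp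
  ultimately show ?thesis using that by blast
qed

lemma ball_admissible: "0 < r \<Longrightarrow> ball (c::'a::euclidean_space) r \<in> admissible"
  using emeasure_lborel_ball_finite[of c r] content_ball_pos[of r c]
  by (simp add: admissible_def emeasure_eq_ennreal_measure)

lemma ball_translate: "(+) c ` ball (0::'a::euclidean_space) r = ball c r"
  using ball_translation[of c 0 r] by simp

text \<open>With \<open>J\<close> the moment and \<open>q\<close> the conjugate exponent, the
  quotients of the bumps tend to \<open>(q * J / d) powr p / (q powr p * J)\<close>, in which
  \<open>q\<close> cancels and \<open>J powr (p - 1) / d powr p\<close> remains. The bumps are
  centred at 0 and translated to \<open>c\<close>.\<close>

lemma torsion_const_le_torsion_ball:
  assumes p: "1 < p" and r: "0 < r"
  shows "torsion_const TYPE('a::euclidean_space) p r \<le> torsion p (ball (c::'a) r)"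
proof -
  let ?q = "p / (p - 1)" and ?d = "real DIM('a)"
  let ?J = "ball_moment TYPE('a) ?q r"
  let ?b = "\<lambda>n. bump ?q r (real (Suc n)) :: 'a \<Rightarrow> real"
  define I where "I n = (LINT x|lborel. ?b n x)" for n
  define G where "G n = (LINT x|lborel. norm (grad (?b n) x) powr p)" for n
  have q: "0 < ?q" using p by simp
  have J: "0 < ?J" by (rule ball_moment_pos[OF r q])
  have G: "G \<longlonglongrightarrow> ?q powr p * ?J" unfolding G_def[abs_def] by (rule bump_integral_limits(1)[OF p refl r])
  have I: "(\<lambda>n. ?d * I n) \<longlonglongrightarrow> ?q * ?J" unfolding I_def by (rule bump_integral_limits(2)[OF p refl r])
  have "(\<lambda>n. (?d * I n) powr p / ?d powr p / G n) \<longlonglongrightarrow> (?q * ?J) powr p / ?d powr p / (?q powr p * ?J)"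
    using J q by (intro tendsto_divide tendsto_powr I G tendsto_const) auto
  moreover have "(?q * ?J) powr p / ?d powr p / (?q powr p * ?J) = torsion_const TYPE('a) p r"
  proof -
    have "(?q * ?J) powr p = ?q powr p * ?J powr p" using powr_mult[of ?q ?J p] q J by linarith
    moreover have "?J powr p = ?J powr (p - 1) * ?J" using J powr_add[of ?J "p - 1" 1] by simp
    moreover have "0 < ?q powr p" using p by simp
    moreover have "a * (b * j) / D / (a * j) = b / D" if "0 < a" "0 < j" for a b j D :: real
      using that by simp
    ultimately show ?thesis unfolding torsion_const_def using J by metis
  qed
  ultimately have lim: "(\<lambda>n. (?d * I n) powr p / ?d powr p / G n) \<longlonglongrightarrow> torsion_const TYPE('a) p r" by metis
  have "\<forall>\<^sub>F n in sequentially. (?d * I n) powr p / ?d powr p / G n \<le> torsion p (ball c r)"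
    using bump_eventually[OF p r, where 'a='a]
  proof eventually_elim
    case (elim n)
    then have In: "0 < I n" by (simp only: I_def)
    have T: "?b n \<in> test_functions (ball 0 r)" using r q by (intro bump_test_function) auto
    have Tc: "(\<lambda>x. ?b n (x - c)) \<in> test_functions (ball c r)"
      using test_functions_translate(1)[OF T, of c] unfolding ball_translate .
    have [measurable]: "?b n \<in> borel_measurable borel" "grad (?b n) \<in> borel_measurable borel"
      by (rule test_functionsD[OF T])+
    have nn: "\<bar>?b n x\<bar> = ?b n x" for x using bump_nonneg[of "real (Suc n)" ?q r x] by (simp del: of_nat_Suc)
    have i1: "(LINT x|lborel. \<bar>?b n (x - c)\<bar>) = I n"
      unfolding nn I_def by (rule lborel_integral_translate) measurable
    have i2: "(LINT x|lborel. norm (grad (\<lambda>x. ?b n (x - c)) x) powr p) = G n"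
      unfolding test_functions_translate(2)[OF T] G_def
      by (rule lborel_integral_translate[of "\<lambda>x. norm (grad (?b n) x) powr p"]) measurable
    have "I n powr p / G n \<le> torsion p (ball c r)"
      using torsion_ge_test_function[OF p ball_admissible[OF r] Tc] In unfolding i1 i2 by simp
    moreover have "(?d * I n) powr p / ?d powr p = I n powr p" using In by (simp add: powr_mult)
    ultimately show ?case by (simp only:)
  qed
  then show ?thesis by (rule tendsto_upperbound[OF lim]) simp
qed

section \<open>Eigenvalue against torsion, and the upper bound for \<open>F\<close>\<close>

lemma eigenvalue_bdd: "bdd_below (rayleigh_quotients p \<Omega>)"
proof (rule bdd_belowI)
  fix y assume "y \<in> rayleigh_quotients p \<Omega>"
  then obtain u g where "(u, g) \<in> W0 p \<Omega>"
    "y = (energy p \<Omega> g) * inverse (Lp_mass p \<Omega> u)" by blast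
  then show "0 \<le> y" by (auto intro!: mult_nonneg_nonneg integral_nonneg_AE)
qed

text \<open>Guarantees that the sets under \<open>Sup\<close> and \<open>Inf\<close> are nonempty: a
  translated test function in a small ball inside \<Omega>.\<close>

lemma exists_nonzero_W0:
  assumes \<Omega>: "(\<Omega> :: 'a::euclidean_space set) \<in> admissible" and p: "1 < p"
  obtains u g where "(u, g) \<in> W0 p \<Omega>" "nonzero_on \<Omega> u"
proof -
  have "\<Omega> \<noteq> {}" using admissibleD(3)[OF \<Omega>] by auto
  then obtain c where "c \<in> \<Omega>" by blast
  then obtain r where r: "0 < r" "ball c r \<subseteq> \<Omega>" using admissibleD(1)[OF \<Omega>] open_contains_ball by blast
  obtain \<phi> where \<phi>: "\<phi> \<in> test_functions (ball (0::'a) r)" "\<And>x. 0 \<le> \<phi> x" "0 < (LINT x|lborel. \<phi> x)"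
    by (rule exists_test_function[OF r(1)]) blast
  have "(\<lambda>x. \<phi> (x - c)) \<in> test_functions (ball c r)"
    using test_functions_translate(1)[OF \<phi>(1), of c] unfolding ball_translate .
  then have T: "(\<lambda>x. \<phi> (x - c)) \<in> test_functions \<Omega>" using test_functions_mono[OF r(2)] by blast
  have "(LINT x|lborel. \<bar>\<phi> (x - c)\<bar>) = (LINT x|lborel. \<phi> x)"
    using \<phi>(2) lborel_integral_translate[OF test_functionsD(5)[OF \<phi>(1)], of c] by simp
  then have "nonzero_on \<Omega> (\<lambda>x. \<phi> (x - c))"
    using \<phi>(3) by (intro test_function_nonzero_on[OF T admissibleD(1)[OF \<Omega>]]) simp
  moreover have "(\<lambda>x. \<phi> (x - c), grad (\<lambda>x. \<phi> (x - c))) \<in> W0 p \<Omega>"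
    by (rule test_functions_W0[OF T admissibleD(1)[OF \<Omega>]]) (use p in simp)
  ultimately show ?thesis by (rule that[rotated])
qed

lemma eigenvalue_nonneg:
  assumes \<Omega>: "\<Omega> \<in> admissible" and p: "1 < p" shows "0 \<le> eigenvalue p \<Omega>" unfolding eigenvalue_def
proof (rule cInf_greatest)
  obtain u g where "(u, g) \<in> W0 p \<Omega>" "nonzero_on \<Omega> u" by (rule exists_nonzero_W0[OF \<Omega> p])
  then show "rayleigh_quotients p \<Omega> \<noteq> {}" by blast
  fix y assume "y \<in> rayleigh_quotients p \<Omega>"
  then obtain u g where "(u, g) \<in> W0 p \<Omega>"
    "y = (energy p \<Omega> g) * inverse (Lp_mass p \<Omega> u)" by blast
  then show "0 \<le> y" by (auto intro!: mult_nonneg_nonneg integral_nonneg_AE)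
qed

lemma W0_integral_pos:
  assumes ug: "(u, g) \<in> W0 p \<Omega>" and nz: "nonzero_on \<Omega> u"
  shows "0 < (Lp_mass p \<Omega> u)"
proof -
  have i: "integrable (lebesgue_on \<Omega>) (\<lambda>x. \<bar>u x\<bar> powr p)" using ug by (simp add: W0_def Lp_on_def)
  have "(Lp_mass p \<Omega> u) \<noteq> 0"
  proof
    assume "(Lp_mass p \<Omega> u) = 0"
    then have "AE x in lebesgue_on \<Omega>. \<bar>u x\<bar> powr p = 0"
      using integral_nonneg_eq_0_iff_AE[OF i] by simp
    then have "AE x in lebesgue_on \<Omega>. u x = 0" by (rule AE_mp) (auto intro!: AE_I2)
    then show False using nz by (simp add: nonzero_on_def)
  qed
  moreover have "0 \<le> (Lp_mass p \<Omega> u)" by (intro integral_nonneg_AE) simp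
  ultimately show ?thesis by linarith
qed

lemma torsion_le:
  assumes p: "1 < p" and \<Omega>: "(\<Omega> :: 'a::euclidean_space set) \<in> admissible"
    and le: "\<And>u g. (u, g) \<in> W0 p \<Omega> \<Longrightarrow> nonzero_on \<Omega> u \<Longrightarrow>
      (L1_mass \<Omega> u) powr p * inverse (energy p \<Omega> g) \<le> C"
  shows "torsion p \<Omega> \<le> C" unfolding torsion_def
proof (rule cSup_least)
  obtain u g where "(u, g) \<in> W0 p \<Omega>" "nonzero_on \<Omega> u" by (rule exists_nonzero_W0[OF \<Omega> p])
  then show "torsion_quotients p \<Omega> \<noteq> {}" by blast
qed (use le in blast)

lemma torsion_nonneg:
  assumes p: "1 < p" and \<Omega>: "(\<Omega> :: 'a::euclidean_space set) \<in> admissible"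
  shows "0 \<le> torsion p \<Omega>"
proof -
  obtain u g where ug: "(u, g) \<in> W0 p \<Omega>" "nonzero_on \<Omega> u" by (rule exists_nonzero_W0[OF \<Omega> p])
  have "0 \<le> (L1_mass \<Omega> u) powr p * inverse (energy p \<Omega> g)"
    by (auto intro!: mult_nonneg_nonneg integral_nonneg_AE)
  also have "\<dots> \<le> torsion p \<Omega>"
    unfolding torsion_def by (rule cSup_upper[OF _ torsion_bdd[OF p \<Omega>]]) (use ug in blast)
  finally show ?thesis .
qed

text \<open>Every competitor \<open>u\<close> of the torsion also competes for the eigenvalue: its
  energy is at least the eigenvalue times its \<open>Lp_mass\<close>, and Hoelder bounds the
  \<open>p\<close>-th power of its \<open>L1_mass\<close> by the volume factor times the same
  \<open>Lp_mass\<close>. The case of eigenvalue 0 is split off to allow division.\<close>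

lemma eigenvalue_torsion_le:
  assumes p: "1 < p" and \<Omega>: "(\<Omega> :: 'a::euclidean_space set) \<in> admissible"
  shows "eigenvalue p \<Omega> * torsion p \<Omega> \<le> measure lebesgue \<Omega> powr (p - 1)"
proof (cases "eigenvalue p \<Omega> = 0")
  case False
  then have l: "0 < eigenvalue p \<Omega>" using eigenvalue_nonneg[OF \<Omega> p] by linarith
  have "torsion p \<Omega> \<le> measure lebesgue \<Omega> powr (p - 1) / eigenvalue p \<Omega>"
  proof (rule torsion_le[OF p \<Omega>])
    fix u g assume ug: "(u, g) \<in> W0 p \<Omega>" and nz: "nonzero_on \<Omega> u"
    define A where "A = (Lp_mass p \<Omega> u)"
    define G where "G = (energy p \<Omega> g)"
    define U where "U = (L1_mass \<Omega> u) powr p"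
    define m where "m = measure lebesgue \<Omega> powr (p - 1)"
    have A: "0 < A" unfolding A_def by (rule W0_integral_pos[OF ug nz])
    have "eigenvalue p \<Omega> \<le> G * inverse A"
      unfolding eigenvalue_def G_def A_def by (rule cInf_lower[OF _ eigenvalue_bdd]) (use ug nz in blast)
    then have lG: "eigenvalue p \<Omega> * A \<le> G" using A by (simp add: field_simps)
    then have G: "0 < G" using mult_pos_pos[OF l A] by linarith
    have "U \<le> m * A" unfolding U_def m_def A_def by (rule W0_holder[OF ug p admissibleD(1,2)[OF \<Omega>]])
    then have "eigenvalue p \<Omega> * U \<le> eigenvalue p \<Omega> * (m * A)" using l by simp
    also have "\<dots> = m * (eigenvalue p \<Omega> * A)" by simp
    also have "\<dots> \<le> m * G" using lG by (intro mult_left_mono) (auto simp: m_def)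
    finally have "U * inverse G \<le> m / eigenvalue p \<Omega>" using l G by (simp add: field_simps)
    then show "(L1_mass \<Omega> u) powr p * inverse (energy p \<Omega> g)
        \<le> measure lebesgue \<Omega> powr (p - 1) / eigenvalue p \<Omega>" by (simp only: U_def G_def m_def)
  qed
  then show ?thesis using l by (simp add: field_simps)
qed simp

text \<open>By \<open>torsion_const_scale\<close> the quotient of \<open>torsion_const\<close> by
  this power of the volume does not depend on the radius, so the ball of the volume of \<Omega> can
  be replaced by the given ball.\<close>

lemma saint_venant:
  assumes p: "1 < p" and r: "0 < r" and \<Omega>: "(\<Omega> :: 'a::euclidean_space set) \<in> admissible"
  shows "torsion p \<Omega> / measure lebesgue \<Omega> powr (p - 1 + p / real DIM('a))
      \<le> torsion p (ball (c::'a) r) / measure lebesgue (ball c r) powr (p - 1 + p / real DIM('a))"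
proof -
  let ?e = "p - 1 + p / real DIM('a)" and ?\<omega> = "unit_ball_vol (real DIM('a))"
  obtain \<rho> where \<rho>: "0 < \<rho>" "measure lebesgue \<Omega> = ?\<omega> * \<rho> ^ DIM('a)"
    by (rule admissible_radius[OF \<Omega>])
  have \<omega>: "0 < ?\<omega>" by simp
  have mB: "measure lebesgue (ball c r) = ?\<omega> * r ^ DIM('a)" using r by (simp add: content_ball)
  have quot: "torsion_const TYPE('a) p s / (?\<omega> * s ^ DIM('a)) powr ?e = torsion_const TYPE('a) p 1 / ?\<omega> powr ?e"
    if s: "0 < s" for s
  proof -
    have "0 < (s ^ DIM('a)) powr ?e" using s by simp
    then show ?thesis unfolding torsion_const_scale[OF p s] using s \<omega> by (simp add: powr_mult)
  qed
  have "torsion p \<Omega> \<le> torsion_const TYPE('a) p \<rho>"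
    by (rule torsion_le[OF p \<Omega>]) (rule torsion_elem_le[OF p \<Omega> \<rho>])
  then have "torsion p \<Omega> / measure lebesgue \<Omega> powr ?e \<le> torsion_const TYPE('a) p \<rho> / measure lebesgue \<Omega> powr ?e"
    by (rule divide_right_mono) simp
  also have "\<dots> = torsion_const TYPE('a) p r / measure lebesgue (ball c r) powr ?e"
    unfolding \<rho>(2) mB quot[OF \<rho>(1)] quot[OF r] by (rule refl)
  also have "\<dots> \<le> torsion p (ball c r) / measure lebesgue (ball c r) powr ?e"
    by (intro divide_right_mono torsion_const_le_torsion_ball p r) simp
  finally show ?thesis .
qed

lemma F_le:
  assumes p: "1 < p" and q: "1 \<le> q" and r: "0 < r" and \<Omega>: "(\<Omega> :: 'a::euclidean_space set) \<in> admissible"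
  shows "F p q \<Omega> \<le> torsion p (ball (c::'a) r) powr (q - 1)
      / measure lebesgue (ball c r) powr ((q - 1) * (p - 1 + p / real DIM('a)))"
proof -
  let ?e = "p - 1 + p / real DIM('a)"
  define m where "m = measure lebesgue \<Omega>"
  define T where "T = torsion p \<Omega>"
  define l where "l = eigenvalue p \<Omega>"
  define R where "R = torsion p (ball c r) powr (q - 1) / measure lebesgue (ball c r) powr ((q - 1) * ?e)"
  have m: "0 < m" unfolding m_def by (rule admissibleD(3)[OF \<Omega>])
  have T: "0 \<le> T" unfolding T_def by (rule torsion_nonneg[OF p \<Omega>])
  have l: "0 \<le> l" unfolding l_def by (rule eigenvalue_nonneg[OF \<Omega> p])
  have "F p q \<Omega> \<le> R"
  proof (cases "T = 0")
    case True
    then show ?thesis by (simp add: F_def T_def[symmetric] R_def)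
  next
    case False
    then have T: "0 < T" using T by simp
    \<comment> \<open>This splitting of the exponent of the volume is what makes \<open>F\<close> a
      product of two scale invariant factors, bounded separately below.\<close>
    have al: "alpha p q DIM('a) = (p - 1) + (q - 1) * ?e"
      by (simp add: alpha_def algebra_simps add_divide_distrib diff_divide_distrib)
    have Tq: "T powr q = T * T powr (q - 1)" using T powr_add[of T 1 "q - 1"] by simp
    have "F p q \<Omega> = (l * T / m powr (p - 1)) * (T powr (q - 1) / m powr ((q - 1) * ?e))"
      unfolding F_def al l_def[symmetric] T_def[symmetric] m_def[symmetric] Tq powr_add by simp
    also have "T powr (q - 1) / m powr ((q - 1) * ?e) = (T / m powr ?e) powr (q - 1)"
      using T m by (simp add: powr_divide powr_powr mult.commute)
    also have "(l * T / m powr (p - 1)) * (T / m powr ?e) powr (q - 1) \<le> 1 * (T / m powr ?e) powr (q - 1)"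
    proof (rule mult_right_mono)
      have "l * T \<le> m powr (p - 1)" unfolding l_def T_def m_def by (rule eigenvalue_torsion_le[OF p \<Omega>])
      then show "l * T / m powr (p - 1) \<le> 1" using m by simp
    qed simp
    also have "\<dots> \<le> (torsion p (ball c r) / measure lebesgue (ball c r) powr ?e) powr (q - 1)"
      unfolding mult_1
    proof (rule powr_mono2)
      show "T / m powr ?e \<le> torsion p (ball c r) / measure lebesgue (ball c r) powr ?e"
        unfolding T_def m_def by (rule saint_venant[OF p r \<Omega>])
    qed (use T q in auto)
    also have "\<dots> = R"
    proof -
      have "0 \<le> torsion p (ball c r)" by (rule torsion_nonneg[OF p ball_admissible[OF r]])
      then show ?thesis unfolding R_def by (simp add: powr_divide powr_powr mult.commute)
    qed
    finally show ?thesis .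
  qed
  then show ?thesis by (simp only: R_def)
qed

text \<open>The competitors for \<open>q < 1\<close>: unit balls so far apart that every line in direction \<open>e\<close> leaves
  their union within distance 2, which keeps the eigenvalue bounded below.\<close>

definition ball_chain :: "'a::euclidean_space \<Rightarrow> nat \<Rightarrow> 'a set" where
  "ball_chain e N = (\<Union>k<N. ball ((10 * real k) *\<^sub>R e) 1)"

text \<open>Distinct centres are at least 10 apart, more than \<open>3 + 1\<close>. The radius 3
  leaves room for a unit ball shifted by a vector of length 2.\<close>

lemma ball_chain_disjoint:
  assumes e: "norm e = 1" and "x \<in> ball ((10 * real k) *\<^sub>R e) 3" "x \<in> ball ((10 * real j) *\<^sub>R e) 1"
  shows "k = j"
proof (rule ccontr)
  assume "k \<noteq> j"
  then have ge: "1 \<le> \<bar>real k - real j\<bar>" by linarith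
  have "(10 * real k) *\<^sub>R e - (10 * real j) *\<^sub>R e = (10 * (real k - real j)) *\<^sub>R e"
    by (simp add: algebra_simps)
  then have nrm: "norm ((10 * real k) *\<^sub>R e - (10 * real j) *\<^sub>R e) = 10 * \<bar>real k - real j\<bar>"
    by (simp only: norm_scaleR e abs_mult abs_numeral mult_1_right)
  have "norm ((10 * real k) *\<^sub>R e - (10 * real j) *\<^sub>R e) < 3 + 1"
    using assms(2,3) dist_triangle_less_add[of "(10 * real k) *\<^sub>R e" x 3 "(10 * real j) *\<^sub>R e" 1]
    by (simp add: dist_norm[symmetric] dist_commute)
  then have "10 * \<bar>real k - real j\<bar> < 3 + 1" unfolding nrm .
  then show False using ge by simp
qed

text \<open>Two points of one open unit ball are at distance less than 2, so the shifted point
  leaves its own ball; it stays within distance 3 of that centre and thus cannot enter another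
  ball.\<close>

lemma ball_chain_gap:
  assumes e: "norm e = 1" and x: "x \<in> ball_chain e N"
  shows "x + 2 *\<^sub>R e \<notin> ball_chain e N"
proof
  assume "x + 2 *\<^sub>R e \<in> ball_chain e N"
  then obtain j where j: "x + 2 *\<^sub>R e \<in> ball ((10 * real j) *\<^sub>R e) 1" unfolding ball_chain_def by blast
  obtain k where k: "x \<in> ball ((10 * real k) *\<^sub>R e) 1" using x unfolding ball_chain_def by blast
  let ?z = "(10 * real k) *\<^sub>R e"
  have "dist ?z (x + 2 *\<^sub>R e) \<le> dist ?z x + dist x (x + 2 *\<^sub>R e)" by (rule dist_triangle)
  also have "dist x (x + 2 *\<^sub>R e) = 2" using e by (simp add: dist_norm)
  finally have "x + 2 *\<^sub>R e \<in> ball ?z 3" using k by simp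
  from ball_chain_disjoint[OF e this j] have "k = j" .
  then have "dist x (x + 2 *\<^sub>R e) < 1 + 1"
    using j k dist_triangle_less_add[of x ?z 1 "x + 2 *\<^sub>R e" 1] by (simp add: dist_commute)
  then show False using e by (simp add: dist_norm)
qed

lemma measure_ball_chain:
  assumes e: "norm (e :: 'a::euclidean_space) = 1"
  shows "measure lebesgue (ball_chain e N) = real N * unit_ball_vol (real DIM('a))"
    and "ball_chain e N \<in> fmeasurable lebesgue"
proof -
  show fm: "ball_chain e N \<in> fmeasurable lebesgue"
    unfolding ball_chain_def by (intro fmeasurable.finite_UN) auto
  have "measure lebesgue (ball_chain e N) = (\<Sum>k<N. measure lebesgue (ball ((10 * real k) *\<^sub>R e) 1))"
    unfolding ball_chain_def
  proof (rule measure_UNION')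
    show "pairwise (\<lambda>k j. disjnt (ball ((10 * real k) *\<^sub>R e) 1) (ball ((10 * real j) *\<^sub>R e) 1)) {..<N}"
    proof (rule pairwiseI)
      fix k j :: nat assume "k \<noteq> j"
      then show "disjnt (ball ((10 * real k) *\<^sub>R e) 1) (ball ((10 * real j) *\<^sub>R e) 1)"
        using ball_chain_disjoint[OF e, of _ k j] unfolding disjnt_iff by force
    qed
  qed auto
  also have "\<dots> = real N * unit_ball_vol (real DIM('a))" by (simp add: content_ball)
  finally show "measure lebesgue (ball_chain e N) = real N * unit_ball_vol (real DIM('a))" .
qed

lemma ball_chain_admissible:
  assumes e: "norm (e :: 'a::euclidean_space) = 1" and N: "0 < N"
  shows "ball_chain e N \<in> admissible"
proof -
  have "0 < measure lebesgue (ball_chain e N)"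
    unfolding measure_ball_chain(1)[OF e] using N by (intro mult_pos_pos) auto
  then have "0 < emeasure lebesgue (ball_chain e N)"
    unfolding emeasure_eq_measure2[OF measure_ball_chain(2)[OF e]] by (simp only: ennreal_less_zero_iff)
  moreover have "emeasure lebesgue (ball_chain e N) < \<infinity>"
    using measure_ball_chain(2)[OF e] unfolding fmeasurable_def mem_Collect_eq by (rule conjunct2)
  moreover have "open (ball_chain e N)" unfolding ball_chain_def by (intro open_UN) auto
  ultimately show ?thesis unfolding admissible_def by blast
qed

text \<open>The Poincare inequality with gap length 2, whence a bound independent of
  \<open>N\<close>.\<close>

lemma eigenvalue_ball_chain:
  assumes p: "1 < p" and e: "norm (e :: 'a::euclidean_space) = 1" and N: "0 < N"
  shows "inverse (2 powr p) \<le> eigenvalue p (ball_chain e N)" unfolding eigenvalue_def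
proof (rule cInf_greatest)
  note \<Omega> = ball_chain_admissible[OF e N]
  obtain u g where "(u, g) \<in> W0 p (ball_chain e N)" "nonzero_on (ball_chain e N) u" by (rule exists_nonzero_W0[OF \<Omega> p])
  then show "rayleigh_quotients p (ball_chain e N) \<noteq> {}" by blast
  fix y assume "y \<in> rayleigh_quotients p (ball_chain e N)"
  then obtain u g where y: "y = (energy p (ball_chain e N) g) * inverse (Lp_mass p (ball_chain e N) u)"
    and ug: "(u, g) \<in> W0 p (ball_chain e N)" and nz: "nonzero_on (ball_chain e N) u" by blast
  define A where "A = (Lp_mass p (ball_chain e N) u)"
  define G where "G = (energy p (ball_chain e N) g)"
  have A: "0 < A" unfolding A_def by (rule W0_integral_pos[OF ug nz])
  have le: "A \<le> 2 powr p * G" unfolding A_def G_def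
    by (rule W0_poincare[OF ug p admissibleD(1,2)[OF \<Omega>] _ e ball_chain_gap[OF e]]) simp
  have "A / 2 powr p \<le> G" using le by (simp add: pos_divide_le_eq mult.commute)
  then have "inverse (2 powr p) * A \<le> G" by (simp add: divide_inverse mult.commute)
  then have "inverse (2 powr p) \<le> G * inverse A" using A by (simp add: field_simps)
  then show "inverse (2 powr p) \<le> y" unfolding y A_def G_def .
qed

text \<open>The sum of \<open>N\<close> translates of one test function has mass
  \<open>N * I\<close> and, by disjointness of the supports, energy \<open>N * G\<close>; its
  quotient is \<open>N powr (p - 1)\<close> times that of a single copy.\<close>

lemma torsion_ball_chain:
  assumes p: "1 < p" and e: "norm (e :: 'a::euclidean_space) = 1"
  obtains t where "0 < t" "\<And>N. 0 < N \<Longrightarrow> real N powr (p - 1) * t \<le> torsion p (ball_chain e N)"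
proof -
  have p0: "0 < p" using p by simp
  obtain \<phi> where \<phi>: "\<phi> \<in> test_functions (ball (0::'a) 1)" "\<And>x. 0 \<le> \<phi> x" "0 < (LINT x|lborel. \<phi> x)"
    by (rule exists_test_function[of 1]) auto
  have [measurable]: "\<phi> \<in> borel_measurable borel" "grad \<phi> \<in> borel_measurable borel"
    by (rule test_functionsD[OF \<phi>(1)])+
  define I where "I = (LINT x|lborel. \<phi> x)"
  define G where "G = (LINT x|lborel. norm (grad \<phi> x) powr p)"
  have I: "0 < I" using \<phi>(3) by (simp add: I_def)
  have abs: "\<bar>\<phi> x\<bar> = \<phi> x" for x using \<phi>(2) by simp
  \<comment> \<open>Positive energy comes from the Saint-Venant bound: energy 0 would force mass
    0.\<close>
  have G: "0 < G"
  proof -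
    have "(LINT x|lborel. \<bar>\<phi> x\<bar>) powr p \<le> torsion_const TYPE('a) p 1 * G"
      unfolding G_def torsion_const_def
      using saint_venant_test_functions[OF \<phi>(1) _ p, of 1] emeasure_lborel_ball_finite[of "0::'a" 1]
      by (simp add: fmeasurable_def content_ball)
    moreover have "0 < (LINT x|lborel. \<bar>\<phi> x\<bar>) powr p" unfolding abs using \<phi>(3) by simp
    ultimately have "0 < torsion_const TYPE('a) p 1 * G" by linarith
    moreover have "0 \<le> G" unfolding G_def by (intro integral_nonneg_AE) simp
    ultimately show ?thesis by (cases "G = 0") auto
  qed
  show ?thesis
  proof (rule that[of "I powr p / G"])
    show "0 < I powr p / G" using I G by simp
    fix N :: nat assume N: "0 < N"
    define c where "c k = (10 * real k) *\<^sub>R e" for k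
    define f where "f k x = \<phi> (x - c k)" for k x
    have f_ball: "f k \<in> test_functions (ball (c k) 1)" for k
      unfolding f_def[abs_def] using test_functions_translate(1)[OF \<phi>(1), of "c k"] unfolding ball_translate .
    have sub: "ball (c k) 1 \<subseteq> ball_chain e N" if "k < N" for k
      using that unfolding ball_chain_def c_def by blast
    have f: "f k \<in> test_functions (ball_chain e N)" if "k \<in> {..<N}" for k
      using f_ball[of k] test_functions_mono[OF sub[of k]] that by auto
    have gf: "grad (f k) x = grad \<phi> (x - c k)" for k x
      unfolding f_def[abs_def] by (rule test_functions_translate(2)[OF \<phi>(1)])
    define u where "u x = (\<Sum>k<N. f k x)" for x
    have u: "u \<in> test_functions (ball_chain e N)"
      unfolding u_def[abs_def] by (rule test_functions_sum(1)[OF finite_lessThan f])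
    have gu: "grad u x = (\<Sum>k<N. grad (f k) x)" for x
      unfolding u_def[abs_def] by (rule test_functions_sum(2)[OF finite_lessThan f])
    have f1: "(LINT x|lborel. f k x) = I" for k
      unfolding f_def I_def by (rule lborel_integral_translate) measurable
    have f2: "(LINT x|lborel. norm (grad (f k) x) powr p) = G" for k
      unfolding gf G_def by (rule lborel_integral_translate[of "\<lambda>x. norm (grad \<phi> x) powr p"]) measurable
    have i1: "integrable lborel (f k)" for k
    proof -
      have "\<bar>f k x\<bar> = f k x" for x using \<phi>(2) by (simp add: f_def)
      then show ?thesis using test_functions_integrable(3)[OF f_ball p0, of k] by simp
    qed
    have i2: "integrable lborel (\<lambda>x. norm (grad (f k) x) powr p)" for k
      by (rule test_functions_integrable(2)[OF f_ball p0])
    have "\<bar>u x\<bar> = u x" for x unfolding u_def f_def using \<phi>(2) by (intro abs_of_nonneg sum_nonneg) auto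
    then have U: "(LINT x|lborel. \<bar>u x\<bar>) = real N * I" using i1 by (simp add: u_def f1)
    \<comment> \<open>At each point at most one summand has a nonzero gradient, so the power of the
      norm of the sum is the sum of the powers.\<close>
    have "norm (grad u x) powr p = (\<Sum>k<N. norm (grad (f k) x) powr p)" for x
    proof (cases "\<exists>j<N. x \<in> ball (c j) 1")
      case True
      then obtain j where j: "j < N" "x \<in> ball (c j) 1" by blast
      have z: "grad (f k) x = 0" if "k \<noteq> j" for k
      proof (rule test_functions_outside_domain(2)[OF f_ball])
        show "x \<notin> ball (c k) 1"
        proof
          assume "x \<in> ball (c k) 1"
          then have "x \<in> ball (c k) 3" by auto
          then show False using ball_chain_disjoint[OF e, of x k j] j(2) that unfolding c_def by blast
        qed
      qed
      have "grad u x = (\<Sum>k<N. if k = j then grad (f j) x else 0)"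
        unfolding gu by (intro sum.cong refl) (auto simp: z)
      moreover have "(\<Sum>k<N. norm (grad (f k) x) powr p) = (\<Sum>k<N. if k = j then norm (grad (f j) x) powr p else 0)"
        by (intro sum.cong refl) (auto simp: z)
      ultimately show ?thesis using j(1) by simp
    next
      case False
      then have z: "grad (f k) x = 0" if "k < N" for k
        using that by (intro test_functions_outside_domain(2)[OF f_ball]) blast
      have "grad u x = 0" unfolding gu by (intro sum.neutral) (auto simp: z)
      moreover have "(\<Sum>k<N. norm (grad (f k) x) powr p) = 0" by (intro sum.neutral) (auto simp: z)
      ultimately show ?thesis by simp
    qed
    then have V: "(LINT x|lborel. norm (grad u x) powr p) = real N * G" using i2 by (simp add: f2)
    have NI: "0 < real N * I" using N I by simp
    have "real N powr (p - 1) * (I powr p / G) = (real N * I) powr p / (real N * G)"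
    proof -
      have "real N powr p = real N powr (p - 1) * real N" using N powr_add[of "real N" "p - 1" 1] by simp
      then show ?thesis using N I G by (simp add: powr_mult)
    qed
    also have "\<dots> \<le> torsion p (ball_chain e N)"
      by (rule torsion_ge_test_function[OF p ball_chain_admissible[OF e N] u, unfolded U V]) (use NI in linarith)
    finally show "real N powr (p - 1) * (I powr p / G) \<le> torsion p (ball_chain e N)" .
  qed
qed

text \<open>The bounds on eigenvalue and torsion give \<open>F \<ge> K * N powr s\<close> with
  \<open>s = (p - 1) * q - alpha p q d = p * (1 - q) / d > 0\<close>.\<close>

lemma F_ball_chain_unbounded:
  assumes p: "1 < p" and q: "0 < q" "q < 1" and e: "norm (e :: 'a::euclidean_space) = 1"
  obtains N where "0 < N" "C < F p q (ball_chain e N)"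
proof -
  let ?\<omega> = "unit_ball_vol (real DIM('a))" and ?a = "alpha p q DIM('a)"
  obtain t where t: "0 < t" "\<And>N. 0 < N \<Longrightarrow> real N powr (p - 1) * t \<le> torsion p (ball_chain e N)"
    by (rule torsion_ball_chain[OF p e]) blast
  define K where "K = inverse (2 powr p) * t powr q / ?\<omega> powr ?a"
  have \<omega>: "0 < ?\<omega>" by simp
  have K: "0 < K"
    unfolding K_def using t(1) by (intro divide_pos_pos mult_pos_pos) (simp_all add: less_imp_neq[OF \<omega>, symmetric])
  define s where "s = p * (1 - q) / real DIM('a)"
  have s: "0 < s" unfolding s_def using p q by simp
  \<comment> \<open>The maximum with 1 makes \<open>M\<close> positive for every \<open>C\<close>,
    so that the powers \<open>1 / s\<close> and \<open>s\<close> undo each other.\<close>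
  define M where "M = max 1 (C / K)"
  have M: "1 \<le> M" "C / K \<le> M" by (auto simp: M_def)
  obtain N where n: "M powr (1 / s) < real N" using reals_Archimedean2 by blast
  have N: "0 < N" using n by (cases N) (auto simp: not_less)
  have "M = (M powr (1 / s)) powr s" using M s by (simp add: powr_powr)
  also have "\<dots> < real N powr s" using n s by (intro powr_less_mono2) auto
  finally have "C / K < real N powr s" using M by linarith
  then have "C < K * real N powr s" using K by (simp add: field_simps)
  also have "\<dots> = inverse (2 powr p) * (real N powr (p - 1) * t) powr q / (real N * ?\<omega>) powr ?a"
  proof -
    have al: "(p - 1) * q - ?a = s" unfolding alpha_def s_def by (simp add: field_simps)
    have "(real N powr (p - 1) * t) powr q = real N powr ((p - 1) * q) * t powr q"
      using t(1) by (simp add: powr_mult powr_powr)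
    moreover have "real N powr ((p - 1) * q) = real N powr s * real N powr ?a"
      unfolding al[symmetric] powr_add[symmetric] by simp
    moreover have "(real N * ?\<omega>) powr ?a = real N powr ?a * ?\<omega> powr ?a" using \<omega> by (simp add: powr_mult)
    moreover have "0 < real N powr ?a" using N by simp
    ultimately show ?thesis unfolding K_def by simp
  qed
  also have "\<dots> \<le> F p q (ball_chain e N)" unfolding F_def measure_ball_chain(1)[OF e]
  proof (intro divide_right_mono mult_mono)
    show "inverse (2 powr p) \<le> eigenvalue p (ball_chain e N)" by (rule eigenvalue_ball_chain[OF p e N])
    show "(real N powr (p - 1) * t) powr q \<le> torsion p (ball_chain e N) powr q"
      using t q N by (intro powr_mono2) auto
    show "0 \<le> eigenvalue p (ball_chain e N)" by (rule eigenvalue_nonneg[OF ball_chain_admissible[OF e N] p])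
  qed auto
  finally show ?thesis using that N by blast
qed

theorem proposition2p3:
  fixes p q r :: real and c :: "'a::euclidean_space" and B :: "'a set"
  assumes "1 < p" and "0 < r" and "B = ball c r"
  shows "(0 < q \<and> q < 1 \<longrightarrow> (SUP \<Omega>\<in>(admissible :: 'a set set). ereal (F p q \<Omega>)) = \<infinity>) \<and>
         (1 \<le> q \<longrightarrow> (SUP \<Omega>\<in>(admissible :: 'a set set). ereal (F p q \<Omega>))
            \<le> ereal (torsion p B powr (q - 1)
                / measure lebesgue B powr ((q - 1) * (p - 1 + p / real DIM('a)))))"
proof (intro conjI impI)
  assume q: "0 < q \<and> q < 1"
  obtain e :: 'a where "e \<in> Basis" using nonempty_Basis by blast
  then have e: "norm e = 1" by simp
  show "(SUP \<Omega>\<in>(admissible :: 'a set set). ereal (F p q \<Omega>)) = \<infinity>"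
  proof (rule SUP_PInfty)
    fix n :: nat
    obtain N where "0 < N" "real n < F p q (ball_chain e N)"
      using F_ball_chain_unbounded[OF assms(1) _ _ e] q by metis
    then show "\<exists>\<Omega>\<in>(admissible :: 'a set set). ereal (real n) \<le> ereal (F p q \<Omega>)"
      using ball_chain_admissible[OF e] by (intro bexI[of _ "ball_chain e N"]) auto
  qed
next
  assume "1 \<le> q"
  then show "(SUP \<Omega>\<in>(admissible :: 'a set set). ereal (F p q \<Omega>))
      \<le> ereal (torsion p B powr (q - 1) / measure lebesgue B powr ((q - 1) * (p - 1 + p / real DIM('a))))"
    unfolding assms(3) by (intro SUP_least) (simp only: ereal_less_eq F_le[OF assms(1) _ assms(2)])
qed

end
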